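(* Let $m\in\mathbb{N}$, $\sigma\ge 0$, $t_0\ge 0$, and consider the system $$\dot y(t)=f(\mathbf{T}(y)(t))+g(\mathbf{T}(y)(t))\,u(t),\qquad y|_{[t_0-\sigma,t_0]}=y^0,$$ with $(f,g,\mathbf{T})\in\mathcal{N}^m$ and initial data $y^0\in\mathcal{C}([t_0-\sigma,t_0],\mathbb{R}^m)$. Let $\psi\in\mathcal{G}$ and $y_{\mathrm{ref}}\in W^{1,\infty}(\mathbb{R}_{\ge 0},\mathbb{R}^m)$. Then there exist $u_{\max}>0$ and $\tau>0$ such that the sampled-data MPC algorithm described in the context, with $T>0$ and $\delta>0$, is initially and recursively feasible, i.e., at time $\hat t=t_0$ and at each successor time $\hat t\in t_0+\delta\mathbb{N}$ the optimal control problem $$\operatorname*{minimize}_{u\in\mathcal{T}_{\mathcal{P}}([\hat t,\hat t+T],\mathbb{R}^m),\ \|u\|_\infty\le u_{\max}}\ \int_{\hat t}^{\hat t+T}\ell\bigl(t,y(t;\hat t,\hat y,u),u(t)\bigr)\,dt$$ has a solution. In particular, the closed-loop system consisting of the system and the MPC feedback $\mu$ has a (not necessarily unique) global solution $y:[t_0,\infty)\to\mathbb{R}^m$, and the corresponding input is given by $$u_{\mathrm{MPC}}(t)=\mu(t,y|_{[t_0-\sigma,\hat t]}).$$ Furthermore, each global solution $y$ with corresponding input $u_{\mathrm{MPC}}$ satisfies: (i) $\|u_{\mathrm{MPC}}(t)\|\le u_{\max}$ for all $t\ge t_0$; (ii) the error $e=y-y_{\mathrm{ref}}$ evolves within the error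 boundaries $\mathcal{F}_\psi=\{(t,e)\in\mathbb{R}_{\ge0}\times\mathbb{R}^m : \|e\|\le\psi(t)\}$, i.e., $\|e(t)\|\le\psi(t)$ for all $t\ge t_0$.
   Context: Notation. $\mathbb{N}_0=\mathbb{N}\cup\{0\}$, $\mathbb{R}_{\ge0}=[0,\infty)$, $\|\cdot\|$ is the Euclidean norm, $\|\cdot\|_\infty$ the essential supremum norm. $W^{1,\infty}(I,\mathbb{R}^n)$ is the space of weakly differentiable functions $h:I\to\mathbb{R}^n$ with $h,\dot h\in L^\infty(I,\mathbb{R}^n)$. $L^\infty_{\mathrm{loc}}$ denotes measurable, locally essentially bounded functions. If $\sigma=0$, then $y|_{[t_0-\sigma,t_0]}$ means $y(t_0)$ and $\mathcal{C}([t_0-\sigma,t_0],\mathbb{R}^m)$ means $\mathbb{R}^m$. The set of funnel functions is $\mathcal{G}=\{\psi\in W^{1,\infty}(\mathbb{R}_{\ge0},\mathbb{R}) : \inf_{s\ge0}\psi(s)>0\}$. Operator class. For $m,q\in\mathbb{N}$, $\sigma\ge0$, the set $\mathcal{T}^{m,q}_\sigma$ consists of the operators $\mathbf{T}:\mathcal{C}([t_0-\sigma,\infty),\mathbb{R}^m)\to L^\infty_{\mathrm{loc}}(\mathbb{R}_{\ge0},\mathbb{R}^q)$ such that: - (Causality) for all $y_1,y_2\in\mathcal{C}([t_0-\sigma,\infty),\mathbb{R}^m)$ and all $t\ge t_0$: $y_1|_{[t_0-\sigma,t]}=y_2|_{[t_0-\sigma,t]}$ implies $\mathbf{T}(y_1)|_{[t_0,t]}=\mathbf{T}(y_2)|_{[t_0,t]}$.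 - (Local Lipschitz) for all $t\ge t_0$ and all $y\in\mathcal{C}([t_0-\sigma,t],\mathbb{R}^m)$ there exist $\Delta,\delta,c>0$ such that for all $y_1,y_2\in\mathcal{C}([t_0-\sigma,\infty),\mathbb{R}^m)$ with $y_i|_{[t_0-\sigma,t]}=y$ and $\|y_i(s)-y(t)\|<\delta$ for all $s\in[t,t+\Delta]$, $i=1,2$: $\operatorname{ess\,sup}_{s\in[t,t+\Delta]}\|\mathbf{T}(y_1)(s)-\mathbf{T}(y_2)(s)\|\le c\sup_{s\in[t,t+\Delta]}\|y_1(s)-y_2(s)\|$. (The authors describe this condition as a technical one that guarantees existence and uniqueness of solutions.) - (Bounded-input bounded-output) for all $c_0>0$ there exists $c_1>0$ such that for all $y\in\mathcal{C}([t_0-\sigma,\infty),\mathbb{R}^m)$: $\sup_{t\ge t_0-\sigma}\|y(t)\|\le c_0$ implies $\sup_{t\ge t_0}\|\mathbf{T}(y)(t)\|\le c_1$. System class. $(f,g,\mathbf{T})\in\mathcal{N}^m$ means that for some $q\in\mathbb{N}$ and $\sigma\ge0$ (the memory of the system): $f\in\mathcal{C}(\mathbb{R}^q,\mathbb{R}^m)$, $g\in\mathcal{C}(\mathbb{R}^q,\mathbb{R}^{m\times m})$, $\mathbf{T}\in\mathcal{T}^{m,q}_\sigma$, and $\langle z,g(\xi)z\rangle>0$ for all $\xi\in\mathbb{R}^q$ and all $z\in\mathbb{R}^m\setminus\{0\}$. Solutions. For a control $u\in L^\infty_{\mathrm{loc}}(\mathbb{R}_{\ge0},\mathbb{R}^m)$,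 a solution (in the sense of Carathéodory) is a function $y:[t_0-\sigma,\omega)\to\mathbb{R}^m$, $\omega>t_0$, with $y|_{[t_0-\sigma,t_0]}=y^0$ such that $y|_{[t_0,\omega)}$ is absolutely continuous and satisfies the differential equation for almost all $t\in[t_0,\omega)$. A solution is maximal if it has no right extension that is also a solution. A maximal solution is called the response associated with $u$ and is denoted $y(\cdot;t_0,y^0,u)$. Analogously, $y(\cdot;\hat t,\hat y,u)$ denotes the response from time $\hat t\ge t_0$ with history $\hat y\in\mathcal{C}([t_0-\sigma,\hat t],\mathbb{R}^m)$. Stage cost. Let $\tilde\ell\in\mathcal{C}(\mathbb{R}_{\ge0}\times\mathbb{R}^m\times\mathbb{R}^m,\mathbb{R}_{\ge0})$. Then $\ell(t,y,u)=\tilde\ell(t,y,u)$ if $\|y-y_{\mathrm{ref}}(t)\|\le\psi(t)$, and $\ell(t,y,u)=\infty$ otherwise. Partitions and step functions. For an interval $I=[a,b]$ with $b>a$ or $I=[a,\infty)$, $I\subset\mathbb{R}_{\ge0}$, a partition of $I$ is a strictly increasing sequence $\mathcal{P}=(t_k)_{k\in\mathbb{N}_0}$ with first element $a$ and $t_k\to\infty$; $|\mathcal{P}|=\sup_{i\in\mathbb{N}_0}(t_{i+1}-t_i)$. $\mathcal{T}_{\mathcal{P}}(I,\mathbb{R}^m)$ is the set of functions $I\to\mathbb{R}^m$ that are constant on each $[t_i,t_{i+1})\cap I$, $i\in\mathbb{N}_0$. (For $I=[\hat t,\hat t+T]$ with $\hat t$ a point of a partition $\mathcal{P}$ of $[t_0,\infty)$,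 the points of $\mathcal{P}$ from $\hat t$ on are used.) Sampled-data MPC algorithm. Given: the system, a reference $y_{\mathrm{ref}}\in W^{1,\infty}(\mathbb{R}_{\ge0},\mathbb{R}^m)$, a funnel function $\psi\in\mathcal{G}$, a control bound $u_{\max}>0$, a maximal step length $\tau>0$ of the control signal, and initial data $y^0\in\mathcal{C}([t_0-\sigma,t_0],\mathbb{R}^m)$. Set the time shift $\delta>0$ and the prediction horizon $T\ge\delta$, initialize the current time $\hat t=t_0$, and choose a partition $\mathcal{P}=(t_k)_{k\in\mathbb{N}_0}$ of $[t_0,\infty)$ with $|\mathcal{P}|\le\tau$ which contains $(t_0+k\delta)_{k\in\mathbb{N}_0}$ as a subsequence. Steps: (1) obtain a measurement of the output $y$ on $[t_0-\sigma,\hat t]$ and set $\hat y:=y|_{[t_0-\sigma,\hat t]}$; (2) compute a solution $u^\star\in\mathcal{T}_{\mathcal{P}}([\hat t,\hat t+T],\mathbb{R}^m)$ of the optimal control problem stated in the claim; (3) apply the sampled-data control signal $\mu:[\hat t,\hat t+\delta)\times\mathcal{C}([t_0-\sigma,\hat t],\mathbb{R}^m)\to\mathbb{R}^m$ defined by $\mu(t,\hat y)=u^\star(t)$ to the system, increase $\hat t$ by $\delta$, and go to (1).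
   Formalization: Two assumptions added, without which the claim fails: ‖y⁰(t₀)−y_ref(t₀)‖≤ψ(t₀), and T is continuous from C([t₀−σ,t]) to L¹([t₀,t]) for every t≥t₀; as responses need not be unique, the problem minimizes over controls with a response, and the loop follows the optimal pair's response. *)

theory Defs
  imports "HOL-Analysis.Analysis" "HOL-Probability.Essential_Supremum"
begin

section \<open>Function spaces\<close>

definition norm_Linf :: "real set \<Rightarrow> (real \<Rightarrow> 'a::euclidean_space) \<Rightarrow> ereal" where
  "norm_Linf I h = esssup (lebesgue_on I) (\<lambda>t. ereal (norm (h t)))"

definition Linf :: "real set \<Rightarrow> (real \<Rightarrow> 'a::euclidean_space) set" where
  "Linf I = {h. h \<in> borel_measurable (lebesgue_on I) \<and> norm_Linf I h < \<infinity>}"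

definition Linf_loc :: "real set \<Rightarrow> (real \<Rightarrow> 'a::euclidean_space) set" where
  "Linf_loc I = {h. h \<in> borel_measurable (lebesgue_on I) \<and>
                    (\<forall>K. compact K \<and> K \<subseteq> I \<longrightarrow> norm_Linf K h < \<infinity>)}"

definition test_function :: "real set \<Rightarrow> (real \<Rightarrow> real) \<Rightarrow> bool" where
  "test_function I \<phi> \<longleftrightarrow>
     \<phi> differentiable_on UNIV \<and> continuous_on UNIV (deriv \<phi>) \<and>
     (\<exists>K. compact K \<and> K \<subseteq> interior I \<and> (\<forall>t. t \<notin> K \<longrightarrow> \<phi> t = 0))"

definition weak_derivative :: "real set \<Rightarrow> (real \<Rightarrow> 'a::euclidean_space) \<Rightarrow> (real \<Rightarrow> 'a) \<Rightarrow> bool" where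
  "weak_derivative I h h' \<longleftrightarrow>
     (\<forall>\<phi>. test_function I \<phi> \<longrightarrow>
        (LINT t|lebesgue_on I. deriv \<phi> t *\<^sub>R h t) = - (LINT t|lebesgue_on I. \<phi> t *\<^sub>R h' t))"

text \<open>Elements of the Sobolev space are identified with their continuous representatives,
  because they are evaluated pointwise.\<close>

definition W1inf :: "real set \<Rightarrow> (real \<Rightarrow> 'a::euclidean_space) set" where
  "W1inf I = {h. continuous_on I h \<and> h \<in> Linf I \<and> (\<exists>h'. h' \<in> Linf I \<and> weak_derivative I h h')}"

definition funnel_functions :: "(real \<Rightarrow> real) set" where
  "funnel_functions = {\<psi>. \<psi> \<in> W1inf {0..} \<and> 0 < (INF s\<in>{0..}. \<psi> s)}"

definition abs_continuous_on :: "real \<Rightarrow> real \<Rightarrow> (real \<Rightarrow> 'a::euclidean_space) \<Rightarrow> bool" where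
  "abs_continuous_on a b y \<longleftrightarrow>
     (\<forall>\<epsilon>>0. \<exists>\<eta>>0. \<forall>D S. D division_of S \<and> S \<subseteq> {a..b} \<and> (\<Sum>k\<in>D. Sup k - Inf k) < \<eta> \<longrightarrow>
        (\<Sum>k\<in>D. norm (y (Sup k) - y (Inf k))) < \<epsilon>)"

section \<open>Operators and systems\<close>

text \<open>An operator acts on total functions, but only its effect on functions continuous on
  \<open>[t0 - \<sigma>, \<infinity>)\<close> is constrained. Causality makes \<open>Op y\<close> on \<open>[t0, \<infinity>)\<close> independent (almost
  everywhere) of the values of \<open>y\<close> outside \<open>[t0 - \<sigma>, \<infinity>)\<close>.\<close>

type_synonym ('m, 'q) operator = "(real \<Rightarrow> real^'m) \<Rightarrow> real \<Rightarrow> real^'q"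

definition causal_op :: "real \<Rightarrow> real \<Rightarrow> ('m::finite, 'q::finite) operator \<Rightarrow> bool" where
  "causal_op t0 \<sigma> Op \<longleftrightarrow>
     (\<forall>y1 y2 t. continuous_on {t0 - \<sigma>..} y1 \<and> continuous_on {t0 - \<sigma>..} y2 \<and> t0 \<le> t \<and>
        (\<forall>s\<in>{t0 - \<sigma>..t}. y1 s = y2 s) \<longrightarrow>
        (AE s in lebesgue_on {t0..t}. Op y1 s = Op y2 s))"

definition locally_lipschitz_op :: "real \<Rightarrow> real \<Rightarrow> ('m::finite, 'q::finite) operator \<Rightarrow> bool" where
  "locally_lipschitz_op t0 \<sigma> Op \<longleftrightarrow>
     (\<forall>t\<ge>t0. \<forall>y. continuous_on {t0 - \<sigma>..t} y \<longrightarrow>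
        (\<exists>\<Delta>>0. \<exists>\<delta>>0. \<exists>c>0. \<forall>y1 y2.
           continuous_on {t0 - \<sigma>..} y1 \<and> continuous_on {t0 - \<sigma>..} y2 \<and>
           (\<forall>s\<in>{t0 - \<sigma>..t}. y1 s = y s \<and> y2 s = y s) \<and>
           (\<forall>s\<in>{t..t + \<Delta>}. norm (y1 s - y t) < \<delta> \<and> norm (y2 s - y t) < \<delta>) \<longrightarrow>
           norm_Linf {t..t + \<Delta>} (\<lambda>s. Op y1 s - Op y2 s)
             \<le> ereal (c * (SUP s\<in>{t..t + \<Delta>}. norm (y1 s - y2 s)))))"

definition bibo_op :: "real \<Rightarrow> real \<Rightarrow> ('m::finite, 'q::finite) operator \<Rightarrow> bool" where
  "bibo_op t0 \<sigma> Op \<longleftrightarrow>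
     (\<forall>c0>0. \<exists>c1>0. \<forall>y. continuous_on {t0 - \<sigma>..} y \<and> (\<forall>t\<ge>t0 - \<sigma>. norm (y t) \<le> c0) \<longrightarrow>
        norm_Linf {t0..} (Op y) \<le> ereal c1)"

definition operator_class :: "real \<Rightarrow> real \<Rightarrow> ('m::finite, 'q::finite) operator set" where
  "operator_class t0 \<sigma> =
     {Op. (\<forall>y. continuous_on {t0 - \<sigma>..} y \<longrightarrow> Op y \<in> Linf_loc {0..}) \<and>
          causal_op t0 \<sigma> Op \<and> locally_lipschitz_op t0 \<sigma> Op \<and> bibo_op t0 \<sigma> Op}"

text \<open>Continuity from \<open>C([t0 - \<sigma>, t])\<close> to \<open>L1([t0, t])\<close>. Local Lipschitz continuity as above only
  compares functions with the same past, so it does not imply this property: with \<open>t0 = 0\<close>, the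
  operator sending \<open>y\<close> to the indicator function of \<open>{s. 2 \<le> s \<and> 0 < y 1}\<close> is in the operator
  class.\<close>

definition continuous_op :: "real \<Rightarrow> real \<Rightarrow> ('m::finite, 'q::finite) operator \<Rightarrow> bool" where
  "continuous_op t0 \<sigma> Op \<longleftrightarrow>
     (\<forall>t\<ge>t0. \<forall>z y. (\<forall>n::nat. continuous_on {t0 - \<sigma>..} (z n)) \<and> continuous_on {t0 - \<sigma>..} y \<and>
        uniform_limit {t0 - \<sigma>..t} z y sequentially \<longrightarrow>
        (\<lambda>n. \<integral>\<^sup>+ s. ennreal (norm (Op (z n) s - Op y s)) \<partial>lebesgue_on {t0..t}) \<longlonglongrightarrow> 0)"

definition system_class ::
    "real \<Rightarrow> real \<Rightarrow> ((real^'q \<Rightarrow> real^'m) \<times> (real^'q \<Rightarrow> real^'m^'m) \<times> ('m::finite, 'q::finite) operator) set" where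
  "system_class t0 \<sigma> =
     {(f, g, Op). continuous_on UNIV f \<and> continuous_on UNIV g \<and> Op \<in> operator_class t0 \<sigma> \<and>
                  (\<forall>\<xi> z. z \<noteq> 0 \<longrightarrow> 0 < z \<bullet> (g \<xi> *v z))}"

section \<open>Solutions\<close>

text \<open>A function \<open>y\<close> on \<open>[t0 - \<sigma>, \<omega>)\<close> need not extend continuously beyond \<open>\<omega>\<close>, so \<open>Op y\<close> on
  \<open>[t0, s]\<close>, \<open>s < \<omega>\<close>, is understood as the operator applied to the continuous extension of
  \<open>y\<close> restricted to \<open>[t0 - \<sigma>, s]\<close> by a constant. By causality any other continuous extension
  gives the same result. The derivative is two-sided; the initial time is a null set.\<close>

definition stopped :: "real \<Rightarrow> (real \<Rightarrow> 'a) \<Rightarrow> real \<Rightarrow> 'a" where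
  "stopped s y = (\<lambda>r. y (min r s))"

text \<open>\<open>th\<close> is the initial time, \<open>yh\<close> the history on \<open>[t0 - \<sigma>, th]\<close>; values of \<open>y\<close> on
  \<open>[\<omega>, \<infinity>)\<close> are irrelevant.\<close>

definition solution ::
    "real \<Rightarrow> real \<Rightarrow> (real^'q \<Rightarrow> real^'m) \<times> (real^'q \<Rightarrow> real^'m^'m) \<times> ('m::finite, 'q::finite) operator
      \<Rightarrow> real \<Rightarrow> (real \<Rightarrow> real^'m) \<Rightarrow> (real \<Rightarrow> real^'m) \<Rightarrow> (real \<Rightarrow> real^'m) \<Rightarrow> ereal \<Rightarrow> bool" where
  "solution t0 \<sigma> sys th yh u y \<omega> \<longleftrightarrow>
     (case sys of (f, g, Op) \<Rightarrow>
        ereal th < \<omega> \<and> (\<forall>s\<in>{t0 - \<sigma>..th}. y s = yh s) \<and>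
        (\<forall>s\<ge>th. ereal s < \<omega> \<longrightarrow>
           abs_continuous_on th s y \<and>
           (AE t in lebesgue_on {th..s}.
              (y has_vector_derivative
                 (f (Op (stopped s y) t) + g (Op (stopped s y) t) *v u t)) (at t))))"

definition maximal_solution ::
    "real \<Rightarrow> real \<Rightarrow> (real^'q \<Rightarrow> real^'m) \<times> (real^'q \<Rightarrow> real^'m^'m) \<times> ('m::finite, 'q::finite) operator
      \<Rightarrow> real \<Rightarrow> (real \<Rightarrow> real^'m) \<Rightarrow> (real \<Rightarrow> real^'m) \<Rightarrow> (real \<Rightarrow> real^'m) \<Rightarrow> ereal \<Rightarrow> bool" where
  "maximal_solution t0 \<sigma> sys th yh u y \<omega> \<longleftrightarrow>
     solution t0 \<sigma> sys th yh u y \<omega> \<and>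
     \<not> (\<exists>y' \<omega>'. \<omega> < \<omega>' \<and> solution t0 \<sigma> sys th yh u y' \<omega>' \<and>
              (\<forall>s\<ge>t0 - \<sigma>. ereal s < \<omega> \<longrightarrow> y' s = y s))"

section \<open>Partitions and step functions\<close>

definition partition_from :: "real \<Rightarrow> (nat \<Rightarrow> real) \<Rightarrow> bool" where
  "partition_from a P \<longleftrightarrow> strict_mono P \<and> P 0 = a \<and> filterlim P at_top sequentially"

definition mesh :: "(nat \<Rightarrow> real) \<Rightarrow> ereal" where
  "mesh P = (SUP i. ereal (P (Suc i) - P i))"

text \<open>Functions on \<open>I\<close> are represented by total functions that vanish outside \<open>I\<close>.\<close>

definition step_functions :: "(nat \<Rightarrow> real) \<Rightarrow> real set \<Rightarrow> (real \<Rightarrow> real^'m::finite) set" where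
  "step_functions P I =
     {u. (\<forall>i. \<forall>s\<in>{P i..<P (Suc i)} \<inter> I. \<forall>s'\<in>{P i..<P (Suc i)} \<inter> I. u s = u s') \<and>
         (\<forall>s. s \<notin> I \<longrightarrow> u s = 0)}"

section \<open>Optimal control problem\<close>

definition stage_cost ::
    "(real \<Rightarrow> real^'m::finite) \<Rightarrow> (real \<Rightarrow> real) \<Rightarrow> (real \<Rightarrow> real^'m \<Rightarrow> real^'m \<Rightarrow> real)
      \<Rightarrow> real \<Rightarrow> real^'m \<Rightarrow> real^'m \<Rightarrow> ennreal" where
  "stage_cost yref \<psi> l t y u = (if norm (y - yref t) \<le> \<psi> t then ennreal (l t y u) else \<infinity>)"

text \<open>Cost over \<open>[th, th + Th]\<close> of a control \<open>u\<close> with a response \<open>y\<close> on \<open>[t0 - \<sigma>, \<omega>)\<close>; the cost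
  is infinite where the response does not exist.\<close>

definition cost ::
    "(real \<Rightarrow> real^'m::finite) \<Rightarrow> (real \<Rightarrow> real) \<Rightarrow> (real \<Rightarrow> real^'m \<Rightarrow> real^'m \<Rightarrow> real)
      \<Rightarrow> real \<Rightarrow> real \<Rightarrow> (real \<Rightarrow> real^'m) \<times> (real \<Rightarrow> real^'m) \<times> ereal \<Rightarrow> ennreal" where
  "cost yref \<psi> l Th th p =
     (case p of (u, y, \<omega>) \<Rightarrow>
        (\<integral>\<^sup>+ t. (if ereal t < \<omega> then stage_cost yref \<psi> l t (y t) (u t) else \<infinity>)
          \<partial>lebesgue_on {th..th + Th}))"

text \<open>Since \<open>f\<close> and \<open>g\<close> are merely continuous, the response to a control may fail to be unique.
  An admissible element is therefore a control together with one of its responses.\<close>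

definition ocp_admissible ::
    "real \<Rightarrow> real \<Rightarrow> (real^'q \<Rightarrow> real^'m) \<times> (real^'q \<Rightarrow> real^'m^'m) \<times> ('m::finite, 'q::finite) operator
      \<Rightarrow> real \<Rightarrow> (nat \<Rightarrow> real) \<Rightarrow> real \<Rightarrow> real \<Rightarrow> (real \<Rightarrow> real^'m)
      \<Rightarrow> ((real \<Rightarrow> real^'m) \<times> (real \<Rightarrow> real^'m) \<times> ereal) set" where
  "ocp_admissible t0 \<sigma> sys umax P Th th yh =
     {(u, y, \<omega>). u \<in> step_functions P {th..th + Th} \<and>
                 norm_Linf {th..th + Th} u \<le> ereal umax \<and>
                 maximal_solution t0 \<sigma> sys th yh u y \<omega>}"

definition ocp_solution ::
    "real \<Rightarrow> real \<Rightarrow> (real^'q \<Rightarrow> real^'m) \<times> (real^'q \<Rightarrow> real^'m^'m) \<times> ('m::finite, 'q::finite) operator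
      \<Rightarrow> (real \<Rightarrow> real^'m) \<Rightarrow> (real \<Rightarrow> real) \<Rightarrow> (real \<Rightarrow> real^'m \<Rightarrow> real^'m \<Rightarrow> real)
      \<Rightarrow> real \<Rightarrow> (nat \<Rightarrow> real) \<Rightarrow> real \<Rightarrow> real \<Rightarrow> (real \<Rightarrow> real^'m)
      \<Rightarrow> (real \<Rightarrow> real^'m) \<times> (real \<Rightarrow> real^'m) \<times> ereal \<Rightarrow> bool" where
  "ocp_solution t0 \<sigma> sys yref \<psi> l umax P Th th yh p \<longleftrightarrow>
     p \<in> ocp_admissible t0 \<sigma> sys umax P Th th yh \<and>
     (\<forall>p'\<in>ocp_admissible t0 \<sigma> sys umax P Th th yh. cost yref \<psi> l Th th p \<le> cost yref \<psi> l Th th p')"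

section \<open>Closed loop\<close>

text \<open>Iteration \<open>k\<close> of the algorithm at time \<open>th = t0 + k * \<delta>\<close>: the measured history is \<open>y\<close> on
  \<open>[t0 - \<sigma>, th]\<close>, the feedback \<open>\<mu>(\<cdot>, y)\<close> is an optimal control, and on \<open>[th, th + \<delta>]\<close> the output
  is the response belonging to this optimal control. If responses are unique, the condition
  \<open>y t = y' t\<close> just says that \<open>y\<close> solves the differential equation.\<close>

definition mpc_step ::
    "real \<Rightarrow> real \<Rightarrow> (real^'q \<Rightarrow> real^'m) \<times> (real^'q \<Rightarrow> real^'m^'m) \<times> ('m::finite, 'q::finite) operator
      \<Rightarrow> (real \<Rightarrow> real^'m) \<Rightarrow> (real \<Rightarrow> real) \<Rightarrow> (real \<Rightarrow> real^'m \<Rightarrow> real^'m \<Rightarrow> real)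
      \<Rightarrow> real \<Rightarrow> (nat \<Rightarrow> real) \<Rightarrow> real \<Rightarrow> real
      \<Rightarrow> (real \<Rightarrow> real^'m) \<Rightarrow> (real \<Rightarrow> real^'m) \<Rightarrow> nat \<Rightarrow> bool" where
  "mpc_step t0 \<sigma> sys yref \<psi> l umax P Th \<delta> y u k \<longleftrightarrow>
     (let th = t0 + real k * \<delta> in
        \<exists>u' y' \<omega>. ocp_solution t0 \<sigma> sys yref \<psi> l umax P Th th y (u', y', \<omega>) \<and>
          ereal (th + \<delta>) < \<omega> \<and>
          (\<forall>t\<in>{th..<th + \<delta>}. u t = u' t) \<and>
          (\<forall>t\<in>{th..th + \<delta>}. y t = y' t))"

text \<open>The first \<open>k\<close> iterations have been executed; \<open>y\<close> is the output up to time \<open>t0 + k * \<delta>\<close>.\<close>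

definition mpc_run ::
    "real \<Rightarrow> real \<Rightarrow> (real^'q \<Rightarrow> real^'m) \<times> (real^'q \<Rightarrow> real^'m^'m) \<times> ('m::finite, 'q::finite) operator
      \<Rightarrow> (real \<Rightarrow> real^'m) \<Rightarrow> (real \<Rightarrow> real) \<Rightarrow> (real \<Rightarrow> real^'m \<Rightarrow> real^'m \<Rightarrow> real)
      \<Rightarrow> real \<Rightarrow> (nat \<Rightarrow> real) \<Rightarrow> real \<Rightarrow> real \<Rightarrow> (real \<Rightarrow> real^'m)
      \<Rightarrow> (real \<Rightarrow> real^'m) \<Rightarrow> (real \<Rightarrow> real^'m) \<Rightarrow> nat \<Rightarrow> bool" where
  "mpc_run t0 \<sigma> sys yref \<psi> l umax P Th \<delta> y0 y u k \<longleftrightarrow>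
     (\<forall>s\<in>{t0 - \<sigma>..t0}. y s = y0 s) \<and>
     (\<forall>j<k. mpc_step t0 \<sigma> sys yref \<psi> l umax P Th \<delta> y u j)"

definition mpc_global_solution ::
    "real \<Rightarrow> real \<Rightarrow> (real^'q \<Rightarrow> real^'m) \<times> (real^'q \<Rightarrow> real^'m^'m) \<times> ('m::finite, 'q::finite) operator
      \<Rightarrow> (real \<Rightarrow> real^'m) \<Rightarrow> (real \<Rightarrow> real) \<Rightarrow> (real \<Rightarrow> real^'m \<Rightarrow> real^'m \<Rightarrow> real)
      \<Rightarrow> real \<Rightarrow> (nat \<Rightarrow> real) \<Rightarrow> real \<Rightarrow> real \<Rightarrow> (real \<Rightarrow> real^'m)
      \<Rightarrow> (real \<Rightarrow> real^'m) \<Rightarrow> (real \<Rightarrow> real^'m) \<Rightarrow> bool" where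
  "mpc_global_solution t0 \<sigma> sys yref \<psi> l umax P Th \<delta> y0 y u \<longleftrightarrow>
     solution t0 \<sigma> sys t0 y0 u y \<infinity> \<and>
     (\<forall>k. mpc_step t0 \<sigma> sys yref \<psi> l umax P Th \<delta> y u k)"

end

theory Submission
  imports Defs "HOL-Complex_Analysis.Great_Picard"
begin

text \<open>The constants \<open>umax\<close> and \<open>\<tau>\<close> come from a sampled version of high-gain feedback. Outputs that stay
below a bound \<open>R\<close> are mapped by the operator into a fixed ball (almost everywhere), where \<open>f\<close> is bounded
and \<open>z \<bullet> g \<xi> z\<close> is bounded below by a positive constant on the unit sphere. A constant control opposite
to the sampled error, with a sufficiently large gain, therefore shrinks the error faster than the
funnel can contract, as long as the step is short; and if the sampled error is small, the zero control
does no harm during a short step (\<open>funnel_step\<close>). One gain and one step length serve all times,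
so every history that ends inside the funnel at a partition point admits a control of finite cost
(\<open>feasible_finite_cost\<close>).

Optimal controls exist by the direct method (\<open>ocp_solution_exists\<close>). A finite cost forces the error to
stay in the funnel during the whole horizon (\<open>finite_cost_imp_in_funnel\<close>), so the outputs of a minimizing
sequence are bounded and equi-Lipschitz, and the step controls are determined by their values at the partition
points. Diagonal selection and the Arzela-Ascoli theorem give a limit, again a solution because
the operator is continuous from uniform convergence to \<open>L1\<close> (\<open>solutions_limit\<close>), and by Fatou's lemma
its cost is not larger than the infimum (\<open>running_cost_lsc\<close>).

Since \<open>f\<close> and \<open>g\<close> are merely continuous, solutions are obtained from delayed approximations
(\<open>local_existence\<close>) and need not be unique; maximal ones are provided by Zorn's lemma
(\<open>maximal_extension\<close>), and a bounded maximal solution is global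
(\<open>maximal_solution_bounded_imp_global\<close>). Estimates and limits use the integral
equation (\<open>solves\<close>), which is equivalent to the differential equation by the fundamental theorem of
calculus for absolutely continuous functions.

For the closed loop, an optimal control has finite cost, so the applied piece of its response ends inside
the funnel at a partition point, where the next problem is feasible again (\<open>mpc_run_invariant\<close>).
Dependent choice strings the iterations together.\<close>

section \<open>Null sets and absolutely continuous functions\<close>

lemma AE_lebesgue_on_iff_negligible:
  assumes "S \<in> sets lebesgue"
  shows "(AE t in lebesgue_on S. Q t) \<longleftrightarrow> negligible {t\<in>S. \<not> Q t}"
proof -
  have "(AE t in lebesgue_on S. Q t) \<longleftrightarrow> (AE t in lebesgue. t \<in> S \<longrightarrow> Q t)"
    using assms by (intro AE_restrict_space_iff) auto
  also have "\<dots> \<longleftrightarrow> negligible {t\<in>S. \<not> Q t}"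
    unfolding eventually_ae_filter_negligible
    by (auto intro: negligible_subset)
  finally show ?thesis .
qed

lemma AE_lebesgue_on_subset:
  assumes "AE t in lebesgue_on S. Q t" "T \<subseteq> S" "S \<in> sets lebesgue" "T \<in> sets lebesgue"
  shows "AE t in lebesgue_on T. Q t"
proof -
  have "negligible {t\<in>S. \<not> Q t}"
    using assms AE_lebesgue_on_iff_negligible by blast
  then have "negligible {t\<in>T. \<not> Q t}"
    by (rule negligible_subset) (use assms in auto)
  then show ?thesis
    using assms AE_lebesgue_on_iff_negligible by blast
qed

lemma AE_not_endpoint: "AE t in lebesgue_on {a..b::real}. t \<in> {a..<b}"
proof -
  have "negligible {t \<in> {a..b}. \<not> t \<in> {a..<b}}"
    by (rule negligible_subset[of "{b}"]) auto
  then show ?thesis by (rule AE_lebesgue_on_iff_negligible[THEN iffD2, rotated]) simp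
qed

lemma norm_Linf_le_imp_AE:
  assumes "norm_Linf S h \<le> ereal c"
  shows "AE t in lebesgue_on S. norm (h t) \<le> c"
proof -
  have "AE t in lebesgue_on S. ereal (norm (h t)) \<le> norm_Linf S h"
    unfolding norm_Linf_def by (rule esssup_AE)
  then show ?thesis
  proof (rule eventually_mono)
    fix t assume "ereal (norm (h t)) \<le> norm_Linf S h"
    from order_trans[OF this assms] show "norm (h t) \<le> c" by simp
  qed
qed

text \<open>An open set on which a continuous function exceeds an almost everywhere valid bound is both open and
  negligible, hence empty.\<close>

lemma AE_le_imp_le:
  fixes \<phi> :: "real \<Rightarrow> real"
  assumes ab: "a < b" and cont: "continuous_on {a..b} \<phi>"
    and AE: "AE t in lebesgue_on {a..b}. \<phi> t \<le> c" and t: "t \<in> {a..b}"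
  shows "\<phi> t \<le> c"
proof -
  have neg: "negligible {t\<in>{a..b}. \<not> \<phi> t \<le> c}"
    using AE by (simp add: AE_lebesgue_on_iff_negligible)
  have "open ({a<..<b} \<inter> \<phi> -` {c<..})"
    by (intro continuous_open_preimage continuous_on_subset[OF cont]) auto
  moreover have "negligible ({a<..<b} \<inter> \<phi> -` {c<..})"
    by (rule negligible_subset[OF neg]) auto
  ultimately have "{a<..<b} \<inter> \<phi> -` {c<..} = {}"
    using open_not_negligible by blast
  then have *: "\<phi> x \<le> c" if "x \<in> {a<..<b}" for x using that by (auto simp: not_less[symmetric])
  show ?thesis
    by (rule continuous_le_on_closure[of "{a<..<b}" \<phi> t c])
       (use ab cont t * in auto)
qed

lemma abs_continuous_onE:
  assumes "abs_continuous_on a b y" "0 < \<epsilon>"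
  obtains \<eta> where "0 < \<eta>" "\<And>D S. \<lbrakk>D division_of S; S \<subseteq> {a..b}; (\<Sum>k\<in>D. Sup k - Inf k) < \<eta>\<rbrakk>
        \<Longrightarrow> (\<Sum>k\<in>D. norm (y (Sup k) - y (Inf k))) < \<epsilon>"
proof -
  obtain \<eta> where "\<eta> > 0" and *: "\<forall>D S. D division_of S \<and> S \<subseteq> {a..b} \<and> (\<Sum>k\<in>D. Sup k - Inf k) < \<eta> \<longrightarrow>
        (\<Sum>k\<in>D. norm (y (Sup k) - y (Inf k))) < \<epsilon>"
    using assms unfolding abs_continuous_on_def by (elim allE[of _ \<epsilon>]) (auto simp del: split_paired_All)
  show ?thesis
    by (rule that[OF \<open>\<eta> > 0\<close>]) (rule *[rule_format], intro conjI)
qed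

text \<open>The fundamental theorem of calculus for absolutely continuous functions. In the Riemann sums of a
  fine tagged division, intervals tagged outside the null set are controlled by differentiability at the tag.
  Those tagged inside it lie in an open set of small measure, so their total length is small and
  absolute continuity controls the increments.\<close>

lemma has_integral_abs_continuous:
  fixes y v :: "real \<Rightarrow> 'a::euclidean_space"
  assumes ab: "a \<le> b" and ac: "abs_continuous_on a b y"
    and der: "AE t in lebesgue_on {a..b}. (y has_vector_derivative v t) (at t)"
  shows "(v has_integral (y b - y a)) {a..b}"
proof -
  define N where "N = {t\<in>{a..b}. \<not> (y has_vector_derivative v t) (at t)}"
  have N: "negligible N"
    using der unfolding N_def by (simp add: AE_lebesgue_on_iff_negligible)
  define w where "w = (\<lambda>t. if t \<in> N then 0 else v t)"
  have "(w has_integral (y b - y a)) (cbox a b)"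
    unfolding has_integral
  proof (intro allI impI)
    fix e :: real assume e: "0 < e"
    define e1 where "e1 = e / (2 * (b - a + 1))"
    have e1: "0 < e1" "e1 * (b - a) \<le> e / 2"
      using e ab by (auto simp: e1_def field_simps)
    obtain \<eta> where \<eta>: "0 < \<eta>" "\<And>D S. \<lbrakk>D division_of S; S \<subseteq> {a..b}; (\<Sum>k\<in>D. Sup k - Inf k) < \<eta>\<rbrakk>
        \<Longrightarrow> (\<Sum>k\<in>D. norm (y (Sup k) - y (Inf k))) < e / 2"
      by (rule abs_continuous_onE[OF ac half_gt_zero[OF e]]) (rule that; assumption)
    obtain U where U: "open U" "N \<subseteq> U" "U - N \<in> lmeasurable" "emeasure lebesgue (U - N) < ennreal \<eta>"
      using sets_lebesgue_outer_open[of N \<eta>] N \<eta>(1) negligible_imp_sets by blast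
    have UN: "U = (U - N) \<union> N" using U(2) by auto
    have Ulm: "U \<in> lmeasurable"
      using U(3) N negligible_imp_measurable by (subst UN) blast
    have "measure lebesgue U = measure lebesgue (U - N)"
      using N U(3) by (simp add: measure_Diff_null_set negligible_iff_null_sets Ulm fmeasurableD)
    also have "\<dots> < \<eta>"
      using U(3,4) \<eta>(1) by (simp add: emeasure_eq_measure2 ennreal_less_iff)
    finally have mU: "measure lebesgue U < \<eta>" .
    have "\<forall>x. \<exists>d>0. x \<in> {a..b} - N \<longrightarrow>
         (\<forall>z. norm (z - x) < d \<longrightarrow> norm (y z - y x - (z - x) *\<^sub>R v x) \<le> e1 * norm (z - x))"
    proof
      fix x
      show "\<exists>d>0. x \<in> {a..b} - N \<longrightarrow>
         (\<forall>z. norm (z - x) < d \<longrightarrow> norm (y z - y x - (z - x) *\<^sub>R v x) \<le> e1 * norm (z - x))"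
      proof (cases "x \<in> {a..b} - N")
        case True
        then have "(y has_derivative (\<lambda>h. h *\<^sub>R v x)) (at x)"
          by (auto simp: N_def has_vector_derivative_def)
        then show ?thesis using e1(1) unfolding has_derivative_at_alt by blast
      qed (auto intro: exI[of _ 1])
    qed
    then obtain d where d: "\<And>x. 0 < d x" "\<And>x z. \<lbrakk>x \<in> {a..b} - N; norm (z - x) < d x\<rbrakk>
         \<Longrightarrow> norm (y z - y x - (z - x) *\<^sub>R v x) \<le> e1 * norm (z - x)"
      by metis
    have "\<forall>x. \<exists>r>0. x \<in> N \<longrightarrow> ball x r \<subseteq> U"
      using U(1,2) by (metis open_contains_ball subsetD zero_less_one)
    then obtain r where r: "\<And>x. 0 < r x" "\<And>x. x \<in> N \<Longrightarrow> ball x (r x) \<subseteq> U"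
      by metis
    define \<gamma> where "\<gamma> = (\<lambda>x. ball x (if x \<in> N then r x else d x))"
    show "\<exists>\<gamma>. gauge \<gamma> \<and> (\<forall>p. p tagged_division_of cbox a b \<and> \<gamma> fine p \<longrightarrow>
            norm ((\<Sum>(x, k)\<in>p. measure lborel k *\<^sub>R w x) - (y b - y a)) < e)"
    proof (intro exI conjI allI impI; (elim conjE)?)
      show "gauge \<gamma>"
        unfolding \<gamma>_def by (rule gauge_ball_dependent) (use d(1) r(1) in auto)
    next
      fix p assume p: "p tagged_division_of cbox a b" and fine: "\<gamma> fine p"
      note pD = tagged_division_ofD[OF p]
      have fin: "finite p" by (rule pD(1))
      have *: "\<exists>u u'. K = {u..u'} \<and> u \<le> u' \<and> x \<in> {u..u'} \<and> a \<le> u \<and> u' \<le> b \<and> {u..u'} \<subseteq> \<gamma> x"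
        if "(x, K) \<in> p" for x K
      proof -
        obtain u u' where "K = cbox u u'" using pD(4) \<open>(x, K) \<in> p\<close> by blast
        moreover have "x \<in> K" "K \<subseteq> cbox a b" using pD(2,3) \<open>(x, K) \<in> p\<close> by auto
        moreover have "K \<subseteq> \<gamma> x" using fineD[OF fine \<open>(x, K) \<in> p\<close>] .
        ultimately show ?thesis by (intro exI[of _ u] exI[of _ u']) auto
      qed
      define q where "q = {z\<in>p. fst z \<in> N}"
      have qp: "q \<subseteq> p" by (auto simp: q_def)
      have tpq: "q tagged_partial_division_of cbox a b"
        using tagged_partial_division_subset[OF _ qp] p unfolding tagged_division_of_def by auto
      have divq: "(snd ` q) division_of \<Union>(snd ` q)"
        by (rule partial_division_of_tagged_division[OF tpq])
      have tq: "q tagged_division_of \<Union>(snd ` q)"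
        by (rule tagged_partial_division_of_Union_self[OF tpq])
      have sub: "\<Union>(snd ` q) \<subseteq> {a..b}" "\<Union>(snd ` q) \<subseteq> U"
      proof -
        show "\<Union>(snd ` q) \<subseteq> {a..b}"
        proof (clarsimp simp del: atLeastAtMost_iff)
          fix x K s assume "(x, K) \<in> q" "s \<in> K"
          then show "s \<in> {a..b}" using pD(3)[OF subsetD[OF qp]] by fastforce
        qed
        show "\<Union>(snd ` q) \<subseteq> U"
        proof clarsimp
          fix x K s assume "(x, K) \<in> q" "s \<in> K"
          then have "x \<in> N" "K \<subseteq> \<gamma> x" using fineD[OF fine] by (auto simp: q_def)
          then show "s \<in> U" using r(2) \<open>s \<in> K\<close> by (auto simp: \<gamma>_def)
        qed
      qed
      have "(\<Sum>k\<in>snd ` q. Sup k - Inf k) = (\<Sum>k\<in>snd ` q. measure lebesgue k)"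
      proof (rule sum.cong[OF refl], clarsimp)
        fix x K assume "(x, K) \<in> q"
        then show "Sup K - Inf K = measure lebesgue K"
          using *[OF subsetD[OF qp]] by fastforce
      qed
      also have "\<dots> = measure lebesgue (\<Union>(snd ` q))"
        by (rule content_division[OF divq])
      also have "\<dots> \<le> measure lebesgue U"
        using sub(2) Ulm lmeasurable_division[OF divq]
        by (intro measure_mono_fmeasurable) (auto simp: fmeasurableD)
      finally have small: "(\<Sum>k\<in>snd ` q. Sup k - Inf k) < \<eta>" using mU by simp
      \<comment> \<open>Equal intervals with different tags are degenerate; the empty interval is excluded by hand
         because \<open>Sup {}\<close> and \<open>Inf {}\<close> are arbitrary numbers.\<close>
      define V where "V K = (if K = {} then 0 else norm (y (Sup K) - y (Inf K)))" for K
      have ne: "K \<noteq> {}" if "(x, K) \<in> q" for x K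
        using pD(2) that qp by blast
      have "(\<Sum>(x,K)\<in>q. norm (y (Sup K) - y (Inf K))) = (\<Sum>(x,K)\<in>q. V K)"
        using ne by (intro sum.cong) (auto simp: V_def)
      also have "\<dots> = sum V (snd ` q)"
      proof (rule sum.over_tagged_division_lemma[OF tq])
        fix u v :: real assume "box u v = {}"
        then show "V (cbox u v) = 0" by (cases "u = v") (auto simp: V_def)
      qed
      also have "\<dots> = (\<Sum>k\<in>snd ` q. norm (y (Sup k) - y (Inf k)))"
        using ne by (intro sum.cong) (auto simp: V_def)
      also have "\<dots> < e / 2" by (rule \<eta>(2)[OF divq sub(1) small])
      finally have A: "(\<Sum>(x,K)\<in>q. norm (y (Sup K) - y (Inf K))) < e / 2" .
      have ba: "b - a = (\<Sum>(x,K)\<in>p. Sup K - Inf K)" "y b - y a = (\<Sum>(x,K)\<in>p. y (Sup K) - y (Inf K))"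
        using additive_tagged_division_1[where f= "\<lambda>x. x"] additive_tagged_division_1[where f= y] ab p by auto
      have "norm ((\<Sum>(x, k)\<in>p. measure lborel k *\<^sub>R w x) - (y b - y a)) =
          norm (\<Sum>(x,K)\<in>p. measure lborel K *\<^sub>R w x - (y (Sup K) - y (Inf K)))"
        unfolding ba by (simp add: split_def sum_subtractf)
      also have "\<dots> \<le> (\<Sum>(x,K)\<in>p. if x \<in> N then norm (y (Sup K) - y (Inf K)) else e1 * (Sup K - Inf K))"
      proof (rule sum_norm_le, clarsimp, intro conjI impI)
        fix x K assume xK: "(x, K) \<in> p" "x \<in> N"
        then show "norm (measure lborel K *\<^sub>R w x - (y (Sup K) - y (Inf K))) \<le> norm (y (Sup K) - y (Inf K))"
          by (simp add: w_def norm_minus_commute)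
      next
        fix x K assume xK: "(x, K) \<in> p" "x \<notin> N"
        obtain u u' where K: "K = {u..u'}" "u \<le> u'" "x \<in> {u..u'}" "a \<le> u" "u' \<le> b" "{u..u'} \<subseteq> \<gamma> x"
          using *[OF xK(1)] by blast
        have u: "u \<in> \<gamma> x" "u' \<in> \<gamma> x" using K by auto
        have "norm (y u - y x - (u - x) *\<^sub>R v x) \<le> e1 * norm (u - x)"
             "norm (y u' - y x - (u' - x) *\<^sub>R v x) \<le> e1 * norm (u' - x)"
          using u K xK(2)
          by (intro d(2); force simp: \<gamma>_def dist_real_def)+
        moreover have "(u' - u) *\<^sub>R v x - (y u' - y u) =
            (y u - y x - (u - x) *\<^sub>R v x) - (y u' - y x - (u' - x) *\<^sub>R v x)"
          by (simp add: algebra_simps)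
        ultimately have "norm ((u' - u) *\<^sub>R v x - (y u' - y u)) \<le> e1 * norm (u - x) + e1 * norm (u' - x)"
          by (smt (verit) norm_triangle_ineq4)
        also have "\<dots> = e1 * (u' - u)" using K by (simp add: algebra_simps)
        finally show "norm (measure lborel K *\<^sub>R w x - (y (Sup K) - y (Inf K))) \<le> e1 * (Sup K - Inf K)"
          using K xK(2) by (simp add: w_def)
      qed
      also have "\<dots> \<le> (\<Sum>(x,K)\<in>p. (if x \<in> N then norm (y (Sup K) - y (Inf K)) else 0) + e1 * (Sup K - Inf K))"
      proof (rule sum_mono, clarsimp)
        fix x K assume "(x, K) \<in> p"
        then obtain u u' where "K = {u..u'}" "u \<le> u'" using * by blast
        then show "0 \<le> e1 * (Sup K - Inf K)" using e1(1) by simp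
      qed
      also have "\<dots> = (\<Sum>(x,K)\<in>q. norm (y (Sup K) - y (Inf K))) + e1 * (b - a)"
      proof -
        have "(\<Sum>(x,K)\<in>p. if x \<in> N then norm (y (Sup K) - y (Inf K)) else 0)
             = (\<Sum>(x,K)\<in>q. norm (y (Sup K) - y (Inf K)))"
          unfolding q_def using fin by (subst sum.inter_filter) (auto simp: split_def intro: sum.cong)
        then show ?thesis unfolding ba(1) by (simp add: split_def sum.distrib sum_distrib_left)
      qed
      also have "\<dots> < e" using A e1(2) by simp
      finally show "norm ((\<Sum>(x, k)\<in>p. measure lborel k *\<^sub>R w x) - (y b - y a)) < e" .
    qed
  qed
  then have "(w has_integral (y b - y a)) {a..b}" by simp
  then show ?thesis
    by (rule has_integral_spike[OF N, rotated]) (auto simp: w_def)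
qed

lemma abs_continuous_on_lipschitz:
  fixes y :: "real \<Rightarrow> 'a::euclidean_space"
  assumes lip: "\<And>s t. \<lbrakk>s \<in> {a..b}; t \<in> {a..b}\<rbrakk> \<Longrightarrow> norm (y t - y s) \<le> M * \<bar>t - s\<bar>"
  shows "abs_continuous_on a b y"
  unfolding abs_continuous_on_def
proof (intro allI impI)
  fix \<epsilon> :: real assume \<epsilon>: "0 < \<epsilon>"
  show "\<exists>\<eta>>0. \<forall>D S. D division_of S \<and> S \<subseteq> {a..b} \<and> (\<Sum>k\<in>D. Sup k - Inf k) < \<eta> \<longrightarrow>
        (\<Sum>k\<in>D. norm (y (Sup k) - y (Inf k))) < \<epsilon>"
  proof (intro exI[of _ "\<epsilon> / (\<bar>M\<bar> + 1)"] conjI allI impI; (elim conjE)?)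
    show "0 < \<epsilon> / (\<bar>M\<bar> + 1)" using \<epsilon> by simp
    fix D S assume D: "D division_of S" "S \<subseteq> {a..b}" "(\<Sum>k\<in>D. Sup k - Inf k) < \<epsilon> / (\<bar>M\<bar> + 1)"
    have *: "norm (y (Sup k) - y (Inf k)) \<le> (\<bar>M\<bar> + 1) * (Sup k - Inf k)" if "k \<in> D" for k
    proof -
      obtain u v where "k = cbox u v"
        using division_ofD(4)[OF D(1) \<open>k \<in> D\<close>] by blast
      moreover have "k \<noteq> {}" "k \<subseteq> {a..b}"
        using division_ofD(2,3)[OF D(1) \<open>k \<in> D\<close>] D(2) by auto
      ultimately have k: "Sup k = v" "Inf k = u" "u \<le> v" "u \<in> {a..b}" "v \<in> {a..b}" by auto
      have "norm (y v - y u) \<le> M * \<bar>v - u\<bar>" using k lip by blast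
      also have "\<dots> \<le> (\<bar>M\<bar> + 1) * \<bar>v - u\<bar>" by (intro mult_right_mono) auto
      finally show ?thesis using k by simp
    qed
    have "(\<Sum>k\<in>D. norm (y (Sup k) - y (Inf k))) \<le> (\<Sum>k\<in>D. (\<bar>M\<bar> + 1) * (Sup k - Inf k))"
      by (intro sum_mono *)
    also have "\<dots> = (\<bar>M\<bar> + 1) * (\<Sum>k\<in>D. Sup k - Inf k)" by (simp add: sum_distrib_left)
    also have "\<dots> < \<epsilon>" using D(3) by (simp add: field_simps)
    finally show "(\<Sum>k\<in>D. norm (y (Sup k) - y (Inf k))) < \<epsilon>" .
  qed
qed

lemma abs_continuous_on_imp_continuous_on:
  fixes y :: "real \<Rightarrow> 'a::euclidean_space"
  assumes "abs_continuous_on a b y"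
  shows "continuous_on {a..b} y"
  unfolding continuous_on_iff
proof (intro ballI allI impI)
  fix x \<epsilon> :: real assume x: "x \<in> {a..b}" and \<epsilon>: "0 < \<epsilon>"
  obtain \<eta> where \<eta>: "0 < \<eta>" "\<And>D S. \<lbrakk>D division_of S; S \<subseteq> {a..b}; (\<Sum>k\<in>D. Sup k - Inf k) < \<eta>\<rbrakk>
        \<Longrightarrow> (\<Sum>k\<in>D. norm (y (Sup k) - y (Inf k))) < \<epsilon>"
    by (rule abs_continuous_onE[OF assms \<epsilon>]) (rule that; assumption)
  have *: "norm (y v - y u) < \<epsilon>" if "u \<in> {a..b}" "v \<in> {a..b}" "u \<le> v" "v - u < \<eta>" for u v
    using \<eta>(2)[of "{cbox u v}" "cbox u v"] that division_of_self[of u v] by auto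
  show "\<exists>d>0. \<forall>x'\<in>{a..b}. dist x' x < d \<longrightarrow> dist (y x') (y x) < \<epsilon>"
  proof (intro exI[of _ \<eta>] conjI ballI impI)
    fix x' assume "x' \<in> {a..b}" "dist x' x < \<eta>"
    then show "dist (y x') (y x) < \<epsilon>"
      using *[of x x'] *[of x' x] x by (cases "x \<le> x'") (auto simp: dist_norm norm_minus_commute)
  qed (use \<eta> in auto)
qed

text \<open>Lebesgue's differentiation theorem for right-hand difference quotients, applied to the function and to its
  reflection, yields a two-sided derivative.\<close>

lemma AE_has_vector_derivative_integral:
  fixes v :: "real \<Rightarrow> 'a::euclidean_space"
  assumes v: "v integrable_on {a..b}"
  shows "AE t in lebesgue_on {a..b}. ((\<lambda>x. integral {a..x} v) has_vector_derivative v t) (at t)"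
proof -
  define w where "w = (\<lambda>t. if t \<in> {a..b} then v t else 0)"
  have wUNIV: "w integrable_on UNIV"
    using v unfolding w_def by (subst integrable_restrict_UNIV)
  have w: "w integrable_on cbox c d" for c d
    by (rule integrable_on_subcbox[OF wUNIV]) auto
  have w': "(\<lambda>t. w (- t)) integrable_on cbox c d" for c d
    using integrable_reflect[of w "-c" "-d"] w[of "-d" "-c"] by simp
  obtain N1 where N1: "negligible N1" "\<And>x e. \<lbrakk>x \<notin> N1; 0 < e\<rbrakk> \<Longrightarrow> \<exists>d>0. \<forall>h. 0 < h \<and> h < d \<longrightarrow>
      norm (integral (cbox x (x + h *\<^sub>R One)) w /\<^sub>R h ^ DIM(real) - w x) < e"
    using integrable_ccontinuous_explicit[of w] w by blast
  obtain N2 where N2: "negligible N2" "\<And>x e. \<lbrakk>x \<notin> N2; 0 < e\<rbrakk> \<Longrightarrow> \<exists>d>0. \<forall>h. 0 < h \<and> h < d \<longrightarrow>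
      norm (integral (cbox x (x + h *\<^sub>R One)) (\<lambda>t. w (- t)) /\<^sub>R h ^ DIM(real) - w (- x)) < e"
    using integrable_ccontinuous_explicit[of "\<lambda>t. w (- t)"] w' by blast
  have negl2: "negligible (uminus ` N2)"
    by (rule negligible_differentiable_image_negligible[OF _ N2(1)]) (auto intro!: derivative_intros simp: differentiable_on_def)
  define N where "N = N1 \<union> uminus ` N2 \<union> {a, b}"
  have N: "negligible N"
    unfolding N_def using N1(1) negl2 by (intro negligible_Un) auto
  have scale: "norm (X - h *\<^sub>R c) \<le> e * h" if "norm (X /\<^sub>R h - c) < e" "0 < h" for X c :: 'a and h e :: real
  proof -
    have "X - h *\<^sub>R c = h *\<^sub>R (X /\<^sub>R h - c)" using that by (simp add: algebra_simps)
    then have "norm (X - h *\<^sub>R c) = h * norm (X /\<^sub>R h - c)" using that by simp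
    also have "\<dots> \<le> h * e" using that by (intro mult_left_mono) auto
    finally show ?thesis by (simp add: mult.commute)
  qed
  have right: "\<exists>d>0. \<forall>h. 0 < h \<and> h < d \<longrightarrow> norm (integral {x..x+h} w - h *\<^sub>R w x) \<le> e * h"
    if x: "x \<notin> N1" "0 < e" for x e
    using N1(2)[OF x] by (auto intro!: scale)
  have left: "\<exists>d>0. \<forall>h. 0 < h \<and> h < d \<longrightarrow> norm (integral {x-h..x} w - h *\<^sub>R w x) \<le> e * h"
    if x: "- x \<notin> N2" "0 < e" for x e
  proof -
    have "integral {-x..h-x} (\<lambda>t. w (- t)) = integral {x-h..x} w" for h
      using Henstock_Kurzweil_Integration.integral_reflect_real[of "x" "x-h" w] by (simp add: minus_diff_eq)
    then show ?thesis using N2(2)[OF x] by (auto intro!: scale)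
  qed
  have "((\<lambda>x. integral {a..x} v) has_vector_derivative v x) (at x)" if x: "x \<in> {a..b}" "x \<notin> N" for x
    unfolding has_vector_derivative_def has_derivative_at_alt
  proof (intro conjI allI impI bounded_linear_scaleR_left)
    fix e :: real assume e: "0 < e"
    have xab: "a < x" "x < b" "x \<notin> N1" "- x \<notin> N2" using x by (auto simp: N_def image_iff)
    obtain d1 where d1: "d1 > 0" "\<And>h. 0 < h \<Longrightarrow> h < d1 \<Longrightarrow> norm (integral {x..x+h} w - h *\<^sub>R w x) \<le> e * h"
      using right[OF xab(3) e] by blast
    obtain d2 where d2: "d2 > 0" "\<And>h. 0 < h \<Longrightarrow> h < d2 \<Longrightarrow> norm (integral {x-h..x} w - h *\<^sub>R w x) \<le> e * h"
      using left[OF xab(4) e] by blast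
    have wv: "integral {s..t} w = integral {s..t} v" if "a \<le> s" "t \<le> b" for s t
      using that by (intro integral_cong) (auto simp: w_def)
    have wx: "w x = v x" using x by (simp add: w_def)
    have comb: "integral {a..s} v + integral {s..t} v = integral {a..t} v" if "a \<le> s" "s \<le> t" "t \<le> b" for s t
      using that by (intro Henstock_Kurzweil_Integration.integral_combine integrable_subinterval_real[OF v]) auto
    define d where "d = Min {d1, d2, x - a, b - x}"
    have d: "d > 0" "d \<le> d1" "d \<le> d2" "d \<le> x - a" "d \<le> b - x"
      using d1 d2 xab by (auto simp: d_def)
    show "\<exists>d>0. \<forall>y. norm (y - x) < d \<longrightarrow>
        norm (integral {a..y} v - integral {a..x} v - (y - x) *\<^sub>R v x) \<le> e * norm (y - x)"
    proof (intro exI[of _ d] conjI allI impI)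
      fix y assume y: "norm (y - x) < d"
      consider "y = x" | "y > x" | "y < x" by linarith
      then show "norm (integral {a..y} v - integral {a..x} v - (y - x) *\<^sub>R v x) \<le> e * norm (y - x)"
      proof cases
        case 2
        then have "norm (integral {x..x+(y-x)} w - (y-x) *\<^sub>R w x) \<le> e * (y-x)"
          using y d by (intro d1(2)) auto
        moreover have "integral {a..y} v - integral {a..x} v = integral {x..y} v"
          using 2 y d xab comb[of x y] by (simp add: algebra_simps)
        ultimately show ?thesis using 2 y d xab wv[of x y] wx by simp
      next
        case 3
        then have "norm (integral {x-(x-y)..x} w - (x-y) *\<^sub>R w x) \<le> e * (x-y)"
          using y d by (intro d2(2)) auto
        moreover have "integral {a..y} v - integral {a..x} v - (y - x) *\<^sub>R v x = - (integral {y..x} v - (x-y) *\<^sub>R v x)"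
          using 3 y d xab comb[of y x] by (simp add: algebra_simps)
        ultimately show ?thesis using 3 y d xab wv[of y x] wx by (simp only: norm_minus_cancel) simp
      qed auto
    qed (use d in auto)
  qed
  then have "negligible {t\<in>{a..b}. \<not> ((\<lambda>x. integral {a..x} v) has_vector_derivative v t) (at t)}"
    by (intro negligible_subset[OF N]) auto
  then show ?thesis by (simp add: AE_lebesgue_on_iff_negligible)
qed

lemma norm_integral_le_AE:
  fixes v :: "real \<Rightarrow> 'a::euclidean_space"
  assumes v: "(v has_integral i) {a..b}" and ab: "a \<le> b"
    and M: "AE t in lebesgue_on {a..b}. norm (v t) \<le> M" and "0 \<le> M"
  shows "norm i \<le> M * (b - a)"
proof -
  have N: "negligible {t\<in>{a..b}. \<not> norm (v t) \<le> M}"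
    using M by (simp add: AE_lebesgue_on_iff_negligible)
  define w where "w = (\<lambda>t. if norm (v t) \<le> M then v t else 0)"
  have "(w has_integral i) {a..b}"
    by (rule has_integral_spike[OF N _ v]) (auto simp: w_def)
  then have "norm i \<le> M * measure lborel (cbox a b)"
    using \<open>0 \<le> M\<close> by (intro has_integral_bound[of M w i]) (auto simp: w_def)
  then show ?thesis using ab by simp
qed

lemma has_integral_le_AE:
  fixes w :: "real \<Rightarrow> real"
  assumes w: "(w has_integral i) {a..b}" and ab: "a \<le> b" and C: "AE t in lebesgue_on {a..b}. w t \<le> C"
  shows "i \<le> C * (b - a)"
proof -
  have N: "negligible {t\<in>{a..b}. \<not> w t \<le> C}"
    using C by (simp add: AE_lebesgue_on_iff_negligible)
  have "((\<lambda>t. if w t \<le> C then w t else C) has_integral i) {a..b}"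
    by (rule has_integral_spike[OF N _ w]) auto
  then have "i \<le> measure lborel {a..b} *\<^sub>R C"
    by (rule has_integral_le[OF _ has_integral_const_real]) auto
  then show ?thesis using ab by (simp add: mult.commute)
qed

lemma integral_lipschitz_AE:
  fixes v :: "real \<Rightarrow> 'a::euclidean_space"
  assumes v: "v integrable_on {a..b}" and M: "AE t in lebesgue_on {a..b}. norm (v t) \<le> M" "0 \<le> M"
    and st: "s \<in> {a..b}" "t \<in> {a..b}"
  shows "norm (integral {a..t} v - integral {a..s} v) \<le> M * \<bar>t - s\<bar>"
proof -
  have *: "norm (integral {a..t} v - integral {a..s} v) \<le> M * (t - s)"
    if st: "s \<in> {a..b}" "t \<in> {a..b}" "s \<le> t" for s t
  proof -
    have i: "v integrable_on {s..t}" "v integrable_on {a..t}"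
      using st by (auto intro!: integrable_subinterval_real[OF v])
    have "integral {a..t} v - integral {a..s} v = integral {s..t} v"
      using Henstock_Kurzweil_Integration.integral_combine[OF _ st(3) i(2)] st by (simp add: algebra_simps)
    moreover have "norm (integral {s..t} v) \<le> M * (t - s)"
    proof (rule norm_integral_le_AE[OF integrable_integral[OF i(1)]])
      show "AE t in lebesgue_on {s..t}. norm (v t) \<le> M"
        by (rule AE_lebesgue_on_subset[OF M(1)]) (use st in auto)
    qed (use st M in auto)
    ultimately show ?thesis by simp
  qed
  show ?thesis
    using *[of s t] *[of t s] st by (cases "s \<le> t") (auto simp: norm_minus_commute)
qed

lemma integrable_lebesgue_on_AE_bounded:
  fixes v :: "real \<Rightarrow> 'a::euclidean_space"
  assumes "v \<in> borel_measurable (lebesgue_on {a..b})" "AE t in lebesgue_on {a..b}. norm (v t) \<le> M"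
  shows "integrable (lebesgue_on {a..b}) v"
proof -
  interpret finite_measure "lebesgue_on {a..b}"
    by (rule finite_measure_lebesgue_on) auto
  show ?thesis by (rule integrable_const_bound[OF assms(2,1)])
qed

lemma equi_lipschitz_convergent_subsequence:
  fixes y :: "nat \<Rightarrow> real \<Rightarrow> 'a::euclidean_space"
  assumes M: "0 < M" and bound: "\<And>n t. t \<in> {a..b} \<Longrightarrow> norm (y n t) \<le> B"
    and lip: "\<And>n s t. \<lbrakk>s \<in> {a..b}; t \<in> {a..b}\<rbrakk> \<Longrightarrow> norm (y n t - y n s) \<le> M * \<bar>t - s\<bar>"
  obtains \<zeta> k where "strict_mono (k :: nat \<Rightarrow> nat)" "uniform_limit {a..b} (\<lambda>n. y (k n)) \<zeta> sequentially"
proof -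
  have equi: "\<exists>d>0. \<forall>n s. s \<in> {a..b} \<and> norm (t - s) < d \<longrightarrow> norm (y n t - y n s) < e"
    if "t \<in> {a..b}" "0 < e" for t e
  proof (intro exI[of _ "e / M"] conjI allI impI)
    show "0 < e / M" using that M by simp
    fix n s assume s: "s \<in> {a..b} \<and> norm (t - s) < e / M"
    have "norm (y n t - y n s) \<le> M * \<bar>t - s\<bar>"
      using s that by (intro lip) auto
    also have "\<dots> < e" using s M by (simp add: field_simps)
    finally show "norm (y n t - y n s) < e" .
  qed
  have "compact {a..b}" by simp
  then obtain \<zeta> k where k: "strict_mono (k :: nat \<Rightarrow> nat)"
    and unif: "\<And>e. 0 < e \<Longrightarrow> \<exists>N. \<forall>n s. n \<ge> N \<and> s \<in> {a..b} \<longrightarrow> norm (y (k n) s - \<zeta> s) < e"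
    using bound equi by (rule Arzela_Ascoli[of "{a..b}" y B]) blast+
  then have "uniform_limit {a..b} (\<lambda>n. y (k n)) \<zeta> sequentially"
    unfolding uniform_limit_iff eventually_sequentially dist_norm by blast
  then show ?thesis using k that by blast
qed

lemma continuous_on_compact_bounded:
  fixes h :: "'a::topological_space \<Rightarrow> 'b::real_normed_vector"
  assumes "compact K" "continuous_on K h"
  obtains C where "0 < C" "\<And>x. x \<in> K \<Longrightarrow> norm (h x) \<le> C"
  using compact_imp_bounded[OF compact_continuous_image[OF assms(2,1)]]
  unfolding bounded_pos by (metis imageI)

lemma continuous_on_Icc_bounded:
  fixes y :: "real \<Rightarrow> 'a::euclidean_space"
  assumes "continuous_on {a..b} y"
  obtains R where "\<And>t. t \<in> {a..b} \<Longrightarrow> norm (y t) \<le> R"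
  using continuous_on_compact_bounded[OF _ assms] by blast

section \<open>Lipschitz representatives of Sobolev functions\<close>

text \<open>A quadratic spline: a continuously differentiable transition from 0 to 1 on \<open>[0, 2]\<close>, with derivative
  \<open>tent\<close> below.\<close>

definition ramp :: "real \<Rightarrow> real" where
  "ramp x = (max 0 x)\<^sup>2 / 2 - (max 0 (x - 1))\<^sup>2 + (max 0 (x - 2))\<^sup>2 / 2"

definition tent :: "real \<Rightarrow> real" where
  "tent x = max 0 x - 2 * max 0 (x - 1) + max 0 (x - 2)"

lemma DERIV_max_sq: "((\<lambda>x::real. (max 0 x)\<^sup>2) has_real_derivative 2 * max 0 x) (at x)"
proof -
  consider "x < 0" | "x = 0" | "x > 0" by linarith
  then show ?thesis
  proof cases
    case 1
    have "((\<lambda>x::real. 0) has_real_derivative 0) (at x)" by simp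
    then have "((\<lambda>x::real. (max 0 x)\<^sup>2) has_real_derivative 0) (at x)"
      by (rule has_field_derivative_transform_within[where d="-x"]) (use 1 in \<open>auto simp: dist_real_def max_def\<close>)
    then show ?thesis using 1 by simp
  next
    case 2
    have "(\<lambda>h::real. (max 0 (0 + h))\<^sup>2 / h) \<midarrow>0\<rightarrow> 0"
    proof (rule Lim_null_comparison[where g="\<lambda>h::real. \<bar>h\<bar>"])
      show "\<forall>\<^sub>F h in at 0. norm ((max 0 (0 + h))\<^sup>2 / h) \<le> \<bar>h::real\<bar>"
        by (intro always_eventually) (auto simp: max_def power2_eq_square)
      show "((\<lambda>h::real. \<bar>h\<bar>) \<longlongrightarrow> 0) (at 0)"
        by (rule tendsto_eq_intros | simp)+
    qed
    then show ?thesis using 2 by (simp add: DERIV_def)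
  next
    case 3
    have "((\<lambda>x::real. x\<^sup>2) has_real_derivative 2 * x) (at x)"
      by (auto intro!: derivative_eq_intros)
    then have "((\<lambda>x::real. (max 0 x)\<^sup>2) has_real_derivative 2 * x) (at x)"
      by (rule has_field_derivative_transform_within[where d="x"]) (use 3 in \<open>auto simp: dist_real_def max_def\<close>)
    then show ?thesis using 3 by simp
  qed
qed

lemma DERIV_ramp: "(ramp has_real_derivative tent x) (at x)"
proof -
  have d: "((\<lambda>x::real. (max 0 (x - c))\<^sup>2) has_real_derivative 2 * max 0 (x - c)) (at x)" for c
  proof -
    have "((\<lambda>x. x - c) has_real_derivative 1) (at x)" by (auto intro!: derivative_eq_intros)
    from DERIV_chain2[OF DERIV_max_sq this] show ?thesis by simp
  qed
  show ?thesis
    unfolding ramp_def tent_def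
    by (rule derivative_eq_intros d[of 0, simplified] d | simp)+
qed

lemma ramp_simps: "x \<le> 0 \<Longrightarrow> ramp x = 0" "x \<ge> 2 \<Longrightarrow> ramp x = 1"
  by (auto simp: ramp_def max_def power2_eq_square field_simps)

lemma tent_nonneg: "0 \<le> tent x"
  by (auto simp: tent_def max_def)

lemma tent_eq_0: "x \<le> 0 \<or> x \<ge> 2 \<Longrightarrow> tent x = 0"
  by (auto simp: tent_def max_def)

lemma ramp_bounds: "0 \<le> ramp x" "ramp x \<le> 1"
proof -
  have mono: "ramp x \<le> ramp y" if "x \<le> y" for x y
    by (rule DERIV_nonneg_imp_nondecreasing[OF that]) (use DERIV_ramp tent_nonneg in blast)
  show "0 \<le> ramp x" using mono[of "min x 0" x] by (simp add: ramp_simps)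
  show "ramp x \<le> 1" using mono[of x "max x 2"] by (simp add: ramp_simps)
qed

lemma continuous_on_tent: "continuous_on S (\<lambda>t. tent (g t))" if "continuous_on S g"
  unfolding tent_def by (intro continuous_intros that)

lemma lebesgue_on_half_line_compact_support:
  fixes F :: "real \<Rightarrow> 'a::euclidean_space"
  assumes cont: "continuous_on {c..d} F" and "0 \<le> c" and supp: "\<And>t. t \<notin> {c..d} \<Longrightarrow> F t = 0"
  shows "integrable (lebesgue_on {0..}) F" "(LINT t|lebesgue_on {0..}. F t) = integral {c..d} F"
proof -
  have i: "integrable (lebesgue_on {c..d}) F"
    using absolutely_integrable_continuous_real[OF cont] by (rule absolutely_integrable_imp_integrable) auto
  have "integrable lebesgue (\<lambda>t. indicator {c..d} t *\<^sub>R F t)"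
    using i by (subst (asm) integrable_restrict_space) auto
  moreover have "(\<lambda>t. indicator {c..d} t *\<^sub>R F t) = F"
    using supp by (auto simp: indicator_def)
  moreover have F0: "(\<lambda>t. indicator {0..} t *\<^sub>R F t) = F"
    using supp \<open>0 \<le> c\<close> by (auto simp: indicator_def fun_eq_iff)
  ultimately show "integrable (lebesgue_on {0..}) F"
    by (subst integrable_restrict_space) auto
  have "(LINT t|lebesgue_on {0..}. F t) = (LINT t|lebesgue. F t)"
    using F0 by (subst integral_restrict_space) auto
  also have "\<dots> = (LINT t|lebesgue_on {c..d}. F t)"
    using \<open>(\<lambda>t. indicator {c..d} t *\<^sub>R F t) = F\<close> by (simp add: integral_restrict_space)
  also have "\<dots> = integral {c..d} F"
    using i by (intro lebesgue_integral_eq_integral) auto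
  finally show "(LINT t|lebesgue_on {0..}. F t) = integral {c..d} F" .
qed

text \<open>Rescaled tents have integral 1 and support in \<open>[a, a + 2 * \<epsilon>]\<close>, so integrating against them
  approximates the point evaluation at \<open>a\<close>.\<close>

lemma tent_average:
  fixes h :: "real \<Rightarrow> 'a::euclidean_space"
  assumes h: "continuous_on {0..} h" and a: "0 \<le> a" and \<epsilon>: "0 < \<epsilon>"
    and close: "\<And>t. t \<in> {a..a + 2 * \<epsilon>} \<Longrightarrow> norm (h t - h a) \<le> r"
  shows "integrable (lebesgue_on {0..}) (\<lambda>t. (tent ((t - a) / \<epsilon>) / \<epsilon>) *\<^sub>R h t)"
    and "norm ((LINT t|lebesgue_on {0..}. (tent ((t - a) / \<epsilon>) / \<epsilon>) *\<^sub>R h t) - h a) \<le> r"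
proof -
  let ?k = "\<lambda>t. tent ((t - a) / \<epsilon>) / \<epsilon>"
  have hc: "continuous_on {a..a + 2 * \<epsilon>} h"
    using h by (rule continuous_on_subset) (use a in auto)
  have kc: "continuous_on {a..a + 2 * \<epsilon>} ?k"
    by (intro continuous_intros continuous_on_tent) (use \<epsilon> in auto)
  have k0: "?k t = 0" if "t \<notin> {a..a + 2 * \<epsilon>}" for t
  proof -
    have "(t - a) / \<epsilon> \<le> 0 \<or> (t - a) / \<epsilon> \<ge> 2"
      using that \<epsilon> by (auto simp: field_simps)
    then show ?thesis by (simp add: tent_eq_0)
  qed
  have khc: "continuous_on {a..a + 2 * \<epsilon>} (\<lambda>t. ?k t *\<^sub>R h t)"
    by (intro continuous_on_scaleR kc hc)
  note L = lebesgue_on_half_line_compact_support[OF khc a]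
  show "integrable (lebesgue_on {0..}) (\<lambda>t. ?k t *\<^sub>R h t)"
    by (rule L(1)) (use k0 in auto)
  have kint: "(?k has_integral 1) {a..a + 2 * \<epsilon>}"
  proof -
    have "(?k has_integral (ramp ((a + 2 * \<epsilon> - a) / \<epsilon>) - ramp ((a - a) / \<epsilon>))) {a..a + 2 * \<epsilon>}"
    proof (rule fundamental_theorem_of_calculus)
      fix t
      have "((\<lambda>t. ramp ((t - a) / \<epsilon>)) has_real_derivative tent ((t - a) / \<epsilon>) * (1 / \<epsilon>)) (at t)"
        by (rule DERIV_chain2[OF DERIV_ramp]) (use \<epsilon> in \<open>auto intro!: derivative_eq_intros\<close>)
      then show "((\<lambda>t. ramp ((t - a) / \<epsilon>)) has_vector_derivative ?k t) (at t within {a..a + 2 * \<epsilon>})"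
        by (simp add: has_real_derivative_iff_has_vector_derivative has_vector_derivative_at_within)
    qed (use \<epsilon> in auto)
    then show ?thesis using \<epsilon> by (simp add: ramp_simps)
  qed
  have i1: "(\<lambda>t. ?k t *\<^sub>R h t) integrable_on {a..a + 2 * \<epsilon>}"
    by (rule integrable_continuous_real[OF khc])
  have i2: "((\<lambda>t. ?k t *\<^sub>R h a) has_integral 1 *\<^sub>R h a) {a..a + 2 * \<epsilon>}"
    by (rule has_integral_scaleR_left[OF kint])
  have "norm (integral {a..a + 2 * \<epsilon>} (\<lambda>t. ?k t *\<^sub>R h t - ?k t *\<^sub>R h a)) \<le> integral {a..a + 2 * \<epsilon>} (\<lambda>t. ?k t * r)"
  proof (rule integral_norm_bound_integral)
    show "(\<lambda>t. ?k t *\<^sub>R h t - ?k t *\<^sub>R h a) integrable_on {a..a + 2 * \<epsilon>}"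
      using i1 i2 by (intro integrable_diff) (auto simp: has_integral_integrable)
    show "(\<lambda>t. ?k t * r) integrable_on {a..a + 2 * \<epsilon>}"
      using has_integral_mult_left[OF kint, of r] by blast
    fix t assume t: "t \<in> {a..a + 2 * \<epsilon>}"
    have "?k t \<ge> 0" using tent_nonneg \<epsilon> by simp
    moreover have "norm (?k t *\<^sub>R h t - ?k t *\<^sub>R h a) = \<bar>?k t\<bar> * norm (h t - h a)"
      by (simp only: scaleR_diff_right[symmetric] norm_scaleR)
    ultimately show "norm (?k t *\<^sub>R h t - ?k t *\<^sub>R h a) \<le> ?k t * r"
      using close[OF t] by (metis abs_of_nonneg mult_left_mono)
  qed
  also have "\<dots> = r" using integral_unique[OF has_integral_mult_left[OF kint, of r]] by (simp only: mult_1)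
  also have "integral {a..a + 2 * \<epsilon>} (\<lambda>t. ?k t *\<^sub>R h t - ?k t *\<^sub>R h a)
      = integral {a..a + 2 * \<epsilon>} (\<lambda>t. ?k t *\<^sub>R h t) - h a"
    using integral_diff[OF i1 has_integral_integrable[OF i2]] integral_unique[OF i2] by simp
  also have "integral {a..a + 2 * \<epsilon>} (\<lambda>t. ?k t *\<^sub>R h t) = (LINT t|lebesgue_on {0..}. ?k t *\<^sub>R h t)"
    by (rule L(2)[symmetric]) (use k0 in auto)
  finally show "norm ((LINT t|lebesgue_on {0..}. ?k t *\<^sub>R h t) - h a) \<le> r" .
qed

lemma W1inf_bounded:
  fixes h :: "real \<Rightarrow> 'a::euclidean_space"
  assumes "h \<in> W1inf {0..}"
  obtains B where "0 < B" "\<And>t. 0 \<le> t \<Longrightarrow> norm (h t) \<le> B"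
proof -
  have h: "continuous_on {0..} h" "norm_Linf {0..} h < \<infinity>"
    using assms by (auto simp: W1inf_def Linf_def)
  obtain c where c: "norm_Linf {0..} h \<le> ereal c"
    using h(2) by (cases "norm_Linf {0..} h") auto
  define B where "B = max 1 c"
  have "norm_Linf {0..} h \<le> ereal B" using c unfolding B_def by (rule order_trans) simp
  then have AE: "AE t in lebesgue_on {0..}. norm (h t) \<le> B"
    by (rule norm_Linf_le_imp_AE)
  have B: "0 < B" by (simp add: B_def)
  show ?thesis
  proof (rule that[OF B])
    fix t :: real assume t: "0 \<le> t"
    show "norm (h t) \<le> B"
    proof (rule AE_le_imp_le[of t "t + 1" "\<lambda>t. norm (h t)"])
      show "continuous_on {t..t + 1} (\<lambda>t. norm (h t))"
        using t by (intro continuous_on_norm continuous_on_subset[OF h(1)]) auto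
      show "AE t in lebesgue_on {t..t + 1}. norm (h t) \<le> B"
        by (rule AE_lebesgue_on_subset[OF AE]) (use t in auto)
    qed auto
  qed
qed

text \<open>Testing the weak derivative with a function that rises to 1 near \<open>a\<close> and falls back to 0 near \<open>b\<close>
  gives \<open>h a - h b\<close> in the limit of steep ramps, and a quantity of norm at most \<open>L * (b - a)\<close> on the side of
  the weak derivative.\<close>

lemma W1inf_lipschitz:
  fixes h :: "real \<Rightarrow> 'a::euclidean_space"
  assumes "h \<in> W1inf {0..}"
  obtains L where "0 < L" "\<And>s t. \<lbrakk>0 \<le> s; 0 \<le> t\<rbrakk> \<Longrightarrow> norm (h t - h s) \<le> L * \<bar>t - s\<bar>"
proof -
  obtain h' where h: "continuous_on {0..} h" and h': "h' \<in> borel_measurable (lebesgue_on {0..})"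
     "norm_Linf {0..} h' < \<infinity>" "weak_derivative {0..} h h'"
    using assms by (auto simp: W1inf_def Linf_def)
  obtain c where c: "norm_Linf {0..} h' \<le> ereal c"
    using h'(2) by (cases "norm_Linf {0..} h'") auto
  define L where "L = max 1 c"
  have L: "L > 0" by (simp add: L_def)
  have "norm_Linf {0..} h' \<le> ereal L" using c unfolding L_def by (rule order_trans) simp
  then have AE: "AE t in lebesgue_on {0..}. norm (h' t) \<le> L"
    by (rule norm_Linf_le_imp_AE)
  have pos: "norm (h b - h a) \<le> L * (b - a) + r" if ab: "0 < a" "a < b" and r: "0 < r" for a b r
  proof -
    have "\<exists>d>0. \<forall>t\<in>{0..}. dist t x < d \<longrightarrow> dist (h t) (h x) < r / 4" if "0 \<le> x" for x
      using h[unfolded continuous_on_iff, rule_format, of x "r / 4"] that r by auto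
    from this[of a] this[of b] obtain da db where d: "da > 0" "db > 0"
      "\<And>t. 0 \<le> t \<Longrightarrow> dist t a < da \<Longrightarrow> dist (h t) (h a) < r / 4"
      "\<And>t. 0 \<le> t \<Longrightarrow> dist t b < db \<Longrightarrow> dist (h t) (h b) < r / 4"
      using ab by auto
    define \<epsilon> where "\<epsilon> = Min {da, db, r / (2 * L)} / 4"
    have \<epsilon>: "0 < \<epsilon>" "2 * \<epsilon> < da" "2 * \<epsilon> < db" "2 * \<epsilon> * L \<le> r / 2"
    proof -
      have m: "0 < Min {da, db, r / (2 * L)}" "Min {da, db, r / (2 * L)} \<le> da" "Min {da, db, r / (2 * L)} \<le> db"
        "Min {da, db, r / (2 * L)} \<le> r / (2 * L)"
        using d L r by auto
      then show "0 < \<epsilon>" "2 * \<epsilon> < da" "2 * \<epsilon> < db" by (auto simp: \<epsilon>_def)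
      have "2 * \<epsilon> \<le> r / (2 * L)" using m by (auto simp: \<epsilon>_def)
      then show "2 * \<epsilon> * L \<le> r / 2" using L by (simp add: field_simps)
    qed
    define \<phi> where "\<phi> = (\<lambda>t. ramp ((t - a) / \<epsilon>) - ramp ((t - b) / \<epsilon>))"
    define \<phi>' where "\<phi>' = (\<lambda>t. tent ((t - a) / \<epsilon>) / \<epsilon> - tent ((t - b) / \<epsilon>) / \<epsilon>)"
    have der: "(\<phi> has_real_derivative \<phi>' t) (at t)" for t
    proof -
      have *: "((\<lambda>t. ramp ((t - x) / \<epsilon>)) has_real_derivative tent ((t - x) / \<epsilon>) * (1 / \<epsilon>)) (at t)" for x
        by (rule DERIV_chain2[OF DERIV_ramp]) (use \<epsilon> in \<open>auto intro!: derivative_eq_intros\<close>)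
      show ?thesis unfolding \<phi>_def \<phi>'_def
        by (rule derivative_eq_intros * | simp)+
    qed
    have deriv: "deriv \<phi> = \<phi>'" using der by (auto intro: DERIV_imp_deriv)
    have \<phi>0: "\<phi> t = 0" if "t \<notin> {a..b + 2 * \<epsilon>}" for t
    proof (cases "t < a")
      case True
      then have "(t - a) / \<epsilon> \<le> 0" "(t - b) / \<epsilon> \<le> 0" using \<epsilon>(1) ab by (auto simp: field_simps)
      then show ?thesis by (simp add: \<phi>_def ramp_simps)
    next
      case False
      then have "(t - a) / \<epsilon> \<ge> 2" "(t - b) / \<epsilon> \<ge> 2" using \<epsilon>(1) ab that by (auto simp: field_simps)
      then show ?thesis by (simp add: \<phi>_def ramp_simps)
    qed
    have \<phi>1: "\<bar>\<phi> t\<bar> \<le> 1" for t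
      using ramp_bounds[of "(t - a) / \<epsilon>"] ramp_bounds[of "(t - b) / \<epsilon>"] by (auto simp: \<phi>_def)
    have "test_function {0..} \<phi>"
      unfolding test_function_def
    proof (intro conjI exI[of _ "{a..b + 2 * \<epsilon>}"] allI impI \<phi>0)
      show "\<phi> differentiable_on UNIV"
        using der by (auto simp: differentiable_on_def real_differentiable_def)
      show "continuous_on UNIV (deriv \<phi>)"
        unfolding deriv \<phi>'_def by (intro continuous_intros continuous_on_tent) (use \<epsilon> in auto)
      show "{a..b + 2 * \<epsilon>} \<subseteq> interior {0..}" using ab by auto
    qed auto
    then have weak: "(LINT t|lebesgue_on {0..}. \<phi>' t *\<^sub>R h t) = - (LINT t|lebesgue_on {0..}. \<phi> t *\<^sub>R h' t)"
      using h'(3) unfolding weak_derivative_def deriv[symmetric] by blast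
    have A: "norm (h t - h a) \<le> r / 4" if "t \<in> {a..a + 2 * \<epsilon>}" for t
      using d(3)[of t] that ab \<epsilon> by (auto simp: dist_norm)
    have B: "norm (h t - h b) \<le> r / 4" if "t \<in> {b..b + 2 * \<epsilon>}" for t
      using d(4)[of t] that ab \<epsilon> by (auto simp: dist_norm)
    note TA = tent_average[OF h _ \<epsilon>(1) A, simplified]
    note TB = tent_average[OF h _ \<epsilon>(1) B, simplified]
    have "(LINT t|lebesgue_on {0..}. \<phi>' t *\<^sub>R h t) =
        (LINT t|lebesgue_on {0..}. (tent ((t - a) / \<epsilon>) / \<epsilon>) *\<^sub>R h t) - (LINT t|lebesgue_on {0..}. (tent ((t - b) / \<epsilon>) / \<epsilon>) *\<^sub>R h t)"
      unfolding \<phi>'_def scaleR_diff_left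
      by (rule Bochner_Integration.integral_diff) (use TA(1) TB(1) ab in auto)
    moreover have "norm ((LINT t|lebesgue_on {0..}. (tent ((t - a) / \<epsilon>) / \<epsilon>) *\<^sub>R h t) - h a) \<le> r / 4"
      "norm ((LINT t|lebesgue_on {0..}. (tent ((t - b) / \<epsilon>) / \<epsilon>) *\<^sub>R h t) - h b) \<le> r / 4"
      using TA(2) TB(2) ab by auto
    moreover have "norm (p - q) \<le> norm (X - Y) + r / 4 + r / 4"
      if "norm (X - p) \<le> r / 4" "norm (Y - q) \<le> r / 4" for X Y p q :: 'a
      using that by norm
    ultimately have "norm (h a - h b) \<le> norm (LINT t|lebesgue_on {0..}. \<phi>' t *\<^sub>R h t) + r / 4 + r / 4"
      by simp
    moreover have "norm (LINT t|lebesgue_on {0..}. \<phi> t *\<^sub>R h' t) \<le> L * (b + 2 * \<epsilon> - a)"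
    proof -
      have ic: "continuous_on {a..b + 2 * \<epsilon>} (indicator {a..b + 2 * \<epsilon>} :: real \<Rightarrow> real)"
        by (rule continuous_on_eq[OF continuous_on_const[of _ 1]]) auto
      have i: "integrable (lebesgue_on {0..}) (indicator {a..b + 2 * \<epsilon>} :: real \<Rightarrow> real)"
        by (rule lebesgue_on_half_line_compact_support(1)[OF ic]) (use ab in auto)
      have ii: "(LINT t|lebesgue_on {0..}. indicator {a..b + 2 * \<epsilon>} t :: real) = b + 2 * \<epsilon> - a"
      proof -
        have "(LINT t|lebesgue_on {0..}. indicator {a..b + 2 * \<epsilon>} t :: real) = integral {a..b + 2 * \<epsilon>} (indicator {a..b + 2 * \<epsilon>})"
          by (rule lebesgue_on_half_line_compact_support(2)[OF ic]) (use ab in auto)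
        also have "\<dots> = integral {a..b + 2 * \<epsilon>} (\<lambda>_. 1)"
          by (rule integral_cong) auto
        finally show ?thesis using ab \<epsilon> by simp
      qed
      have "norm (LINT t|lebesgue_on {0..}. \<phi> t *\<^sub>R h' t) \<le> (LINT t|lebesgue_on {0..}. L * indicator {a..b + 2 * \<epsilon>} t)"
      proof (rule order_trans[OF integral_norm_bound integral_mono_AE'])
        show "integrable (lebesgue_on {0..}) (\<lambda>t. L * indicator {a..b + 2 * \<epsilon>} t)"
          using i by simp
        show "AE t in lebesgue_on {0..}. norm (\<phi> t *\<^sub>R h' t) \<le> L * indicator {a..b + 2 * \<epsilon>} t"
          using AE
        proof (rule eventually_mono)
          fix t assume "norm (h' t) \<le> L"
          then have "\<bar>\<phi> t\<bar> * norm (h' t) \<le> 1 * L"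
            using \<phi>1 by (intro mult_mono) auto
          then show "norm (\<phi> t *\<^sub>R h' t) \<le> L * indicator {a..b + 2 * \<epsilon>} t"
            using \<phi>0[of t] by (auto simp: indicator_def)
        qed
        show "AE t in lebesgue_on {0..}. 0 \<le> L * indicator {a..b + 2 * \<epsilon>} t"
          using L by (intro always_eventually) (auto simp: indicator_def)
      qed
      also have "\<dots> = L * (b + 2 * \<epsilon> - a)" using ii by simp
      finally show ?thesis .
    qed
    ultimately show ?thesis
      using weak \<epsilon>(4) by (simp add: algebra_simps norm_minus_commute)
  qed
  have pos': "norm (h b - h a) \<le> L * (b - a)" if ab: "0 \<le> a" "a \<le> b" for a b
  proof (cases "a = b")
    case False
    then have lt: "a < b" using ab by simp
    have "norm (h b - h x) \<le> L * (b - x)" if "0 < x" "x < b" for x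
      by (rule field_le_epsilon) (rule pos[OF that])
    then have *: "norm (h b - h x) - L * (b - x) \<le> 0" if "x \<in> {a<..<b}" for x using that ab by auto
    have "norm (h b - h a) - L * (b - a) \<le> 0"
    proof (rule continuous_le_on_closure[of "{a<..<b}" "\<lambda>x. norm (h b - h x) - L * (b - x)" a 0])
      show "continuous_on (closure {a<..<b}) (\<lambda>x. norm (h b - h x) - L * (b - x))"
        using lt ab by (intro continuous_intros continuous_on_subset[OF h]) auto
    qed (use lt * in auto)
    then show ?thesis by simp
  qed simp
  show ?thesis
  proof (rule that[OF L])
    fix s t :: real assume "0 \<le> s" "0 \<le> t"
    then show "norm (h t - h s) \<le> L * \<bar>t - s\<bar>"
      using pos'[of s t] pos'[of t s] by (cases "s \<le> t") (auto simp: norm_minus_commute)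
  qed
qed

section \<open>Control systems and their solutions in integral form\<close>

locale control_system =
  fixes t0 \<sigma> :: real
    and f :: "real^'q::finite \<Rightarrow> real^'m::finite"
    and g :: "real^'q \<Rightarrow> real^'m^'m"
    and Op :: "('m, 'q) operator"
  assumes t0_nonneg: "0 \<le> t0" and \<sigma>_nonneg: "0 \<le> \<sigma>"
    and sys: "(f, g, Op) \<in> system_class t0 \<sigma>"
    and Op_continuous: "continuous_op t0 \<sigma> Op"
begin

definition rhs :: "(real \<Rightarrow> real^'m) \<Rightarrow> (real \<Rightarrow> real^'m) \<Rightarrow> real \<Rightarrow> real^'m" where
  "rhs y u t = f (Op y t) + g (Op y t) *v u t"

lemma f_cont: "continuous_on UNIV f" and g_cont: "continuous_on UNIV g"
  and g_pos: "z \<noteq> 0 \<Longrightarrow> 0 < z \<bullet> (g \<xi> *v z)" and Op_class: "Op \<in> operator_class t0 \<sigma>"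
  using sys by (auto simp: system_class_def)

lemma continuous_on_rhs_pair: "continuous_on UNIV (\<lambda>p. f (fst p) + g (fst p) *v snd p)"
proof -
  have "continuous_on UNIV (\<lambda>p. f (fst p))" "continuous_on UNIV (\<lambda>p. g (fst p))"
    by (rule continuous_on_compose2[OF f_cont] continuous_on_compose2[OF g_cont];
        auto intro: continuous_intros)+
  then show ?thesis
    unfolding matrix_vector_mult_def
    by (intro continuous_intros) auto
qed

lemma Op_measurable:
  assumes "continuous_on {t0 - \<sigma>..} y" "S \<subseteq> {t0..}"
  shows "Op y \<in> borel_measurable (lebesgue_on S)"
proof -
  have "Op y \<in> borel_measurable (lebesgue_on {0..})"
    using assms Op_class by (auto simp: operator_class_def Linf_loc_def)
  then show ?thesis
    by (rule measurable_restrict_mono) (use assms t0_nonneg in auto)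
qed

lemma Op_causal:
  assumes "continuous_on {t0 - \<sigma>..} y1" "continuous_on {t0 - \<sigma>..} y2" "t0 \<le> t"
    "\<And>s. s \<in> {t0 - \<sigma>..t} \<Longrightarrow> y1 s = y2 s"
  shows "AE s in lebesgue_on {t0..t}. Op y1 s = Op y2 s"
proof -
  have "causal_op t0 \<sigma> Op" using Op_class by (auto simp: operator_class_def)
  then show ?thesis using assms unfolding causal_op_def by blast
qed

lemma Op_bounded:
  obtains c where "\<And>y. \<lbrakk>continuous_on {t0 - \<sigma>..} y; \<forall>t\<ge>t0 - \<sigma>. norm (y t) \<le> R\<rbrakk>
    \<Longrightarrow> AE s in lebesgue_on {t0..}. norm (Op y s) \<le> c"
proof -
  have "bibo_op t0 \<sigma> Op" using Op_class by (auto simp: operator_class_def)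
  moreover have "max 1 R > 0" by simp
  ultimately obtain c1 where c1: "\<And>y. \<lbrakk>continuous_on {t0 - \<sigma>..} y; \<forall>t\<ge>t0 - \<sigma>. norm (y t) \<le> max 1 R\<rbrakk>
      \<Longrightarrow> norm_Linf {t0..} (Op y) \<le> ereal c1"
    unfolding bibo_op_def by blast
  show ?thesis
  proof (rule that[of c1])
    fix y :: "real \<Rightarrow> real^'m" assume y: "continuous_on {t0 - \<sigma>..} y" "\<forall>t\<ge>t0 - \<sigma>. norm (y t) \<le> R"
    have "norm_Linf {t0..} (Op y) \<le> ereal c1"
      by (rule c1[OF y(1)]) (use y(2) in fastforce)
    then show "AE s in lebesgue_on {t0..}. norm (Op y s) \<le> c1"
      by (rule norm_Linf_le_imp_AE)
  qed
qed

text \<open>The input value is quantified inside the almost-everywhere statement so that the exceptional null set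
  does not depend on the control.\<close>

definition rhs_bound :: "real \<Rightarrow> real \<Rightarrow> real \<Rightarrow> bool" where
  "rhs_bound R U M \<longleftrightarrow> 0 < M \<and>
     (\<forall>y. continuous_on {t0 - \<sigma>..} y \<and> (\<forall>t\<ge>t0 - \<sigma>. norm (y t) \<le> R) \<longrightarrow>
        (AE s in lebesgue_on {t0..}. \<forall>v. norm v \<le> U \<longrightarrow> norm (f (Op y s) + g (Op y s) *v v) \<le> M))"

lemma rhs_bound_exists: obtains M where "rhs_bound R U M"
proof -
  obtain c where c: "\<And>y. \<lbrakk>continuous_on {t0 - \<sigma>..} y; \<forall>t\<ge>t0 - \<sigma>. norm (y t) \<le> R\<rbrakk>
    \<Longrightarrow> AE s in lebesgue_on {t0..}. norm (Op y s) \<le> c"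
    using Op_bounded[of R] by blast
  let ?K = "cball (0::real^'q) c \<times> cball (0::real^'m) U"
  have "compact ?K" by (intro compact_Times) auto
  then obtain M where M: "0 < M" "\<And>p. p \<in> ?K \<Longrightarrow> norm (f (fst p) + g (fst p) *v snd p) \<le> M"
    using continuous_on_compact_bounded[OF _ continuous_on_subset[OF continuous_on_rhs_pair]] by blast
  have "rhs_bound R U M"
    unfolding rhs_bound_def
  proof (intro conjI allI impI M(1); elim conjE)
    fix y :: "real \<Rightarrow> real^'m" assume "continuous_on {t0 - \<sigma>..} y" "\<forall>t\<ge>t0 - \<sigma>. norm (y t) \<le> R"
    from c[OF this] show "AE s in lebesgue_on {t0..}. \<forall>v. norm v \<le> U \<longrightarrow> norm (f (Op y s) + g (Op y s) *v v) \<le> M"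
      by (rule eventually_mono) (use M(2)[of "(_, _)"] in auto)
  qed
  then show ?thesis by (rule that)
qed

lemma rhs_bound_AE:
  assumes M: "rhs_bound R U M" and y: "continuous_on {t0 - \<sigma>..} y" "\<forall>t\<ge>t0 - \<sigma>. norm (y t) \<le> R"
    and u: "\<And>t. t \<in> {a..<b} \<Longrightarrow> norm (u t) \<le> U" and a: "t0 \<le> a"
  shows "AE t in lebesgue_on {a..b}. norm (rhs y u t) \<le> M"
proof -
  have "AE s in lebesgue_on {t0..}. \<forall>v. norm v \<le> U \<longrightarrow> norm (f (Op y s) + g (Op y s) *v v) \<le> M"
    using M y by (simp add: rhs_bound_def)
  then have "AE s in lebesgue_on {a..b}. \<forall>v. norm v \<le> U \<longrightarrow> norm (f (Op y s) + g (Op y s) *v v) \<le> M"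
    by (rule AE_lebesgue_on_subset) (use a in auto)
  then have "negligible ({s\<in>{a..b}. \<not> (\<forall>v. norm v \<le> U \<longrightarrow> norm (f (Op y s) + g (Op y s) *v v) \<le> M)} \<union> {b})"
    by (intro negligible_Un) (auto simp: AE_lebesgue_on_iff_negligible)
  then have "negligible {s\<in>{a..b}. \<not> norm (rhs y u s) \<le> M}"
    by (rule negligible_subset) (use u in \<open>force simp: rhs_def\<close>)
  then show ?thesis
    by (simp add: AE_lebesgue_on_iff_negligible)
qed

lemma rhs_measurable:
  assumes "continuous_on {t0 - \<sigma>..} y" "S \<subseteq> {t0..}" "u \<in> borel_measurable (lebesgue_on S)"
  shows "rhs y u \<in> borel_measurable (lebesgue_on S)"
  unfolding rhs_def
  by (rule borel_measurable_continuous_Pair[OF Op_measurable[OF assms(1,2)] assms(3)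
        continuous_on_rhs_pair])

lemma stopped_continuous:
  assumes "continuous_on {t0 - \<sigma>..b} y" "t0 \<le> b"
  shows "continuous_on {t0 - \<sigma>..} (stopped b y)"
  unfolding stopped_def
  by (rule continuous_on_compose2[OF assms(1)]) (use assms \<sigma>_nonneg in \<open>auto intro!: continuous_intros\<close>)

text \<open>Causality: only the past matters. The inputs need not agree at the right end \<open>c\<close>, a null set; this is what
  allows step functions to be glued on half-open intervals.\<close>

lemma rhs_integral_cong:
  assumes y: "continuous_on {t0 - \<sigma>..} y1" "continuous_on {t0 - \<sigma>..} y2"
    and eq: "\<And>s. s \<in> {t0 - \<sigma>..c} \<Longrightarrow> y1 s = y2 s" "\<And>s. s \<in> {a..<c} \<Longrightarrow> u1 s = u2 s"
    and a: "t0 \<le> a" "t \<le> c"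
    and int: "(rhs y1 u1 has_integral i) {a..t}"
  shows "(rhs y2 u2 has_integral i) {a..t}"
proof (cases "t0 \<le> c")
  case True
  have neg: "negligible {s\<in>{t0..c}. \<not> Op y1 s = Op y2 s}"
    using Op_causal[OF y True eq(1)] by (simp add: AE_lebesgue_on_iff_negligible)
  have N: "negligible ({s\<in>{t0..c}. \<not> Op y1 s = Op y2 s} \<union> {c})"
    by (intro negligible_Un neg) auto
  show ?thesis
    by (rule has_integral_spike[OF N _ int]) (use a eq(2) in \<open>auto simp: rhs_def\<close>)
next
  case False
  then have "{a..t} = {}" using a by auto
  then show ?thesis using int by (auto simp: has_integral_empty_eq)
qed

text \<open>Caratheodory solutions in integral form; the history on \<open>[t0 - \<sigma>, a]\<close> is part of \<open>y\<close>. The output is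
  stopped because the operator needs a function that is continuous on a half-line.\<close>

definition solves :: "real \<Rightarrow> real \<Rightarrow> (real \<Rightarrow> real^'m) \<Rightarrow> (real \<Rightarrow> real^'m) \<Rightarrow> bool" where
  "solves a b u y \<longleftrightarrow> continuous_on {t0 - \<sigma>..b} y \<and>
     (\<forall>t\<in>{a..b}. (rhs (stopped b y) u has_integral (y t - y a)) {a..t})"

lemma solves_continuous: "solves a b u y \<Longrightarrow> continuous_on {t0 - \<sigma>..b} y"
  by (simp add: solves_def)

lemma solves_cong:
  assumes s: "solves a b u1 y1" and ab: "t0 \<le> a" "a \<le> b"
    and eq: "\<And>s. s \<in> {t0 - \<sigma>..b} \<Longrightarrow> y1 s = y2 s" "\<And>s. s \<in> {a..<b} \<Longrightarrow> u1 s = u2 s"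
  shows "solves a b u2 y2"
proof -
  have c1: "continuous_on {t0 - \<sigma>..b} y1" using s by (simp add: solves_def)
  then have c2: "continuous_on {t0 - \<sigma>..b} y2"
    by (rule continuous_on_eq) (rule eq(1))
  have sc: "continuous_on {t0 - \<sigma>..} (stopped b y1)" "continuous_on {t0 - \<sigma>..} (stopped b y2)"
    using stopped_continuous[OF c1] stopped_continuous[OF c2] ab by auto
  show ?thesis unfolding solves_def
  proof (intro conjI ballI c2)
    fix t assume t: "t \<in> {a..b}"
    have "(rhs (stopped b y1) u1 has_integral (y1 t - y1 a)) {a..t}"
      using s t by (simp add: solves_def)
    then have "(rhs (stopped b y2) u2 has_integral (y1 t - y1 a)) {a..t}"
      by (rule rhs_integral_cong[rotated -1, where c=b])
         (use sc ab eq t in auto, simp add: stopped_def)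
    moreover have "y1 t = y2 t" "y1 a = y2 a" using eq(1) t ab \<sigma>_nonneg by auto
    ultimately show "(rhs (stopped b y2) u2 has_integral (y2 t - y2 a)) {a..t}" by simp
  qed
qed

lemma solves_integral_stopped:
  assumes s: "solves a b u y" and ab: "t0 \<le> a" "t \<in> {a..b}" and c: "t \<le> c" and yc: "continuous_on {t0 - \<sigma>..c} y"
  shows "(rhs (stopped c y) u has_integral (y t - y a)) {a..t}"
proof -
  have "(rhs (stopped b y) u has_integral (y t - y a)) {a..t}"
    using s ab by (simp add: solves_def)
  then show ?thesis
    by (rule rhs_integral_cong[rotated -1, where c=t])
       (use s ab c yc in \<open>auto intro!: stopped_continuous simp: solves_def\<close>, simp add: stopped_def)
qed

lemma solves_restrict:
  assumes s: "solves a b u y" and ab: "t0 \<le> a" "a \<le> c" "c \<le> b"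
  shows "solves a c u y"
  unfolding solves_def
proof (intro conjI ballI)
  show c: "continuous_on {t0 - \<sigma>..c} y"
    using solves_continuous[OF s] by (rule continuous_on_subset) (use ab in auto)
  fix t assume "t \<in> {a..c}"
  then show "(rhs (stopped c y) u has_integral (y t - y a)) {a..t}"
    using ab by (intro solves_integral_stopped[OF s _ _ _ c]) auto
qed

lemma solves_shift:
  assumes s: "solves a b u y" and ab: "a \<le> c"
  shows "solves c b u y"
  unfolding solves_def
proof (intro conjI ballI solves_continuous[OF s])
  fix t assume t: "t \<in> {c..b}"
  have i: "(rhs (stopped b y) u has_integral (y t - y a)) {a..t}"
    "(rhs (stopped b y) u has_integral (y c - y a)) {a..c}"
    using s t ab by (auto simp: solves_def)
  have "rhs (stopped b y) u integrable_on {c..t}"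
    by (rule integrable_subinterval_real[OF has_integral_integrable[OF i(1)]]) (use ab in auto)
  then obtain j where j: "(rhs (stopped b y) u has_integral j) {c..t}" by auto
  have "(rhs (stopped b y) u has_integral ((y c - y a) + j)) {a..t}"
    by (rule has_integral_combine[OF ab _ i(2) j]) (use t in auto)
  then have "(y c - y a) + j = y t - y a"
    by (rule has_integral_unique[OF _ i(1)])
  then have "j = y t - y c" by (simp add: algebra_simps)
  then show "(rhs (stopped b y) u has_integral (y t - y c)) {c..t}" using j by simp
qed

lemma solves_append:
  assumes s: "solves a c u y" "solves c b u y" and ab: "t0 \<le> a" "a \<le> c" "c \<le> b"
  shows "solves a b u y"
  unfolding solves_def
proof (intro conjI ballI solves_continuous[OF s(2)])
  note yb = solves_continuous[OF s(2)]
  fix t assume t: "t \<in> {a..b}"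
  show "(rhs (stopped b y) u has_integral (y t - y a)) {a..t}"
  proof (cases "t \<le> c")
    case True
    then show ?thesis using t ab by (intro solves_integral_stopped[OF s(1) _ _ _ yb]) auto
  next
    case False
    have 1: "(rhs (stopped b y) u has_integral (y c - y a)) {a..c}"
      using t ab by (intro solves_integral_stopped[OF s(1) _ _ _ yb]) auto
    have 2: "(rhs (stopped b y) u has_integral (y t - y c)) {c..t}"
      using t ab False by (intro solves_integral_stopped[OF s(2) _ _ _ yb]) auto
    have "(rhs (stopped b y) u has_integral ((y c - y a) + (y t - y c))) {a..t}"
      by (rule has_integral_combine[OF _ _ 1 2]) (use False ab in auto)
    then show ?thesis by simp
  qed
qed

lemma solves_lipschitz:
  assumes s: "solves a b u y" and a: "t0 \<le> a"
    and M: "rhs_bound R U M"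
    and R: "\<And>t. t \<in> {t0 - \<sigma>..b} \<Longrightarrow> norm (y t) \<le> R"
    and U: "\<And>t. t \<in> {a..<b} \<Longrightarrow> norm (u t) \<le> U"
    and t: "s \<in> {a..b}" "t \<in> {a..b}"
  shows "norm (y t - y s) \<le> M * \<bar>t - s\<bar>"
proof -
  have *: "norm (y t - y s) \<le> M * (t - s)" if t: "s \<in> {a..b}" "t \<in> {a..b}" "s \<le> t" for s t
  proof -
    have i: "(rhs (stopped b y) u has_integral (y t - y s)) {s..t}"
      using solves_shift[OF s, of s] t by (auto simp: solves_def)
    have tb: "t0 \<le> b" using a t by auto
    have "AE r in lebesgue_on {s..t}. norm (rhs (stopped b y) u r) \<le> M"
    proof (rule rhs_bound_AE[OF M])
      show "continuous_on {t0 - \<sigma>..} (stopped b y)"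
        using solves_continuous[OF s] tb by (rule stopped_continuous)
      show "\<forall>t\<ge>t0 - \<sigma>. norm (stopped b y t) \<le> R"
        using R tb \<sigma>_nonneg by (auto simp: stopped_def)
    qed (use U a t in auto)
    then show ?thesis
      using norm_integral_le_AE[OF i t(3)] M by (auto simp: rhs_bound_def)
  qed
  show ?thesis
    using *[of s t] *[of t s] t by (cases "s \<le> t") (auto simp: norm_minus_commute)
qed

abbreviation sol where "sol \<equiv> solution t0 \<sigma> (f, g, Op)"
abbreviation max_sol where "max_sol \<equiv> maximal_solution t0 \<sigma> (f, g, Op)"

lemma solution_imp_solves:
  assumes sol: "sol th yh u y \<omega>" and yh: "continuous_on {t0 - \<sigma>..th} yh"
    and th: "t0 \<le> th" "th \<le> b" "ereal b < \<omega>"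
  shows "solves th b u y"
  unfolding solves_def
proof (intro conjI ballI)
  have hist: "\<And>s. s \<in> {t0 - \<sigma>..th} \<Longrightarrow> y s = yh s"
    and ac: "\<And>s. \<lbrakk>s \<ge> th; ereal s < \<omega>\<rbrakk> \<Longrightarrow> abs_continuous_on th s y"
    and der: "\<And>s. \<lbrakk>s \<ge> th; ereal s < \<omega>\<rbrakk> \<Longrightarrow> AE t in lebesgue_on {th..s}.
              (y has_vector_derivative rhs (stopped s y) u t) (at t)"
    using sol by (auto simp: solution_def rhs_def)
  have "continuous_on {t0 - \<sigma>..th} y"
    by (rule continuous_on_eq[OF yh]) (simp add: hist)
  then have "continuous_on ({t0 - \<sigma>..th} \<union> {th..b}) y"
    using abs_continuous_on_imp_continuous_on[OF ac[OF th(2,3)]]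
    by (intro continuous_on_closed_Un) auto
  moreover have "{t0 - \<sigma>..th} \<union> {th..b} = {t0 - \<sigma>..b}" using th \<sigma>_nonneg by auto
  ultimately show "continuous_on {t0 - \<sigma>..b} y" by simp
  fix t assume t: "t \<in> {th..b}"
  then have tw: "ereal t < \<omega>" using th(3) by (auto intro: le_less_trans[of _ "ereal b"])
  show "(rhs (stopped b y) u has_integral (y t - y th)) {th..t}"
  proof (rule has_integral_abs_continuous)
    show "abs_continuous_on th t y" using ac tw t by auto
    show "AE t in lebesgue_on {th..t}. (y has_vector_derivative rhs (stopped b y) u t) (at t)"
      by (rule AE_lebesgue_on_subset[OF der[OF th(2,3)]]) (use t in auto)
  qed (use t in auto)
qed

text \<open>On compact intervals the output is bounded, hence so is the right-hand side; the integral equation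
  makes the output Lipschitz and differentiable wherever the indefinite integral is.\<close>

lemma solves_imp_solution:
  assumes th: "t0 \<le> th" "ereal th < \<omega>" and hist: "\<And>s. s \<in> {t0 - \<sigma>..th} \<Longrightarrow> y s = yh s"
    and s: "\<And>s. \<lbrakk>th \<le> s; ereal s < \<omega>\<rbrakk> \<Longrightarrow> solves th s u y"
    and u: "\<And>s. \<lbrakk>th \<le> s; ereal s < \<omega>\<rbrakk> \<Longrightarrow> \<exists>U. \<forall>t\<in>{th..<s}. norm (u t) \<le> U"
  shows "sol th yh u y \<omega>"
proof -
  have "abs_continuous_on th b y \<and> (AE t in lebesgue_on {th..b}.
              (y has_vector_derivative rhs (stopped b y) u t) (at t))"
    if b: "th \<le> b" "ereal b < \<omega>" for b
  proof
    have sb: "solves th b u y" by (rule s[OF b])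
    obtain U where U: "\<And>t. t \<in> {th..<b} \<Longrightarrow> norm (u t) \<le> U" using u[OF b] by blast
    obtain R where R: "\<And>t. t \<in> {t0 - \<sigma>..b} \<Longrightarrow> norm (y t) \<le> R"
      using continuous_on_Icc_bounded[OF solves_continuous[OF sb]] by blast
    obtain M where M: "rhs_bound R U M" by (rule rhs_bound_exists)
    show "abs_continuous_on th b y"
      by (rule abs_continuous_on_lipschitz[of th b y M])
         (rule solves_lipschitz[OF sb th(1) M R U])
    let ?v = "rhs (stopped b y) u"
    have i: "(?v has_integral (y t - y th)) {th..t}" if "t \<in> {th..b}" for t
      using sb that by (simp add: solves_def)
    have "?v integrable_on {th..b}" using i[of b] b by auto
    from AE_has_vector_derivative_integral[OF this]
    have "negligible ({t\<in>{th..b}. \<not> ((\<lambda>x. integral {th..x} ?v) has_vector_derivative ?v t) (at t)} \<union> {th, b})"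
      by (intro negligible_Un) (auto simp: AE_lebesgue_on_iff_negligible)
    moreover have "(y has_vector_derivative ?v t) (at t)"
      if t: "t \<in> {th<..<b}" and d: "((\<lambda>x. integral {th..x} ?v) has_vector_derivative ?v t) (at t)" for t
    proof -
      have "((\<lambda>x. y th + integral {th..x} ?v) has_vector_derivative ?v t) (at t)"
        using d by (auto intro!: derivative_eq_intros)
      then show ?thesis
        by (rule has_vector_derivative_transform_within_open[where S="{th<..<b}"])
           (use t integral_unique[OF i] in auto)
    qed
    ultimately have "negligible {t\<in>{th..b}. \<not> (y has_vector_derivative ?v t) (at t)}"
      by (elim negligible_subset) force
    then show "AE t in lebesgue_on {th..b}. (y has_vector_derivative ?v t) (at t)"
      by (simp add: AE_lebesgue_on_iff_negligible)
  qed
  then show ?thesis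
    using th hist by (auto simp: solution_def rhs_def)
qed

section \<open>Local existence\<close>

lemma rhs_integrable:
  assumes M: "rhs_bound R U M" and y: "continuous_on {t0 - \<sigma>..} y" "\<forall>t\<ge>t0 - \<sigma>. norm (y t) \<le> R"
    and u: "u \<in> borel_measurable (lebesgue_on {a..b})" "\<And>t. t \<in> {a..<b} \<Longrightarrow> norm (u t) \<le> U" and a: "t0 \<le> a"
  shows "integrable (lebesgue_on {a..b}) (rhs y u)"
  by (rule integrable_lebesgue_on_AE_bounded[OF rhs_measurable[OF y(1) _ u(1)] rhs_bound_AE[OF M y u(2) a]])
     (use a in auto)

text \<open>Continuity of the operator provides convergence in \<open>L1\<close>; a subsequence converges almost everywhere.\<close>

lemma Op_converges_AE:
  assumes z: "\<And>n. continuous_on {t0 - \<sigma>..} (z n)" "\<And>n. \<forall>t\<ge>t0 - \<sigma>. norm (z n t) \<le> R"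
    and y: "continuous_on {t0 - \<sigma>..} y" "\<forall>t\<ge>t0 - \<sigma>. norm (y t) \<le> R"
    and lim: "uniform_limit {t0 - \<sigma>..b} z y sequentially" and b: "t0 \<le> b"
  obtains r :: "nat \<Rightarrow> nat" where "strict_mono r"
    "AE s in lebesgue_on {t0..b}. (\<lambda>n. Op (z (r n)) s) \<longlonglongrightarrow> Op y s"
proof -
  let ?d = "\<lambda>n s. Op (z n) s - Op y s"
  obtain c where c: "\<And>y. \<lbrakk>continuous_on {t0 - \<sigma>..} y; \<forall>t\<ge>t0 - \<sigma>. norm (y t) \<le> R\<rbrakk>
    \<Longrightarrow> AE s in lebesgue_on {t0..}. norm (Op y s) \<le> c"
    using Op_bounded[of R] by blast
  have int: "integrable (lebesgue_on {t0..b}) (Op x)"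
    if "continuous_on {t0 - \<sigma>..} x" "\<forall>t\<ge>t0 - \<sigma>. norm (x t) \<le> R" for x
    by (rule integrable_lebesgue_on_AE_bounded[OF Op_measurable[OF that(1)]
          AE_lebesgue_on_subset[OF c[OF that]]]) auto
  have dint: "integrable (lebesgue_on {t0..b}) (?d n)" for n
    by (intro Bochner_Integration.integrable_diff int z y)
  have "(\<lambda>n. \<integral>\<^sup>+ s. ennreal (norm (?d n s)) \<partial>lebesgue_on {t0..b}) \<longlonglongrightarrow> 0"
    using Op_continuous z(1) y(1) lim b unfolding continuous_op_def by blast
  then have "(\<lambda>n. ennreal (LINT s|lebesgue_on {t0..b}. norm (?d n s))) \<longlonglongrightarrow> ennreal 0"
    by (subst (asm) nn_integral_eq_integral[OF integrable_norm[OF dint]]) auto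
  then have "(\<lambda>n. LINT s|lebesgue_on {t0..b}. norm (?d n s)) \<longlonglongrightarrow> 0"
    by (subst (asm) tendsto_ennreal_iff) auto
  from tendsto_L1_AE_subseq[OF dint this] obtain r :: "nat \<Rightarrow> nat" where r: "strict_mono r"
    "AE s in lebesgue_on {t0..b}. (\<lambda>n. ?d (r n) s) \<longlonglongrightarrow> 0"
    by blast
  have "AE s in lebesgue_on {t0..b}. (\<lambda>n. Op (z (r n)) s) \<longlonglongrightarrow> Op y s"
    using r(2) by (rule eventually_mono) (simp add: LIM_zero_iff)
  then show ?thesis using r(1) that by blast
qed

text \<open>Passing to the limit in the integral equation, by dominated convergence: the common bound on the
  outputs bounds all right-hand sides. The existence of solutions and of optimal controls rests on this.\<close>

lemma rhs_integral_converges: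
  assumes z: "\<And>n. continuous_on {t0 - \<sigma>..} (z n)" "\<And>n. \<forall>t\<ge>t0 - \<sigma>. norm (z n t) \<le> R"
    and y: "continuous_on {t0 - \<sigma>..} y" "\<forall>t\<ge>t0 - \<sigma>. norm (y t) \<le> R"
    and lim: "uniform_limit {t0 - \<sigma>..b} z y sequentially" and a: "t0 \<le> a" "a \<le> b"
    and u: "\<And>n. u n \<in> borel_measurable (lebesgue_on {a..b})"
      "\<And>n t. t \<in> {a..b} \<Longrightarrow> norm (u n t) \<le> U" "\<And>t. t \<in> {a..b} \<Longrightarrow> (\<lambda>n. u n t) \<longlonglongrightarrow> v t"
  obtains r :: "nat \<Rightarrow> nat" where "strict_mono r"
    "\<And>t. t \<in> {a..b} \<Longrightarrow> rhs y v integrable_on {a..t}"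
    "\<And>t. t \<in> {a..b} \<Longrightarrow> (\<lambda>n. integral {a..t} (rhs (z (r n)) (u (r n)))) \<longlonglongrightarrow> integral {a..t} (rhs y v)"
proof -
  obtain M where M: "rhs_bound R U M" by (rule rhs_bound_exists)
  obtain r :: "nat \<Rightarrow> nat" where r: "strict_mono r"
    "AE s in lebesgue_on {t0..b}. (\<lambda>n. Op (z (r n)) s) \<longlonglongrightarrow> Op y s"
    using Op_converges_AE[OF z y lim order_trans[OF a]] by blast
  have vm: "v \<in> borel_measurable (lebesgue_on {a..b})"
    by (rule borel_measurable_LIMSEQ_metric[where f=u, OF u(1)]) (use u(3) in auto)
  have vU: "norm (v t) \<le> U" if "t \<in> {a..b}" for t
    by (rule LIMSEQ_le_const2[OF tendsto_norm[OF u(3)[OF that]]]) (use u(2)[OF that] in auto)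
  have AEr: "AE s in lebesgue_on {a..b}. (\<lambda>n. rhs (z (r n)) (u (r n)) s) \<longlonglongrightarrow> rhs y v s"
  proof -
    have "AE s in lebesgue_on {a..b}. (\<lambda>n. Op (z (r n)) s) \<longlonglongrightarrow> Op y s"
      by (rule AE_lebesgue_on_subset[OF r(2)]) (use a in auto)
    moreover have "AE s in lebesgue_on {a..b}. s \<in> {a..b}"
      using AE_space[of "lebesgue_on {a..b}"] by simp
    ultimately show ?thesis
    proof eventually_elim
      fix s assume s: "(\<lambda>n. Op (z (r n)) s) \<longlonglongrightarrow> Op y s" "s \<in> {a..b}"
      have "(\<lambda>n. u (r n) s) \<longlonglongrightarrow> v s"
        using LIMSEQ_subseq_LIMSEQ[OF u(3)[OF s(2)] r(1)] by (simp add: o_def)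
      with s(1) have "(\<lambda>n. (Op (z (r n)) s, u (r n) s)) \<longlonglongrightarrow> (Op y s, v s)"
        by (rule tendsto_Pair)
      moreover have "isCont (\<lambda>p. f (fst p) + g (fst p) *v snd p) (Op y s, v s)"
        using continuous_on_rhs_pair by (simp add: continuous_on_eq_continuous_at)
      ultimately have "(\<lambda>n. (\<lambda>p. f (fst p) + g (fst p) *v snd p) (Op (z (r n)) s, u (r n) s))
          \<longlonglongrightarrow> (\<lambda>p. f (fst p) + g (fst p) *v snd p) (Op y s, v s)"
        by (rule isCont_tendsto_compose[rotated])
      then show "(\<lambda>n. rhs (z (r n)) (u (r n)) s) \<longlonglongrightarrow> rhs y v s"
        by (simp add: rhs_def)
    qed
  qed
  have sub: "AE s in lebesgue_on {a..t}. Q s" if "AE s in lebesgue_on {a..b}. Q s" "t \<in> {a..b}" for Q t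
    by (rule AE_lebesgue_on_subset[OF that(1)]) (use that in auto)
  have meas: "w \<in> borel_measurable (lebesgue_on {a..t})" if "w \<in> borel_measurable (lebesgue_on {a..b})" "t \<in> {a..b}" for w :: "real \<Rightarrow> real^'m" and t
    by (rule measurable_restrict_mono[OF that(1)]) (use that in auto)
  have main: "rhs y v integrable_on {a..t} \<and>
    (\<lambda>n. integral {a..t} (rhs (z (r n)) (u (r n)))) \<longlonglongrightarrow> integral {a..t} (rhs y v)"
    if t: "t \<in> {a..b}" for t
  proof
    have iy: "integrable (lebesgue_on {a..t}) (rhs y v)"
      by (rule rhs_integrable[OF M y meas[OF vm t]]) (use vU t a in auto)
    then show "rhs y v integrable_on {a..t}"
      by (rule integrable_on_lebesgue_on) auto
    have iz: "integrable (lebesgue_on {a..t}) (rhs (z (r n)) (u (r n)))" for n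
      by (rule rhs_integrable[OF M z(1) z(2) meas[OF u(1) t]]) (use u(2) t a in auto)
    have "(\<lambda>n. integral\<^sup>L (lebesgue_on {a..t}) (rhs (z (r n)) (u (r n)))) \<longlonglongrightarrow> integral\<^sup>L (lebesgue_on {a..t}) (rhs y v)"
    proof (rule integral_dominated_convergence[where w="\<lambda>_. M"])
      show "rhs y v \<in> borel_measurable (lebesgue_on {a..t})" using iy by auto
      show "rhs (z (r n)) (u (r n)) \<in> borel_measurable (lebesgue_on {a..t})" for n using iz by auto
      show "integrable (lebesgue_on {a..t}) (\<lambda>_. M)"
        by (rule integrable_lebesgue_on_AE_bounded[of _ _ _ "\<bar>M\<bar>"]) auto
      show "AE s in lebesgue_on {a..t}. (\<lambda>n. rhs (z (r n)) (u (r n)) s) \<longlonglongrightarrow> rhs y v s"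
        by (rule sub[OF AEr t])
      show "AE s in lebesgue_on {a..t}. norm (rhs (z (r n)) (u (r n)) s) \<le> M" for n
        by (rule rhs_bound_AE[OF M z(1) z(2)]) (use u(2) t a in auto)
    qed
    then show "(\<lambda>n. integral {a..t} (rhs (z (r n)) (u (r n)))) \<longlonglongrightarrow> integral {a..t} (rhs y v)"
      using iz iy by (simp add: lebesgue_integral_eq_integral)
  qed
  show ?thesis by (rule that[OF r(1)]) (use main in auto)
qed

lemma rhs_integral_converges_stopped:
  assumes z: "\<And>n. continuous_on {t0 - \<sigma>..b} (z n)" "\<And>n t. t \<in> {t0 - \<sigma>..b} \<Longrightarrow> norm (z n t) \<le> R"
    and lim: "uniform_limit {t0 - \<sigma>..b} z y sequentially" and a: "t0 \<le> a" "a \<le> b"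
    and u: "\<And>n. u n \<in> borel_measurable (lebesgue_on {a..b})"
      "\<And>n t. t \<in> {a..b} \<Longrightarrow> norm (u n t) \<le> U" "\<And>t. t \<in> {a..b} \<Longrightarrow> (\<lambda>n. u n t) \<longlonglongrightarrow> v t"
  obtains r :: "nat \<Rightarrow> nat" where "strict_mono r"
    "continuous_on {t0 - \<sigma>..b} y" "\<And>t. t \<in> {t0 - \<sigma>..b} \<Longrightarrow> norm (y t) \<le> R"
    "\<And>t. t \<in> {a..b} \<Longrightarrow> rhs (stopped b y) v integrable_on {a..t}"
    "\<And>t. t \<in> {a..b} \<Longrightarrow> (\<lambda>n. integral {a..t} (rhs (stopped b (z (r n))) (u (r n))))
        \<longlonglongrightarrow> integral {a..t} (rhs (stopped b y) v)"
proof -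
  have tb: "t0 \<le> b" using a by simp
  have yc: "continuous_on {t0 - \<sigma>..b} y"
    by (rule uniform_limit_theorem[OF _ lim]) (use z(1) in \<open>auto intro!: always_eventually\<close>)
  have yR: "norm (y t) \<le> R" if "t \<in> {t0 - \<sigma>..b}" for t
    by (rule LIMSEQ_le_const2[OF tendsto_norm[OF tendsto_uniform_limitI[OF lim that]]])
       (use z(2) that in auto)
  have zs: "continuous_on {t0 - \<sigma>..} (stopped b (z n))" "\<forall>t\<ge>t0 - \<sigma>. norm (stopped b (z n) t) \<le> R" for n
    using z tb \<sigma>_nonneg by (auto intro: stopped_continuous) (simp add: stopped_def)
  have ys: "continuous_on {t0 - \<sigma>..} (stopped b y)" "\<forall>t\<ge>t0 - \<sigma>. norm (stopped b y t) \<le> R"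
    using yc yR tb \<sigma>_nonneg by (auto intro: stopped_continuous) (simp add: stopped_def)
  have lims: "uniform_limit {t0 - \<sigma>..b} (\<lambda>n. stopped b (z n)) (stopped b y) sequentially"
    using lim by (rule uniform_limit_cong'[THEN iffD1, rotated 2]) (auto simp: stopped_def)
  show ?thesis
    by (rule rhs_integral_converges[OF zs ys lims a u], assumption+) (rule that[OF _ yc yR]; assumption)
qed

text \<open>Tonelli's approximation scheme. If the right-hand side is evaluated with a delay \<open>d\<close>, the equation is
  solved by iterating the integral operator: by causality each iteration is final on a further interval of length \<open>d\<close>.
  The interval is short enough for the outputs to stay below \<open>R + 1\<close>, so the
  delayed solutions are equi-Lipschitz, and as \<open>d\<close> tends to 0 a subsequence converges to a solution.
  The length of the interval depends on the bounds only, not on the initial time or history.\<close>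

lemma local_existence:
  assumes M: "rhs_bound (R + 1) U M" and th: "t0 \<le> th" and b: "b = th + 1 / M"
    and yh: "continuous_on {t0 - \<sigma>..th} yh" "\<And>t. t \<in> {t0 - \<sigma>..th} \<Longrightarrow> norm (yh t) \<le> R"
    and u: "u \<in> borel_measurable (lebesgue_on {th..b})" "\<And>t. t \<in> {th..b} \<Longrightarrow> norm (u t) \<le> U"
  shows "\<exists>y. (\<forall>t\<in>{t0 - \<sigma>..th}. y t = yh t) \<and> (\<forall>t\<in>{t0 - \<sigma>..b}. norm (y t) \<le> R + 1) \<and> solves th b u y"
proof -
  have M0: "0 < M" using M by (simp add: rhs_bound_def)
  define \<eta> where "\<eta> = 1 / M"
  have \<eta>: "0 < \<eta>" "M * \<eta> = 1" "b = th + \<eta>" using M0 b by (auto simp: \<eta>_def)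
  define good where "good z \<longleftrightarrow> continuous_on {t0 - \<sigma>..} z \<and> (\<forall>t\<ge>t0 - \<sigma>. norm (z t) \<le> R + 1)" for z :: "real \<Rightarrow> real^'m"
  define clip where "clip d t = max th (min (t - d) b)" for d t
  define part where "part d z t = integral {th..clip d t} (rhs z u)" for d z t
  define step where "step d z t = stopped th yh t + part d z t" for d z t
  have clip: "clip d t \<in> {th..b}" "\<bar>clip d t - clip d s\<bar> \<le> \<bar>t - s\<bar>" for d s t
    using \<eta> by (auto simp: clip_def)
  have int: "rhs z u integrable_on {th..b}" and lip: "\<And>s t. s \<in> {th..b} \<Longrightarrow> t \<in> {th..b} \<Longrightarrow>
      norm (integral {th..t} (rhs z u) - integral {th..s} (rhs z u)) \<le> M * \<bar>t - s\<bar>"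
    if z: "good z" for z
  proof -
    have zg: "continuous_on {t0 - \<sigma>..} z" "\<forall>t\<ge>t0 - \<sigma>. norm (z t) \<le> R + 1"
      using z by (auto simp: good_def)
    have "integrable (lebesgue_on {th..b}) (rhs z u)"
      by (rule rhs_integrable[OF M zg u(1)]) (use u(2) th in auto)
    then show i: "rhs z u integrable_on {th..b}"
      by (rule integrable_on_lebesgue_on) auto
    fix s t assume st: "s \<in> {th..b}" "t \<in> {th..b}"
    show "norm (integral {th..t} (rhs z u) - integral {th..s} (rhs z u)) \<le> M * \<bar>t - s\<bar>"
      by (rule integral_lipschitz_AE[OF i rhs_bound_AE[OF M zg] _ st]) (use u(2) th M0 in auto)
  qed
  have part_lip: "norm (part d z t - part d z s) \<le> M * \<bar>t - s\<bar>" if "good z" for d z s t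
  proof -
    have "norm (part d z t - part d z s) \<le> M * \<bar>clip d t - clip d s\<bar>"
      unfolding part_def by (rule lip[OF that clip(1) clip(1)])
    also have "\<dots> \<le> M * \<bar>t - s\<bar>"
      using clip(2) M0 by (intro mult_left_mono) auto
    finally show ?thesis .
  qed
  have part_bound: "norm (part d z t) \<le> 1" if "good z" for d z t
  proof -
    have "norm (part d z t) \<le> M * \<bar>clip d t - th\<bar>"
      using lip[OF that, of th "clip d t"] clip(1)[of d t] \<eta> unfolding part_def by auto
    also have "\<dots> \<le> M * \<eta>" using clip(1)[of d t] \<eta> M0 by (intro mult_left_mono) auto
    finally show ?thesis using \<eta> by simp
  qed
  have part_cont: "continuous_on S (part d z)" if "good z" for d z S
    by (rule lipschitz_on_continuous_on[where L=M], rule lipschitz_onI)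
       (use part_lip[OF that] M0 in \<open>auto simp: dist_norm\<close>)
  have part_0: "part d z t = 0" if "t \<le> th" "0 \<le> d" for d z t
  proof -
    have "clip d t = th" using that \<eta> by (auto simp: clip_def)
    then show ?thesis by (simp add: part_def)
  qed
  have yh_cont: "continuous_on {t0 - \<sigma>..} (stopped th yh)"
    by (rule stopped_continuous[OF yh(1) th])
  have yh_bound: "norm (stopped th yh t) \<le> R" if "t0 - \<sigma> \<le> t" for t
    using yh(2) that th \<sigma>_nonneg by (auto simp: stopped_def)
  have good0: "good (stopped th yh)"
    using yh_cont yh_bound by (force simp: good_def)
  have good_step: "good (step d z)" if "good z" for d z
    unfolding good_def step_def
  proof (intro conjI allI impI)
    show "continuous_on {t0 - \<sigma>..} (\<lambda>t. stopped th yh t + part d z t)"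
      by (intro continuous_on_add yh_cont part_cont that)
    fix t assume "t0 - \<sigma> \<le> t"
    then show "norm (stopped th yh t + part d z t) \<le> R + 1"
      using yh_bound part_bound[OF that] by (intro norm_triangle_le add_mono) auto
  qed
  have step_agree: "step d z1 t = step d z2 t"
    if g: "good z1" "good z2" and eq: "\<And>s. s \<in> {t0 - \<sigma>..c} \<Longrightarrow> z1 s = z2 s"
      and c: "th \<le> c" "t \<le> c + d" for d z1 z2 t c
  proof -
    have "(rhs z1 u has_integral part d z1 t) {th..clip d t}"
      unfolding part_def using clip(1)[of d t]
      by (intro integrable_integral integrable_subinterval_real[OF int[OF g(1)]]) auto
    then have "(rhs z2 u has_integral part d z1 t) {th..clip d t}"
      by (rule rhs_integral_cong[rotated -1, where c=c])
         (use g c th eq in \<open>auto simp: good_def clip_def\<close>)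
    then have "part d z2 t = part d z1 t" unfolding part_def[of d z2] by (rule integral_unique)
    then show ?thesis by (simp add: step_def)
  qed
  define Z where "Z d k = (step d ^^ k) (stopped th yh)" for d k
  have Z_good: "good (Z d k)" for d k
    by (induction k) (auto simp: Z_def good0 good_step)
  have Z_agree: "Z d k t = Z d (Suc k) t" if "0 \<le> d" "t \<in> {t0 - \<sigma>..th + real k * d}" for d k t
    using that
  proof (induction k arbitrary: t)
    case 0
    then show ?case by (simp add: Z_def step_def part_0)
  next
    case (Suc k)
    have "step d (Z d k) t = step d (Z d (Suc k)) t"
      by (rule step_agree[where c="th + real k * d"])
         (use Suc Z_good in \<open>auto simp: algebra_simps\<close>)
    then show ?case by (simp add: Z_def)
  qed
  define d where "d n = \<eta> / real (Suc n)" for n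
  have d: "0 < d n" "real (Suc n) * d n = \<eta>" for n
    using \<eta> by (auto simp: d_def)
  define z where "z n = Z (d n) (Suc n)" for n
  \<comment> \<open>With delay \<open>\<eta> / (n + 1)\<close>, after \<open>n + 1\<close> iterations the result is final on \<open>[th, b]\<close>.\<close>
  define x where "x n = step (d n) (z n)" for n
  have zx: "z n t = x n t" if "t \<in> {t0 - \<sigma>..b}" for n t
    using Z_agree[of "d n" t "Suc n"] that d[of n] \<eta> by (simp add: z_def x_def Z_def)
  have zg: "good (z n)" and xg: "good (x n)" for n
    by (auto simp: z_def x_def Z_good good_step)
  obtain \<zeta> k where k: "strict_mono (k :: nat \<Rightarrow> nat)"
    and unif: "uniform_limit {t0 - \<sigma>..b} (\<lambda>n. part (d (k n)) (z (k n))) \<zeta> sequentially"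
    by (rule equi_lipschitz_convergent_subsequence[of M "t0 - \<sigma>" b "\<lambda>n. part (d n) (z n)" 1])
       (use M0 part_bound[OF zg] part_lip[OF zg] in auto)
  define y where "y t = stopped th yh t + \<zeta> t" for t
  have tb: "t0 \<le> b" using th \<eta> by simp
  have ul: "uniform_limit {t0 - \<sigma>..b} (\<lambda>n. x (k n)) y sequentially"
    using unif unfolding uniform_limit_iff by (simp add: x_def step_def y_def)
  have lim: "(\<lambda>n. x (k n) t) \<longlonglongrightarrow> y t" if "t \<in> {t0 - \<sigma>..b}" for t
    by (rule tendsto_uniform_limitI[OF ul that])
  have xb: "continuous_on {t0 - \<sigma>..b} (x n)" "t \<in> {t0 - \<sigma>..b} \<Longrightarrow> norm (x n t) \<le> R + 1" for n t
    using xg[of n] continuous_on_subset[of "{t0 - \<sigma>..}" "x n" "{t0 - \<sigma>..b}"] by (auto simp: good_def)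
  have sg: "good (stopped b (x n))" for n
    using stopped_continuous[OF xb(1) tb] xb(2) tb \<sigma>_nonneg by (simp add: good_def) (simp add: stopped_def)
  obtain r :: "nat \<Rightarrow> nat" where r: "strict_mono r"
    "continuous_on {t0 - \<sigma>..b} y" "\<And>t. t \<in> {t0 - \<sigma>..b} \<Longrightarrow> norm (y t) \<le> R + 1"
    "\<And>t. t \<in> {th..b} \<Longrightarrow> rhs (stopped b y) u integrable_on {th..t}"
    "\<And>t. t \<in> {th..b} \<Longrightarrow> (\<lambda>n. integral {th..t} (rhs (stopped b (x (k (r n)))) u))
        \<longlonglongrightarrow> integral {th..t} (rhs (stopped b y) u)"
    by (rule rhs_integral_converges_stopped[of b "\<lambda>n. x (k n)" "R + 1" y th "\<lambda>_. u" U u])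
       (use xb ul th \<eta> u in auto)
  have xI: "x n t = yh th + integral {th..clip (d n) t} (rhs (stopped b (x n)) u)" if t: "t \<in> {th..b}" for n t
  proof -
    have "(rhs (z n) u has_integral part (d n) (z n) t) {th..clip (d n) t}"
      unfolding part_def using clip(1)[of "d n" t]
      by (intro integrable_integral integrable_subinterval_real[OF int[OF zg]]) auto
    then have "(rhs (stopped b (x n)) u has_integral part (d n) (z n) t) {th..clip (d n) t}"
    proof (rule rhs_integral_cong[rotated -1, where c=b])
      show "z n s = stopped b (x n) s" if "s \<in> {t0 - \<sigma>..b}" for s
        using zx[OF that] that by (simp add: stopped_def)
    qed (use zg sg th clip(1)[of "d n" t] in \<open>auto simp: good_def\<close>)
    moreover have "stopped th yh t = yh th" using t by (simp add: stopped_def)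
    ultimately show ?thesis by (simp add: x_def step_def integral_unique)
  qed
  have dlim: "(\<lambda>n. M * d (k (r n))) \<longlonglongrightarrow> 0"
  proof -
    have "d \<longlonglongrightarrow> 0"
      unfolding d_def using LIMSEQ_Suc[OF lim_const_over_n[of \<eta>]] by simp
    then have "(\<lambda>n. d (k (r n))) \<longlonglongrightarrow> 0"
      using LIMSEQ_subseq_LIMSEQ[OF _ strict_mono_o[OF k r(1)]] by (auto simp: o_def)
    then show ?thesis by (rule tendsto_mult_right_zero)
  qed
  have eq: "y t = yh th + integral {th..t} (rhs (stopped b y) u)" if t: "t \<in> {th..b}" for t
  proof -
    let ?I = "\<lambda>n s. integral {th..s} (rhs (stopped b (x (k (r n)))) u)"
    have "norm (?I n t - ?I n (clip (d (k (r n))) t)) \<le> M * d (k (r n))" for n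
    proof -
      have "norm (?I n t - ?I n (clip (d (k (r n))) t)) \<le> M * \<bar>t - clip (d (k (r n))) t\<bar>"
        by (rule lip[OF sg clip(1) t])
      also have "\<dots> \<le> M * d (k (r n))"
        using t d(1)[of "k (r n)"] M0 by (intro mult_left_mono) (auto simp: clip_def)
      finally show ?thesis .
    qed
    then have "(\<lambda>n. ?I n t - ?I n (clip (d (k (r n))) t)) \<longlonglongrightarrow> 0"
      by (intro Lim_null_comparison[OF _ dlim]) auto
    from tendsto_diff[OF r(5)[OF t] this]
    have "(\<lambda>n. ?I n (clip (d (k (r n))) t)) \<longlonglongrightarrow> integral {th..t} (rhs (stopped b y) u)" by simp
    then have "(\<lambda>n. yh th + ?I n (clip (d (k (r n))) t)) \<longlonglongrightarrow> yh th + integral {th..t} (rhs (stopped b y) u)"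
      by (intro tendsto_intros)
    then have "(\<lambda>n. x (k (r n)) t) \<longlonglongrightarrow> yh th + integral {th..t} (rhs (stopped b y) u)"
      using xI[OF t] by simp
    moreover have "(\<lambda>n. x (k (r n)) t) \<longlonglongrightarrow> y t"
      using LIMSEQ_subseq_LIMSEQ[OF lim r(1)] t th \<sigma>_nonneg by (auto simp: o_def)
    ultimately show ?thesis by (rule LIMSEQ_unique[rotated])
  qed
  have \<zeta>0: "\<zeta> t = 0" if "t \<in> {t0 - \<sigma>..th}" for t
  proof -
    have "(\<lambda>n. x (k n) t) \<longlonglongrightarrow> y t" using lim that \<eta> by auto
    moreover have "x (k n) t = stopped th yh t" for n
      using that d(1)[of "k n"] by (simp add: x_def step_def part_0)
    ultimately have "y t = stopped th yh t" by (simp add: LIMSEQ_const_iff)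
    then show ?thesis by (simp add: y_def)
  qed
  have hist: "y t = yh t" if "t \<in> {t0 - \<sigma>..th}" for t
    using \<zeta>0[OF that] that by (simp add: y_def stopped_def)
  have "solves th b u y"
    unfolding solves_def
  proof (intro conjI ballI r(2))
    fix t assume t: "t \<in> {th..b}"
    have "y th = yh th" using hist th \<sigma>_nonneg by auto
    then have "y t - y th = integral {th..t} (rhs (stopped b y) u)" using eq[OF t] by simp
    then show "(rhs (stopped b y) u has_integral (y t - y th)) {th..t}"
      using integrable_integral[OF r(4)[OF t]] by simp
  qed
  then show ?thesis using hist r(3) by blast
qed

section \<open>Maximal solutions\<close>

definition bounded_input :: "real \<Rightarrow> (real \<Rightarrow> real^'m) \<Rightarrow> bool" where
  "bounded_input a u \<longleftrightarrow> (\<forall>b. u \<in> borel_measurable (lebesgue_on {a..b})) \<and> (\<exists>U. \<forall>t\<ge>a. norm (u t) \<le> U)"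

lemma solves_extend:
  assumes s: "solves th w u y" and th: "t0 \<le> th" "th \<le> w" and u: "bounded_input th u"
  obtains y' b where "w < b" "\<And>t. t \<in> {t0 - \<sigma>..w} \<Longrightarrow> y' t = y t" "solves th b u y'"
proof -
  obtain R where R: "\<And>t. t \<in> {t0 - \<sigma>..w} \<Longrightarrow> norm (y t) \<le> R"
    using continuous_on_Icc_bounded[OF solves_continuous[OF s]] by blast
  obtain U where U: "\<And>t. t \<ge> th \<Longrightarrow> norm (u t) \<le> U"
    using u by (auto simp: bounded_input_def)
  obtain M where M: "rhs_bound (R + 1) U M" by (rule rhs_bound_exists)
  have M0: "M > 0" using M by (simp add: rhs_bound_def)
  have "u \<in> borel_measurable (lebesgue_on {th..w + 1 / M})"
    using u by (simp add: bounded_input_def)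
  then have um: "u \<in> borel_measurable (lebesgue_on {w..w + 1 / M})"
    by (rule measurable_restrict_mono) (use th in auto)
  obtain y' where y': "\<And>t. t \<in> {t0 - \<sigma>..w} \<Longrightarrow> y' t = y t" "solves w (w + 1 / M) u y'"
    using local_existence[OF M order_trans[OF th] refl solves_continuous[OF s] R um] U th by fastforce
  have "solves th w u y'"
    by (rule solves_cong[OF s th]) (use y' in auto)
  then have "solves th (w + 1 / M) u y'"
    by (rule solves_append[OF _ y'(2)]) (use th M0 in auto)
  then show ?thesis using M0 y'(1) by (intro that[of "w + 1 / M" y']) auto
qed

lemma bounded_input_bound: "bounded_input th u \<Longrightarrow> \<exists>U. \<forall>t\<in>{th..<s}. norm (u t) \<le> U"
  unfolding bounded_input_def by (metis atLeastLessThan_iff)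

lemma solves_imp_solution_Icc:
  assumes s: "solves th b u y" and th: "t0 \<le> th" "th < b" and hist: "\<And>s. s \<in> {t0 - \<sigma>..th} \<Longrightarrow> y s = yh s"
    and u: "bounded_input th u"
  shows "sol th yh u y (ereal b)"
  by (rule solves_imp_solution)
     (use th hist bounded_input_bound[OF u] in \<open>auto intro: solves_restrict[OF s]\<close>)

text \<open>Zorn's lemma for the graphs of solutions over \<open>[t0 - \<sigma>, \<omega>)\<close>, ordered by inclusion. The union of a
  chain of graphs is the graph of a solution, since at each time only the past up to that time matters.\<close>

lemma maximal_extension:
  assumes sol: "sol th yh u y0 \<omega>0" and yh: "continuous_on {t0 - \<sigma>..th} yh"
    and th: "t0 \<le> th" and u: "bounded_input th u"
  obtains y \<omega> where "\<omega>0 \<le> \<omega>" "max_sol th yh u y \<omega>"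
    "\<And>s. \<lbrakk>t0 - \<sigma> \<le> s; ereal s < \<omega>0\<rbrakk> \<Longrightarrow> y s = y0 s"
proof -
  let ?sol = "sol th yh u"
  define G where "G y \<omega> = {(s, y s) | s. t0 - \<sigma> \<le> s \<and> ereal s < \<omega>}" for y :: "real \<Rightarrow> real^'m" and \<omega>
  define \<A> where "\<A> = {X. \<exists>y \<omega>. X = G y \<omega> \<and> ?sol y \<omega> \<and> G y0 \<omega>0 \<subseteq> G y \<omega>}"
  have th\<omega>: "ereal th < \<omega>" if "?sol y \<omega>" for y \<omega>
    using that by (simp add: solution_def)
  have hist: "y s = yh s" if "?sol y \<omega>" "s \<in> {t0 - \<sigma>..th}" for y \<omega> s
    using that by (simp add: solution_def)
  have G_sub: "\<omega> \<le> \<omega>'" if sub: "G y \<omega> \<subseteq> G y' \<omega>'" and s: "?sol y \<omega>" "?sol y' \<omega>'" for y \<omega> y' \<omega>'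
  proof (rule ccontr)
    assume "\<not> \<omega> \<le> \<omega>'"
    then obtain w where w: "\<omega>' = ereal w" "ereal w < \<omega>" "th < w"
      using th\<omega>[OF s(2)] by (cases \<omega>') auto
    then have "(w, y w) \<in> G y \<omega>" using th \<sigma>_nonneg by (auto simp: G_def)
    then show False using sub w by (auto simp: G_def)
  qed
  have "\<exists>X\<in>\<A>. \<forall>X'\<in>\<A>. X \<subseteq> X' \<longrightarrow> X' = X"
  proof (rule subset_Zorn_nonempty)
    show "\<A> \<noteq> {}" using sol by (auto simp: \<A>_def)
  next
    fix \<C> assume ne: "\<C> \<noteq> {}" and chain: "subset.chain \<A> \<C>"
    have C\<A>: "\<C> \<subseteq> \<A>" and tot: "\<And>X Y. X \<in> \<C> \<Longrightarrow> Y \<in> \<C> \<Longrightarrow> X \<subseteq> Y \<or> Y \<subseteq> X"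
      using chain by (auto simp: subset_chain_def)
    define \<omega> where "\<omega> = Sup {\<omega>. \<exists>y. ?sol y \<omega> \<and> G y \<omega> \<in> \<C>}"
    define y where "y s = (SOME v. (s, v) \<in> \<Union>\<C>)" for s
    have uniq: "v = v'" if "(s, v) \<in> \<Union>\<C>" "(s, v') \<in> \<Union>\<C>" for s v v'
    proof -
      obtain X X' where X: "X \<in> \<C>" "(s, v) \<in> X" "X' \<in> \<C>" "(s, v') \<in> X'"
        using \<open>(s, v) \<in> \<Union>\<C>\<close> \<open>(s, v') \<in> \<Union>\<C>\<close> by blast
      then obtain Y where Y: "Y \<in> \<C>" "(s, v) \<in> Y" "(s, v') \<in> Y" using tot by blast
      then obtain y \<omega> where "Y = G y \<omega>" using C\<A> by (auto simp: \<A>_def)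
      then show ?thesis using Y by (auto simp: G_def)
    qed
    have y: "y s = v" if "(s, v) \<in> \<Union>\<C>" for s v
      unfolding y_def by (rule some_equality[where P="\<lambda>v. (s, v) \<in> \<Union>\<C>", OF that]) (rule uniq[OF _ that])
    have below: "\<exists>y' \<omega>'. ?sol y' \<omega>' \<and> G y' \<omega>' \<in> \<C> \<and> ereal s < \<omega>' \<and> (\<forall>r\<in>{t0 - \<sigma>..s}. y r = y' r)"
      if "ereal s < \<omega>" for s
    proof -
      obtain \<omega>' y' where *: "?sol y' \<omega>'" "G y' \<omega>' \<in> \<C>" "ereal s < \<omega>'"
        using \<open>ereal s < \<omega>\<close> unfolding \<omega>_def less_Sup_iff by blast
      have "y r = y' r" if r: "r \<in> {t0 - \<sigma>..s}" for r
      proof (rule y)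
        have "ereal r < \<omega>'" using r *(3) by (auto intro: le_less_trans[of _ "ereal s"])
        then have "(r, y' r) \<in> G y' \<omega>'" using r by (auto simp: G_def)
        then show "(r, y' r) \<in> \<Union>\<C>" using *(2) by blast
      qed
      then show ?thesis using * by blast
    qed
    have union: "\<Union>\<C> = G y \<omega>"
    proof (rule set_eqI, clarify)
      fix s v
      show "(s, v) \<in> \<Union>\<C> \<longleftrightarrow> (s, v) \<in> G y \<omega>"
      proof
        assume sv: "(s, v) \<in> \<Union>\<C>"
        then obtain X where X: "X \<in> \<C>" "(s, v) \<in> X" by blast
        then obtain y' \<omega>' where X': "X = G y' \<omega>'" "?sol y' \<omega>'" using C\<A> by (auto simp: \<A>_def)
        then have "\<omega>' \<le> \<omega>" unfolding \<omega>_def using X(1) by (intro Sup_upper) auto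
        moreover have "t0 - \<sigma> \<le> s" "ereal s < \<omega>'" using X X' by (auto simp: G_def)
        ultimately have "t0 - \<sigma> \<le> s" "ereal s < \<omega>" by (auto intro: less_le_trans)
        then show "(s, v) \<in> G y \<omega>" using y[OF sv] by (auto simp: G_def)
      next
        assume "(s, v) \<in> G y \<omega>"
        then have s: "t0 - \<sigma> \<le> s" "ereal s < \<omega>" "v = y s" by (auto simp: G_def)
        obtain y' \<omega>' where *: "G y' \<omega>' \<in> \<C>" "ereal s < \<omega>'" "\<forall>r\<in>{t0 - \<sigma>..s}. y r = y' r"
          using below[OF s(2)] by blast
        have "(s, y' s) \<in> G y' \<omega>'" using s *(2) by (auto simp: G_def)
        then show "(s, v) \<in> \<Union>\<C>" using * s by auto
      qed
    qed
    obtain X0 where X0: "X0 \<in> \<C>" using ne by blast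
    then obtain y1 \<omega>1 where X1: "X0 = G y1 \<omega>1" "?sol y1 \<omega>1" "G y0 \<omega>0 \<subseteq> G y1 \<omega>1"
      using C\<A> by (auto simp: \<A>_def)
    have "\<omega>1 \<le> \<omega>" unfolding \<omega>_def using X0 X1 by (intro Sup_upper) auto
    then have thw: "ereal th < \<omega>" using th\<omega>[OF X1(2)] by simp
    have "?sol y \<omega>"
    proof (rule solves_imp_solution[OF th thw])
      fix s assume s: "s \<in> {t0 - \<sigma>..th}"
      obtain y' \<omega>' where "?sol y' \<omega>'" "\<forall>r\<in>{t0 - \<sigma>..th}. y r = y' r"
        using below[OF thw] by blast
      then show "y s = yh s" using hist s by auto
    next
      fix s assume s: "th \<le> s" "ereal s < \<omega>"
      obtain y' \<omega>' where *: "?sol y' \<omega>'" "ereal s < \<omega>'" "\<forall>r\<in>{t0 - \<sigma>..s}. y r = y' r"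
        using below[OF s(2)] by blast
      have "solves th s u y'" by (rule solution_imp_solves[OF *(1) yh th s(1) *(2)])
      then show "solves th s u y" by (rule solves_cong) (use th s * in auto)
    qed (rule bounded_input_bound[OF u])
    then show "\<Union>\<C> \<in> \<A>"
      using X0 X1 union unfolding \<A>_def by blast
  qed
  then obtain X where X: "X \<in> \<A>" "\<forall>X'\<in>\<A>. X \<subseteq> X' \<longrightarrow> X' = X" by blast
  then obtain y \<omega> where Xy: "X = G y \<omega>" and y: "?sol y \<omega>" "G y0 \<omega>0 \<subseteq> G y \<omega>"
    unfolding \<A>_def by blast
  have max: "G y' \<omega>' = G y \<omega>" if "?sol y' \<omega>'" "G y0 \<omega>0 \<subseteq> G y' \<omega>'" "G y \<omega> \<subseteq> G y' \<omega>'" for y' \<omega>'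
  proof -
    have "G y' \<omega>' \<in> \<A>" using that unfolding \<A>_def by blast
    then show ?thesis using X(2) that(3) Xy by blast
  qed
  show ?thesis
  proof (rule that[of \<omega> y])
    show "\<omega>0 \<le> \<omega>" by (rule G_sub[OF y(2) sol y(1)])
    show "y s = y0 s" if "t0 - \<sigma> \<le> s" "ereal s < \<omega>0" for s
    proof -
      have "(s, y0 s) \<in> G y0 \<omega>0" using that by (auto simp: G_def)
      then show ?thesis using y(2) by (auto simp: G_def)
    qed
    show "max_sol th yh u y \<omega>"
      unfolding maximal_solution_def
    proof (intro conjI y(1) notI)
      assume "\<exists>y' \<omega>'. \<omega> < \<omega>' \<and> ?sol y' \<omega>' \<and> (\<forall>s\<ge>t0 - \<sigma>. ereal s < \<omega> \<longrightarrow> y' s = y s)"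
      then obtain y' \<omega>' where y': "\<omega> < \<omega>'" "?sol y' \<omega>'" "\<And>s. s \<ge> t0 - \<sigma> \<Longrightarrow> ereal s < \<omega> \<Longrightarrow> y' s = y s"
        by blast
      have "G y \<omega> \<subseteq> G y' \<omega>'" using y' by (fastforce simp: G_def)
      then have eq: "G y' \<omega>' = G y \<omega>" using max y' y(2) by blast
      have "\<omega>' \<le> \<omega>" by (rule G_sub[OF equalityD1[OF eq] y'(2) y(1)])
      then show False using y'(1) by simp
    qed
  qed
qed

text \<open>Restarting from a time shortly before \<open>\<omega>\<close> would not contradict maximality, because the new solution
  may leave the old one immediately. The solution is therefore first extended to \<open>\<omega>\<close> itself, as the limit of a
  Lipschitz function, and then restarted from there.\<close>

lemma maximal_solution_bounded_imp_global:
  assumes max: "max_sol th yh u y \<omega>" and yh: "continuous_on {t0 - \<sigma>..th} yh"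
    and th: "t0 \<le> th" and u: "bounded_input th u"
    and R: "\<And>s. \<lbrakk>t0 - \<sigma> \<le> s; ereal s < \<omega>\<rbrakk> \<Longrightarrow> norm (y s) \<le> R"
  shows "\<omega> = \<infinity>"
proof (rule ccontr)
  assume "\<omega> \<noteq> \<infinity>"
  have sol: "sol th yh u y \<omega>" using max by (simp add: maximal_solution_def)
  then have "ereal th < \<omega>" and hist: "\<And>s. s \<in> {t0 - \<sigma>..th} \<Longrightarrow> y s = yh s" by (auto simp: solution_def)
  with \<open>\<omega> \<noteq> \<infinity>\<close> obtain w where w: "\<omega> = ereal w" "th < w" by (cases \<omega>) auto
  obtain U where U: "\<And>t. t \<ge> th \<Longrightarrow> norm (u t) \<le> U"
    using u by (auto simp: bounded_input_def)
  obtain M where M: "rhs_bound R U M" by (rule rhs_bound_exists)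
  have M0: "M > 0" using M by (simp add: rhs_bound_def)
  have slv: "solves th b u y" if "th \<le> b" "b < w" for b
    by (rule solution_imp_solves[OF sol yh th that(1)]) (use that w in auto)
  have lip: "norm (y t - y s) \<le> M * \<bar>t - s\<bar>" if st: "s \<in> {th..<w}" "t \<in> {th..<w}" for s t
    by (rule solves_lipschitz[OF slv[of "max s t"] th M]) (use st w R U in auto)
  have "M-lipschitz_on {th..<w} y"
    by (rule lipschitz_onI) (use lip M0 in \<open>auto simp: dist_norm\<close>)
  then obtain h where h: "M-lipschitz_on {th..w} h" "\<And>s. s \<in> {th..<w} \<Longrightarrow> h s = y s"
    using lipschitz_extend_closure[of M "{th..<w}" y] w by auto
  define y1 where "y1 t = (if t < w then y t else h w)" for t
  have y1h: "y1 t = h t" if "t \<in> {th..w}" for t using h(2) that by (auto simp: y1_def)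
  have y1lip: "norm (y1 t - y1 s) \<le> M * \<bar>t - s\<bar>" if "s \<in> {th..w}" "t \<in> {th..w}" for s t
    using lipschitz_onD[OF h(1) that(2,1)] y1h that by (simp add: dist_norm)
  have "continuous_on {th..w} y1"
    by (rule continuous_on_eq[OF lipschitz_on_continuous_on[OF h(1)]]) (use y1h in auto)
  moreover have "continuous_on {t0 - \<sigma>..th} y1"
    by (rule continuous_on_eq[OF yh]) (use hist w in \<open>auto simp: y1_def\<close>)
  ultimately have "continuous_on ({t0 - \<sigma>..th} \<union> {th..w}) y1"
    by (intro continuous_on_closed_Un) auto
  moreover have "{t0 - \<sigma>..th} \<union> {th..w} = {t0 - \<sigma>..w}" using w th \<sigma>_nonneg by auto
  ultimately have y1c: "continuous_on {t0 - \<sigma>..w} y1" by simp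
  obtain R' where R': "\<And>t. t \<in> {t0 - \<sigma>..w} \<Longrightarrow> norm (y1 t) \<le> R'"
    using continuous_on_Icc_bounded[OF y1c] by blast
  obtain M' where M': "rhs_bound R' U M'" by (rule rhs_bound_exists)
  have M'0: "M' > 0" using M' by (simp add: rhs_bound_def)
  let ?v = "rhs (stopped w y1) u"
  have tw: "t0 \<le> w" using th w by simp
  have sy: "continuous_on {t0 - \<sigma>..} (stopped w y1)" by (rule stopped_continuous[OF y1c tw])
  have sR: "\<forall>t\<ge>t0 - \<sigma>. norm (stopped w y1 t) \<le> R'"
    using R' tw \<sigma>_nonneg by (auto simp: stopped_def)
  have vint: "?v integrable_on {th..w}"
    by (rule integrable_on_lebesgue_on[OF rhs_integrable[OF M' sy sR]])
       (use u U th in \<open>auto simp: bounded_input_def\<close>)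
  have before: "(?v has_integral (y1 t - y1 th)) {th..t}" if t: "t \<in> {th..<w}" for t
  proof -
    have "solves th t u y1"
      by (rule solves_cong[OF slv[of t] th]) (use t in \<open>auto simp: y1_def\<close>)
    then show ?thesis
      by (rule solves_integral_stopped[OF _ th _ _ y1c]) (use t in auto)
  qed
  have "norm (integral {th..w} ?v - (y1 w - y1 th)) \<le> 0"
  proof (rule ccontr)
    define X where "X = norm (integral {th..w} ?v - (y1 w - y1 th))"
    assume "\<not> norm (integral {th..w} ?v - (y1 w - y1 th)) \<le> 0"
    then have X: "X > 0" by (simp add: X_def)
    define t where "t = max th (w - X / (2 * (M + M')))"
    have t: "t \<in> {th..<w}" "w - t \<le> X / (2 * (M + M'))" using w X M0 M'0 by (auto simp: t_def)
    have "norm (integral {th..w} ?v - integral {th..t} ?v) \<le> M' * \<bar>w - t\<bar>"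
      by (rule integral_lipschitz_AE[OF vint rhs_bound_AE[OF M' sy sR]]) (use U th M'0 t w in auto)
    moreover have "integral {th..t} ?v = y1 t - y1 th" by (rule integral_unique[OF before[OF t(1)]])
    moreover have "norm (y1 w - y1 t) \<le> M * \<bar>w - t\<bar>" by (rule y1lip) (use t w in auto)
    moreover have "X \<le> norm (integral {th..w} ?v - (y1 t - y1 th)) + norm (y1 w - y1 t)"
      unfolding X_def using norm_triangle_ineq4[of "integral {th..w} ?v - (y1 t - y1 th)" "y1 w - y1 t"]
      by (simp add: algebra_simps)
    ultimately have "X \<le> M' * (w - t) + M * (w - t)"
      using t by auto
    also have "\<dots> = (M + M') * (w - t)" by (simp add: algebra_simps)
    also have "\<dots> \<le> (M + M') * (X / (2 * (M + M')))" using t M0 M'0 by (intro mult_left_mono) auto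
    also have "\<dots> = X / 2" using M0 M'0 by (simp add: field_simps)
    finally show False using X by simp
  qed
  then have "integral {th..w} ?v = y1 w - y1 th" by simp
  then have at_w: "(?v has_integral (y1 w - y1 th)) {th..w}" using integrable_integral[OF vint] by simp
  have "solves th w u y1"
    unfolding solves_def
  proof (intro conjI ballI y1c)
    fix t assume "t \<in> {th..w}"
    then show "(?v has_integral (y1 t - y1 th)) {th..t}"
      using before[of t] at_w by (cases "t = w") auto
  qed
  then obtain y2 b where b: "w < b" "\<And>t. t \<in> {t0 - \<sigma>..w} \<Longrightarrow> y2 t = y1 t" "solves th b u y2"
    using solves_extend[OF _ th less_imp_le[OF w(2)] u] by blast
  have "sol th yh u y2 (ereal b)"
    by (rule solves_imp_solution_Icc[OF b(3) th _ _ u]) (use b w hist in \<open>auto simp: y1_def\<close>)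
  moreover have "\<forall>s\<ge>t0 - \<sigma>. ereal s < \<omega> \<longrightarrow> y2 s = y s" using b(2) w by (auto simp: y1_def)
  moreover have "\<omega> < ereal b" using b(1) w(1) by simp
  ultimately show False using max unfolding maximal_solution_def by blast
qed

end

section \<open>Step functions on a partition\<close>

lemma partition_from_covers:
  assumes P: "partition_from a P" and t: "a \<le> t"
  obtains i where "P i \<le> t" "t < P (Suc i)"
proof -
  have "\<exists>n. t < P n"
    using P unfolding partition_from_def filterlim_at_top_dense eventually_sequentially by blast
  then have l: "t < P (LEAST n. t < P n)" by (rule LeastI_ex)
  obtain i where i: "(LEAST n. t < P n) = Suc i"
    using l P t by (cases "LEAST n. t < P n") (auto simp: partition_from_def)
  have "\<not> t < P i" using i not_less_Least[of i "\<lambda>n. t < P n"] by simp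
  then show ?thesis using l i by (intro that[of i]) auto
qed

lemma partition_from_le: "partition_from a P \<Longrightarrow> i \<le> j \<Longrightarrow> P i \<le> P j"
  by (simp add: partition_from_def strict_mono_less_eq)

lemma step_functions_measurable:
  fixes u :: "real \<Rightarrow> real^'m::finite"
  assumes P: "partition_from a P" and u: "u \<in> step_functions P {c..d}" and ac: "a \<le> c"
  shows "u \<in> borel_measurable (lebesgue_on S)"
proof -
  let ?C = "insert (- {c..d}) (range (\<lambda>i. {P i..<P (Suc i)} \<inter> {c..d}))"
  have "u \<in> borel_measurable borel"
  proof (rule measurable_piecewise_restrict[of ?C])
    show "countable ?C" by simp
    show "space borel \<subseteq> \<Union> ?C"
    proof
      fix t :: real
      show "t \<in> \<Union> ?C"
      proof (cases "t \<in> {c..d}")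
        case True
        then obtain i where "P i \<le> t" "t < P (Suc i)"
          using partition_from_covers[OF P, of t] ac by auto
        then show ?thesis using True by auto
      qed auto
    qed
    fix \<Omega> assume \<Omega>: "\<Omega> \<in> ?C"
    then show "\<Omega> \<inter> space borel \<in> sets borel" by auto
    have "\<exists>k. \<forall>t\<in>\<Omega>. u t = k"
    proof (cases "\<Omega> = - {c..d}")
      case True
      then show ?thesis using u by (auto simp: step_functions_def)
    next
      case False
      then obtain i where i: "\<Omega> = {P i..<P (Suc i)} \<inter> {c..d}" using \<Omega> by auto
      show ?thesis
      proof (cases "\<Omega> = {}")
        case False
        then obtain s where s: "s \<in> \<Omega>" by blast
        have "\<forall>t\<in>\<Omega>. u t = u s" using u s unfolding i step_functions_def by blast
        then show ?thesis by blast
      qed auto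
    qed
    then obtain k where "\<forall>t\<in>\<Omega>. u t = k" by blast
    then show "u \<in> borel_measurable (restrict_space borel \<Omega>)"
      by (subst measurable_cong[of _ _ "\<lambda>_. k"]) (auto simp: space_restrict_space)
  qed
  then have "u \<in> borel_measurable lebesgue"
    by (simp add: measurable_completion)
  then show ?thesis by (rule measurable_restrict_space1)
qed

text \<open>Every cell meets \<open>[c, d)\<close> in a set that is empty or of positive measure, so an essential bound is a
  pointwise one. The right end is excluded: if \<open>d\<close> is a partition point, the value there is arbitrary.\<close>

lemma step_functions_bound:
  fixes u :: "real \<Rightarrow> real^'m::finite"
  assumes P: "partition_from a P" and u: "u \<in> step_functions P {c..d}" and ac: "a \<le> c"
    and norm: "norm_Linf {c..d} u \<le> ereal U" and t: "c \<le> t" "t < d"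
  shows "norm (u t) \<le> U"
proof (rule ccontr)
  assume U: "\<not> norm (u t) \<le> U"
  have neg: "negligible {s\<in>{c..d}. \<not> norm (u s) \<le> U}"
    using norm_Linf_le_imp_AE[OF norm] by (simp add: AE_lebesgue_on_iff_negligible)
  obtain i where i: "P i \<le> t" "t < P (Suc i)"
    using partition_from_covers[OF P, of t] ac t by auto
  have const: "u s = u t" if "s \<in> {t<..<min d (P (Suc i))}" for s
  proof -
    have "s \<in> {P i..<P (Suc i)} \<inter> {c..d}" "t \<in> {P i..<P (Suc i)} \<inter> {c..d}"
      using that i t by auto
    then show ?thesis using u unfolding step_functions_def by blast
  qed
  have "negligible {t<..<min d (P (Suc i))}"
  proof (rule negligible_subset[OF neg], rule subsetI)
    fix s assume s: "s \<in> {t<..<min d (P (Suc i))}"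
    show "s \<in> {s\<in>{c..d}. \<not> norm (u s) \<le> U}"
      unfolding mem_Collect_eq const[OF s] using s U t by auto
  qed
  then show False using open_not_negligible[of "{t<..<min d (P (Suc i))}"] t i by auto
qed

lemma norm_Linf_step_le:
  fixes u :: "real \<Rightarrow> real^'m::finite"
  assumes "u \<in> borel_measurable (lebesgue_on S)" "\<And>t. t \<in> S \<Longrightarrow> norm (u t) \<le> U"
  shows "norm_Linf S u \<le> ereal U"
  unfolding norm_Linf_def
  by (rule esssup_I) (use assms in \<open>auto intro!: AE_I2\<close>)

section \<open>Keeping the error in the funnel\<close>

context control_system
begin

lemma step_bounded_input:
  assumes P: "partition_from a P" and u: "u \<in> step_functions P {c..d}" and ac: "a \<le> c"
    and norm: "norm_Linf {c..d} u \<le> ereal U"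
  shows "bounded_input c u"
  unfolding bounded_input_def
proof (intro conjI allI exI[of _ "max (max U 0) (norm (u d))"] impI)
  show "u \<in> borel_measurable (lebesgue_on {c..b})" for b
    by (rule step_functions_measurable[OF P u ac])
  fix t assume t: "c \<le> t"
  consider "t < d" | "t = d" | "t \<notin> {c..d}" using t by fastforce
  then show "norm (u t) \<le> max (max U 0) (norm (u d))"
  proof cases
    case 1
    then show ?thesis using step_functions_bound[OF P u ac norm t] by auto
  next
    case 3
    then have "u t = 0" using u by (simp add: step_functions_def)
    then show ?thesis by simp
  qed auto
qed

text \<open>A positive continuous function on the compact product of a ball and the unit sphere has a positive
  minimum.\<close>

lemma gain_bounds:
  obtains F lam where "0 \<le> F" "0 < lam"
    "\<And>y. \<lbrakk>continuous_on {t0 - \<sigma>..} y; \<forall>t\<ge>t0 - \<sigma>. norm (y t) \<le> R\<rbrakk>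
    \<Longrightarrow> AE s in lebesgue_on {t0..}. norm (f (Op y s)) \<le> F \<and> (\<forall>z. norm z = 1 \<longrightarrow> lam \<le> z \<bullet> (g (Op y s) *v z))"
proof -
  obtain c0 where c0: "\<And>y. \<lbrakk>continuous_on {t0 - \<sigma>..} y; \<forall>t\<ge>t0 - \<sigma>. norm (y t) \<le> R\<rbrakk>
    \<Longrightarrow> AE s in lebesgue_on {t0..}. norm (Op y s) \<le> c0"
    using Op_bounded[of R] by blast
  define c where "c = max 0 c0"
  obtain F where F: "0 < F" "\<And>\<xi>. \<xi> \<in> cball 0 c \<Longrightarrow> norm (f \<xi>) \<le> F"
    using continuous_on_compact_bounded[OF compact_cball continuous_on_subset[OF f_cont]] by blast
  let ?K = "cball (0::real^'q) c \<times> sphere (0::real^'m) 1"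
  have "continuous_on UNIV (\<lambda>p::(real^'q) \<times> (real^'m). g (fst p))"
    by (rule continuous_on_compose2[OF g_cont]) (auto intro: continuous_intros)
  then have gc: "continuous_on UNIV (\<lambda>p. snd p \<bullet> (g (fst p) *v snd p))"
    unfolding matrix_vector_mult_def by (intro continuous_intros) auto
  have "sphere (0::real^'m) 1 \<noteq> {}" by simp
  then have ne: "?K \<noteq> {}" by (simp add: c_def)
  obtain p where p: "p \<in> ?K" "\<And>p'. p' \<in> ?K \<Longrightarrow> snd p \<bullet> (g (fst p) *v snd p) \<le> snd p' \<bullet> (g (fst p') *v snd p')"
    using continuous_attains_inf[OF compact_Times[OF compact_cball compact_sphere] ne continuous_on_subset[OF gc]]
    by blast
  define lam where "lam = snd p \<bullet> (g (fst p) *v snd p)"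
  have "snd p \<noteq> 0" using p(1) by auto
  then have lam: "0 < lam" unfolding lam_def by (rule g_pos)
  show ?thesis
  proof (rule that[OF less_imp_le[OF F(1)] lam])
    fix y :: "real \<Rightarrow> real^'m" assume "continuous_on {t0 - \<sigma>..} y" "\<forall>t\<ge>t0 - \<sigma>. norm (y t) \<le> R"
    from c0[OF this] show "AE s in lebesgue_on {t0..}. norm (f (Op y s)) \<le> F \<and> (\<forall>z. norm z = 1 \<longrightarrow> lam \<le> z \<bullet> (g (Op y s) *v z))"
    proof (rule eventually_mono)
      fix s assume "norm (Op y s) \<le> c0"
      then have "Op y s \<in> cball 0 c" by (auto simp: c_def)
      then show "norm (f (Op y s)) \<le> F \<and> (\<forall>z. norm z = 1 \<longrightarrow> lam \<le> z \<bullet> (g (Op y s) *v z))"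
        using F(2) p(2)[of "(Op y s, _)"] by (auto simp: lam_def)
    qed
  qed
qed

text \<open>All that the rest of the proof needs to know about control bound and step length. The bound \<open>R\<close> concerns
  the whole history because the operator has memory.\<close>

definition keeps_in_funnel ::
    "(real \<Rightarrow> real^'m) \<Rightarrow> (real \<Rightarrow> real) \<Rightarrow> real \<Rightarrow> real \<Rightarrow> real \<Rightarrow> bool" where
  "keeps_in_funnel yref \<psi> R \<beta> \<tau> \<longleftrightarrow>
     (\<forall>a c yh. t0 \<le> a \<longrightarrow> a < c \<longrightarrow> c \<le> a + \<tau> \<longrightarrow> continuous_on {t0 - \<sigma>..a} yh \<longrightarrow>
        (\<forall>t\<in>{t0 - \<sigma>..a}. norm (yh t) \<le> R) \<longrightarrow> norm (yh a - yref a) \<le> \<psi> a \<longrightarrow>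
        (\<exists>v y. norm v \<le> \<beta> \<and> (\<forall>t\<in>{t0 - \<sigma>..a}. y t = yh t) \<and> solves a c (\<lambda>_. v) y \<and>
          (\<forall>t\<in>{a..c}. norm (y t - yref t) \<le> \<psi> t)))"

text \<open>If the sampled error \<open>e0\<close> has norm \<open>E \<ge> \<psi>m / 2\<close>, the control is \<open>- \<beta> e0 / E\<close>. After time
  \<open>h\<close> the error has changed by some \<open>\<Delta>\<close> with \<open>norm \<Delta> \<le> K h\<close> and, by the choice of \<open>\<beta>\<close>,
  \<open>e0 \<bullet> \<Delta> \<le> - E (L\<psi> + 1) h\<close>. Expanding \<open>(norm (e0 + \<Delta>))\<^sup>2\<close> shows that the quadratic term
  \<open>K\<^sup>2 h\<^sup>2\<close> is absorbed by \<open>2 E h\<close> for small \<open>h\<close>, so that \<open>norm (e0 + \<Delta>) \<le> E - L\<psi> h\<close>: the error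
  norm decreases at least as fast as \<open>\<psi>\<close> can. If \<open>E < \<psi>m / 2\<close>, the control is 0 and the error
  moves by at most \<open>\<psi>m / 2\<close>.\<close>

lemma funnel_step:
  assumes \<psi>: "0 < \<psi>m" "\<And>t. 0 \<le> t \<Longrightarrow> \<psi>m \<le> \<psi> t"
      "0 < L\<psi>" "\<And>s t. \<lbrakk>0 \<le> s; 0 \<le> t\<rbrakk> \<Longrightarrow> \<bar>\<psi> t - \<psi> s\<bar> \<le> L\<psi> * \<bar>t - s\<bar>"
    and yref: "0 < Lr" "\<And>s t. \<lbrakk>0 \<le> s; 0 \<le> t\<rbrakk> \<Longrightarrow> norm (yref t - yref s :: real^'m) \<le> Lr * \<bar>t - s\<bar>"
  obtains \<beta> \<tau> where "0 < \<beta>" "0 < \<tau>" "keeps_in_funnel yref \<psi> R \<beta> \<tau>"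
proof -
  obtain F lam where Flam: "0 \<le> F" "0 < lam"
    "\<And>y. \<lbrakk>continuous_on {t0 - \<sigma>..} y; \<forall>t\<ge>t0 - \<sigma>. norm (y t) \<le> R + 1\<rbrakk>
    \<Longrightarrow> AE s in lebesgue_on {t0..}. norm (f (Op y s)) \<le> F \<and> (\<forall>z. norm z = 1 \<longrightarrow> lam \<le> z \<bullet> (g (Op y s) *v z))"
    using gain_bounds[of "R + 1"] by blast
  define \<beta> where "\<beta> = (F + Lr + L\<psi> + 1) / lam"
  have \<beta>: "0 < \<beta>" "\<beta> * lam = F + Lr + L\<psi> + 1"
    using Flam yref(1) \<psi>(3) by (auto simp: \<beta>_def)
  obtain M where M: "rhs_bound (R + 1) \<beta> M" by (rule rhs_bound_exists)
  have M0: "0 < M" using M by (simp add: rhs_bound_def)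
  define K where "K = M + Lr"
  have K: "0 < K" using M0 yref(1) by (simp add: K_def)
  define \<tau> where "\<tau> = Min {1 / M, \<psi>m / (2 * K), \<psi>m / K\<^sup>2, \<psi>m / (2 * L\<psi>)}"
  have \<tau>0: "0 < \<tau>" using M0 K \<psi>(1,3) by (auto simp: \<tau>_def)
  have \<tau>: "\<tau> \<le> 1 / M" "K * \<tau> \<le> \<psi>m / 2" "K\<^sup>2 * \<tau> \<le> \<psi>m" "L\<psi> * \<tau> \<le> \<psi>m / 2"
  proof -
    have m: "\<tau> \<le> 1 / M" "\<tau> \<le> \<psi>m / (2 * K)" "\<tau> \<le> \<psi>m / K\<^sup>2" "\<tau> \<le> \<psi>m / (2 * L\<psi>)"
      unfolding \<tau>_def by auto
    show "\<tau> \<le> 1 / M" by (rule m)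
    show "K * \<tau> \<le> \<psi>m / 2" using m(2) K by (simp add: field_simps)
    show "K\<^sup>2 * \<tau> \<le> \<psi>m" using m(3) K by (simp add: field_simps)
    show "L\<psi> * \<tau> \<le> \<psi>m / 2" using m(4) \<psi>(3) by (simp add: field_simps)
  qed
  show ?thesis
  proof (rule that[OF \<beta>(1) \<tau>0], unfold keeps_in_funnel_def, intro allI impI)
    fix a c and yh :: "real \<Rightarrow> real^'m"
    assume a: "t0 \<le> a" "a < c" "c \<le> a + \<tau>" and yh: "continuous_on {t0 - \<sigma>..a} yh"
        "\<forall>t\<in>{t0 - \<sigma>..a}. norm (yh t) \<le> R" and init: "norm (yh a - yref a) \<le> \<psi> a"
    define e0 where "e0 = yh a - yref a"
    define E where "E = norm e0"
    define n where "n = e0 /\<^sub>R E"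
    define v where "v = (if E < \<psi>m / 2 then 0 else - (\<beta> *\<^sub>R n))"
    have n1: "norm n = 1" if "\<not> E < \<psi>m / 2"
    proof -
      have "norm e0 \<noteq> 0" using that \<psi>(1) by (auto simp: E_def)
      then show ?thesis by (simp add: n_def E_def)
    qed
    have v: "norm v \<le> \<beta>" using n1 \<beta> by (auto simp: v_def)
    have a0: "0 \<le> a" using a t0_nonneg by simp
    obtain y where y: "\<And>t. t \<in> {t0 - \<sigma>..a} \<Longrightarrow> y t = yh t"
      "\<And>t. t \<in> {t0 - \<sigma>..a + 1 / M} \<Longrightarrow> norm (y t) \<le> R + 1" "solves a (a + 1 / M) (\<lambda>_. v) y"
      using local_existence[OF M a(1) refl yh(1), of "\<lambda>_. v"] yh(2) v by fastforce
    have sc: "solves a c (\<lambda>_. v) y"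
      by (rule solves_restrict[OF y(3)]) (use a \<tau> in auto)
    have yc: "continuous_on {t0 - \<sigma>..c} y" by (rule solves_continuous[OF sc])
    have yR: "norm (y t) \<le> R + 1" if "t \<in> {t0 - \<sigma>..c}" for t
      using y(2)[of t] that a \<tau>(1) by auto
    let ?r = "rhs (stopped c y) (\<lambda>_. v)"
    have ct: "t0 \<le> c" using a by simp
    have syc: "continuous_on {t0 - \<sigma>..} (stopped c y)" by (rule stopped_continuous[OF yc ct])
    have syR: "\<forall>t\<ge>t0 - \<sigma>. norm (stopped c y t) \<le> R + 1"
      using yR ct \<sigma>_nonneg by (auto simp: stopped_def)
    have ya: "y a = yh a" using y(1) a \<sigma>_nonneg by auto
    have "norm (y t - yref t) \<le> \<psi> t" if t: "t \<in> {a..c}" for t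
    proof -
      define h where "h = t - a"
      have h: "0 \<le> h" "h \<le> \<tau>" using t a by (auto simp: h_def)
      have t0': "0 \<le> t" using t a0 by auto
      define \<Delta> where "\<Delta> = (y t - y a) - (yref t - yref a)"
      have e: "y t - yref t = e0 + \<Delta>" using ya by (simp add: \<Delta>_def e0_def)
      have ly: "norm (y t - y a) \<le> M * h"
        using solves_lipschitz[OF sc a(1) M yR v, of a t] t by (auto simp: h_def)
      have lr: "norm (yref t - yref a) \<le> Lr * h"
        using yref(2)[OF a0 t0'] t by (auto simp: h_def)
      have \<Delta>: "norm \<Delta> \<le> K * h"
        using norm_triangle_ineq4[of "y t - y a" "yref t - yref a"] ly lr by (auto simp: \<Delta>_def K_def algebra_simps)
      have l\<psi>: "\<psi> a - L\<psi> * h \<le> \<psi> t" using \<psi>(4)[OF a0 t0'] t by (auto simp: h_def)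
      show ?thesis
      proof (cases "E < \<psi>m / 2")
        case True
        have "norm (e0 + \<Delta>) \<le> E + norm \<Delta>" unfolding E_def by (rule norm_triangle_ineq)
        also have "\<dots> \<le> \<psi>m / 2 + K * \<tau>"
        proof (intro add_mono)
          have "K * h \<le> K * \<tau>" using h(2) K by (intro mult_left_mono) auto
          then show "norm \<Delta> \<le> K * \<tau>" using \<Delta> by simp
        qed (use True in simp)
        also have "\<dots> \<le> \<psi> t" using \<tau>(2) \<psi>(2)[OF t0'] by auto
        finally show ?thesis using e by simp
      next
        case False
        then have E: "E \<ge> \<psi>m / 2" "E > 0" using \<psi>(1) by auto
        have vn: "v = - (\<beta> *\<^sub>R n)" using False by (simp add: v_def)
        have i: "(?r has_integral (y t - y a)) {a..t}" using sc t by (simp add: solves_def)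
        have "((\<lambda>s. n \<bullet> ?r s) has_integral (n \<bullet> (y t - y a))) {a..t}"
          using has_integral_linear[OF i bounded_linear_inner_right[of n]] by (simp add: o_def)
        moreover have "AE s in lebesgue_on {a..t}. n \<bullet> ?r s \<le> - (Lr + L\<psi> + 1)"
        proof -
          have "AE s in lebesgue_on {a..t}. norm (f (Op (stopped c y) s)) \<le> F \<and>
              (\<forall>z. norm z = 1 \<longrightarrow> lam \<le> z \<bullet> (g (Op (stopped c y) s) *v z))"
            by (rule AE_lebesgue_on_subset[OF Flam(3)[OF syc syR]]) (use a in auto)
          then show ?thesis
          proof (rule eventually_mono)
            fix s assume s: "norm (f (Op (stopped c y) s)) \<le> F \<and>
              (\<forall>z. norm z = 1 \<longrightarrow> lam \<le> z \<bullet> (g (Op (stopped c y) s) *v z))"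
            have "n \<bullet> f (Op (stopped c y) s) \<le> F"
              using norm_cauchy_schwarz[of n "f (Op (stopped c y) s)"] s n1[OF False] by simp
            moreover have "n \<bullet> (g (Op (stopped c y) s) *v v) = - (\<beta> * (n \<bullet> (g (Op (stopped c y) s) *v n)))"
              unfolding vn by (simp add: matrix_vector_mult_scaleR flip: scaleR_minus_left)
            moreover have "\<beta> * lam \<le> \<beta> * (n \<bullet> (g (Op (stopped c y) s) *v n))"
              using s n1[OF False] \<beta>(1) by (intro mult_left_mono) auto
            ultimately show "n \<bullet> ?r s \<le> - (Lr + L\<psi> + 1)"
              using \<beta>(2) by (simp add: rhs_def inner_add_right)
          qed
        qed
        ultimately have dec: "n \<bullet> (y t - y a) \<le> - (Lr + L\<psi> + 1) * h"
          using t unfolding h_def by (intro has_integral_le_AE) auto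
        have "n \<bullet> \<Delta> \<le> - (L\<psi> + 1) * h"
        proof -
          have "- (n \<bullet> (yref t - yref a)) \<le> Lr * h"
            using norm_cauchy_schwarz[of n "yref a - yref t"] lr n1[OF False]
            by (simp add: inner_diff_right norm_minus_commute)
          then show ?thesis using dec by (simp add: \<Delta>_def inner_diff_right algebra_simps)
        qed
        moreover have "e0 = E *\<^sub>R n" using E by (simp add: n_def)
        ultimately have "e0 \<bullet> \<Delta> \<le> E * (- (L\<psi> + 1) * h)"
          using E by (simp add: mult_left_mono)
        moreover have "(norm \<Delta>)\<^sup>2 \<le> 2 * E * h"
        proof -
          have "(norm \<Delta>)\<^sup>2 \<le> (K * h)\<^sup>2" using \<Delta> by (intro power_mono) auto
          also have "\<dots> = (K\<^sup>2 * h) * h" by (simp add: power2_eq_square)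
          also have "\<dots> \<le> (2 * E) * h"
            using mult_left_mono[OF h(2), of "K\<^sup>2"] \<tau>(3) E(1) h(1) by (intro mult_right_mono) auto
          finally show ?thesis .
        qed
        moreover have "(norm (e0 + \<Delta>))\<^sup>2 = E\<^sup>2 + 2 * (e0 \<bullet> \<Delta>) + (norm \<Delta>)\<^sup>2"
          unfolding E_def power2_norm_eq_inner by (simp add: algebra_simps inner_commute)
        ultimately have "(norm (e0 + \<Delta>))\<^sup>2 \<le> E\<^sup>2 - 2 * E * (L\<psi> * h)"
          by (simp add: algebra_simps)
        also have "\<dots> \<le> (E - L\<psi> * h)\<^sup>2" using zero_le_power2[of "L\<psi> * h"] by (simp add: power2_diff)
        finally have "norm (e0 + \<Delta>) \<le> E - L\<psi> * h"
        proof (rule power2_le_imp_le)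
          have "L\<psi> * h \<le> L\<psi> * \<tau>" using h(2) \<psi>(3) by (intro mult_left_mono) auto
          then show "0 \<le> E - L\<psi> * h" using \<tau>(4) E(1) by simp
        qed
        also have "\<dots> \<le> \<psi> t" using init l\<psi> by (simp add: E_def e0_def)
        finally show ?thesis using e by simp
      qed
    qed
    then show "\<exists>v y. norm v \<le> \<beta> \<and> (\<forall>t\<in>{t0 - \<sigma>..a}. y t = yh t) \<and> solves a c (\<lambda>_. v) y \<and>
          (\<forall>t\<in>{a..c}. norm (y t - yref t) \<le> \<psi> t)"
      using v y(1) sc by blast
  qed
qed

end

section \<open>The optimal control problem has a solution\<close>

text \<open>The constants \<open>umax\<close>, \<open>\<tau>\<close> and \<open>R\<close> are fixed first; the horizon, the time shift and the partition are
  arbitrary afterwards.\<close>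

locale mpc_problem = control_system t0 \<sigma> f g Op
  for t0 \<sigma> :: real
    and f :: "real^'q::finite \<Rightarrow> real^'m::finite"
    and g :: "real^'q \<Rightarrow> real^'m^'m"
    and Op :: "('m, 'q) operator" +
  fixes yref :: "real \<Rightarrow> real^'m" and \<psi> :: "real \<Rightarrow> real"
    and l :: "real \<Rightarrow> real^'m \<Rightarrow> real^'m \<Rightarrow> real"
    and umax \<tau> R \<delta> Th :: real and P :: "nat \<Rightarrow> real"
  assumes l_continuous: "continuous_on ({0..} \<times> UNIV \<times> UNIV) (\<lambda>(t, y, u). l t y u)"
    and \<psi>_continuous: "continuous_on {0..} \<psi>" and yref_continuous: "continuous_on {0..} yref"
    and R: "\<And>t. 0 \<le> t \<Longrightarrow> \<psi> t + norm (yref t) \<le> R"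
    and umax: "0 < umax"
    and one_step: "keeps_in_funnel yref \<psi> R umax \<tau>"
    and \<delta>: "0 < \<delta>" and Th: "\<delta> \<le> Th"
    and P: "partition_from t0 P" and P_step: "\<And>i. P (Suc i) \<le> P i + \<tau>"
    and grid: "\<And>k::nat. \<exists>i. P i = t0 + real k * \<delta>"
begin

text \<open>Histories from which \<open>one_step\<close> can be iterated along the partition; the closed loop produces only these.\<close>

definition feasible_history :: "real \<Rightarrow> (real \<Rightarrow> real^'m) \<Rightarrow> bool" where
  "feasible_history th yh \<longleftrightarrow> t0 \<le> th \<and> (\<exists>i. P i = th) \<and> continuous_on {t0 - \<sigma>..th} yh \<and>
     (\<forall>t\<in>{t0 - \<sigma>..th}. norm (yh t) \<le> R) \<and> norm (yh th - yref th) \<le> \<psi> th"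

abbreviation adm where
  "adm th yh \<equiv> ocp_admissible t0 \<sigma> (f, g, Op) umax P Th th yh"

lemma Th_pos: "0 < Th" using \<delta> Th by simp

lemma in_funnel_bound: "0 \<le> t \<Longrightarrow> norm (y - yref t) \<le> \<psi> t \<Longrightarrow> norm y \<le> R"
  using R[of t] norm_triangle_ineq[of "y - yref t" "yref t"] by auto

lemma feasible_steps:
  assumes h: "feasible_history (P i0) yh"
  shows "\<exists>u y. (\<forall>t. norm (u t) \<le> umax) \<and>
     (\<forall>i. \<forall>s\<in>{P i..<P (Suc i)}. \<forall>s'\<in>{P i..<P (Suc i)}. u s = u s') \<and>
     (\<forall>t\<in>{t0 - \<sigma>..P i0}. y t = yh t) \<and> solves (P i0) (P (i0 + k)) u y \<and>
     (\<forall>t\<in>{P i0..P (i0 + k)}. norm (y t - yref t) \<le> \<psi> t)"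
proof (induction k)
  case 0
  have "solves (P i0) (P i0) (\<lambda>_. 0) yh"
    using h by (auto simp: solves_def feasible_history_def)
  then show ?case using h umax by (intro exI[of _ "\<lambda>_. 0"] exI[of _ yh]) (auto simp: feasible_history_def)
next
  case (Suc k)
  let ?a = "P (i0 + k)" and ?c = "P (i0 + Suc k)"
  obtain u y where u: "\<And>t. norm (u t) \<le> umax"
      "\<And>i s s'. s \<in> {P i..<P (Suc i)} \<Longrightarrow> s' \<in> {P i..<P (Suc i)} \<Longrightarrow> u s = u s'"
    and y: "\<And>t. t \<in> {t0 - \<sigma>..P i0} \<Longrightarrow> y t = yh t" "solves (P i0) ?a u y"
      "\<And>t. t \<in> {P i0..?a} \<Longrightarrow> norm (y t - yref t) \<le> \<psi> t"
    using Suc by blast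
  have th: "t0 \<le> P i0" "P i0 \<le> ?a" "?a < ?c" "?c \<le> ?a + \<tau>"
    using h P P_step[of "i0 + k"] partition_from_le[OF P, of i0 "i0 + k"]
    by (auto simp: feasible_history_def partition_from_def strict_mono_less)
  have yR: "norm (y t) \<le> R" if t: "t \<in> {t0 - \<sigma>..?a}" for t
  proof (cases "t \<le> P i0")
    case True
    then show ?thesis using h y(1) t by (auto simp: feasible_history_def)
  next
    case False
    then show ?thesis using y(3)[of t] t th t0_nonneg by (intro in_funnel_bound[of t]) auto
  qed
  have "\<exists>v y'. norm v \<le> umax \<and> (\<forall>t\<in>{t0 - \<sigma>..?a}. y' t = y t) \<and> solves ?a ?c (\<lambda>_. v) y' \<and>
          (\<forall>t\<in>{?a..?c}. norm (y' t - yref t) \<le> \<psi> t)"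
    by (rule one_step[unfolded keeps_in_funnel_def, rule_format]) (use th solves_continuous[OF y(2)] yR y(3)[of ?a] in auto)
  then obtain v y' where v: "norm v \<le> umax" and y': "\<And>t. t \<in> {t0 - \<sigma>..?a} \<Longrightarrow> y' t = y t"
     "solves ?a ?c (\<lambda>_. v) y'" "\<And>t. t \<in> {?a..?c} \<Longrightarrow> norm (y' t - yref t) \<le> \<psi> t"
    by blast
  define u' where "u' t = (if t < ?a then u t else v)" for t
  have "solves (P i0) ?a u' y'"
    by (rule solves_cong[OF y(2) th(1,2)]) (use y' in \<open>auto simp: u'_def\<close>)
  moreover have "solves ?a ?c u' y'"
    by (rule solves_cong[OF y'(2)]) (use th in \<open>auto simp: u'_def\<close>)
  ultimately have "solves (P i0) ?c u' y'"
    by (rule solves_append) (use th in auto)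
  moreover have "norm (u' t) \<le> umax" for t using u(1) v by (simp add: u'_def)
  moreover have "u' s = u' s'" if "s \<in> {P i..<P (Suc i)}" "s' \<in> {P i..<P (Suc i)}" for i s s'
  proof (cases "i < i0 + k")
    case True
    then have "P (Suc i) \<le> ?a" by (intro partition_from_le[OF P]) auto
    then show ?thesis using that u(2)[OF that] by (auto simp: u'_def)
  next
    case False
    then have "?a \<le> P i" by (intro partition_from_le[OF P]) auto
    then show ?thesis using that by (auto simp: u'_def)
  qed
  moreover have "y' t = yh t" if "t \<in> {t0 - \<sigma>..P i0}" for t using y(1) y'(1) that th by auto
  moreover have "norm (y' t - yref t) \<le> \<psi> t" if "t \<in> {P i0..?c}" for t
    using y(3)[of t] y'(1)[of t] y'(3)[of t] that th \<sigma>_nonneg by (cases "t \<le> ?a") auto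
  ultimately show ?case by blast
qed

lemma feasible_control:
  assumes h: "feasible_history th yh"
  obtains u y where "u \<in> step_functions P {th..th + Th}" "\<And>t. norm (u t) \<le> umax"
    "\<And>t. t \<in> {t0 - \<sigma>..th} \<Longrightarrow> y t = yh t" "solves th (th + Th) u y"
    "\<And>t. t \<in> {th..th + Th} \<Longrightarrow> norm (y t - yref t) \<le> \<psi> t"
proof -
  obtain i0 where i0: "P i0 = th" and th: "t0 \<le> th" using h by (auto simp: feasible_history_def)
  obtain j where j: "P j \<le> th + Th" "th + Th < P (Suc j)"
    using partition_from_covers[OF P, of "th + Th"] th Th_pos by auto
  have "th < P (Suc j)" using j Th_pos by simp
  then have "i0 < Suc j" using partition_from_le[OF P, of "Suc j" i0] i0 by (meson leD leI)
  then obtain k where k: "Suc j = i0 + k" by (metis less_imp_add_positive)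
  have hP: "feasible_history (P i0) yh" using h i0 by simp
  obtain u y where u: "\<forall>t. norm (u t) \<le> umax"
      "\<forall>i. \<forall>s\<in>{P i..<P (Suc i)}. \<forall>s'\<in>{P i..<P (Suc i)}. u s = u s'"
    and y: "\<forall>t\<in>{t0 - \<sigma>..th}. y t = yh t" "solves th (P (Suc j)) u y"
      "\<forall>t\<in>{th..P (Suc j)}. norm (y t - yref t) \<le> \<psi> t"
    using feasible_steps[OF hP, of k] unfolding i0 k[symmetric]
    by (elim exE conjE) (rule that; assumption)
  define u' where "u' t = (if t \<in> {th..th + Th} then u t else 0)" for t
  show ?thesis
  proof (rule that[of u' y])
    show "u' \<in> step_functions P {th..th + Th}"
      unfolding step_functions_def mem_Collect_eq
    proof (intro conjI allI ballI impI)
      fix i s s' assume s: "s \<in> {P i..<P (Suc i)} \<inter> {th..th + Th}" "s' \<in> {P i..<P (Suc i)} \<inter> {th..th + Th}"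
      then have "u s = u s'" using u(2) by blast
      then show "u' s = u' s'" using s by (simp add: u'_def)
    qed (auto simp: u'_def)
    show "norm (u' t) \<le> umax" for t using u(1) umax by (simp add: u'_def)
    have "solves th (th + Th) u y"
      by (rule solves_restrict[OF y(2) th]) (use j Th_pos in auto)
    then show "solves th (th + Th) u' y"
      by (rule solves_cong) (use th Th_pos in \<open>auto simp: u'_def\<close>)
  qed (use y j in auto)
qed

definition running_cost :: "real \<Rightarrow> (real \<Rightarrow> real^'m) \<Rightarrow> (real \<Rightarrow> real^'m) \<Rightarrow> ennreal" where
  "running_cost th u y = (\<integral>\<^sup>+ t. ennreal (l t (y t) (u t)) \<partial>lebesgue_on {th..th + Th})"

lemma running_cost_cong:
  assumes "\<And>t. t \<in> {th..<th + Th} \<Longrightarrow> u t = u' t" "\<And>t. t \<in> {th..<th + Th} \<Longrightarrow> y t = y' t"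
  shows "running_cost th u y = running_cost th u' y'"
  unfolding running_cost_def
  by (rule nn_integral_cong_AE, rule eventually_mono[OF AE_not_endpoint]) (use assms in auto)

lemma cost_eq_running_cost:
  assumes "ereal (th + Th) \<le> \<omega>" "\<And>t. t \<in> {th..<th + Th} \<Longrightarrow> norm (y t - yref t) \<le> \<psi> t"
  shows "cost yref \<psi> l Th th (u, y, \<omega>) = running_cost th u y"
  unfolding cost_def running_cost_def prod.case
proof (rule nn_integral_cong_AE, rule eventually_mono[OF AE_not_endpoint])
  fix t assume t: "t \<in> {th..<th + Th}"
  then have "ereal t < \<omega>" using assms(1) by (auto intro: less_le_trans[of _ "ereal (th + Th)"])
  then show "(if ereal t < \<omega> then stage_cost yref \<psi> l t (y t) (u t) else \<infinity>) = ennreal (l t (y t) (u t))"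
    using assms(2)[OF t] by (simp add: stage_cost_def)
qed

lemma admissible_of_solves:
  assumes h: "feasible_history th yh" and u: "u \<in> step_functions P {th..th + Th}" "\<And>t. norm (u t) \<le> umax"
    and y: "\<And>t. t \<in> {t0 - \<sigma>..th} \<Longrightarrow> y t = yh t" "solves th (th + Th) u y"
      "\<And>t. t \<in> {th..th + Th} \<Longrightarrow> norm (y t - yref t) \<le> \<psi> t"
  obtains p where "p \<in> adm th yh" "cost yref \<psi> l Th th p = running_cost th u y"
proof -
  have th: "t0 \<le> th" and yh: "continuous_on {t0 - \<sigma>..th} yh" using h by (auto simp: feasible_history_def)
  have norm: "norm_Linf {th..th + Th} u \<le> ereal umax"
    by (rule norm_Linf_step_le[OF step_functions_measurable[OF P u(1) th] u(2)])
  have b: "bounded_input th u" by (rule step_bounded_input[OF P u(1) th norm])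
  have "sol th yh u y (ereal (th + Th))"
    by (rule solves_imp_solution_Icc[OF y(2) th _ y(1) b]) (use Th_pos in auto)
  from maximal_extension[OF this yh th b] obtain y' \<omega> where *: "ereal (th + Th) \<le> \<omega>"
    "max_sol th yh u y' \<omega>"
    "\<And>s. \<lbrakk>t0 - \<sigma> \<le> s; ereal s < ereal (th + Th)\<rbrakk> \<Longrightarrow> y' s = y s" by blast
  have y': "y' t = y t" if "t \<in> {th..<th + Th}" for t using *(3)[of t] that th \<sigma>_nonneg by auto
  have "cost yref \<psi> l Th th (u, y', \<omega>) = running_cost th u y'"
    by (rule cost_eq_running_cost[OF *(1)]) (use y' y(3) in auto)
  also have "\<dots> = running_cost th u y"
    by (rule running_cost_cong) (use y' in auto)
  finally show ?thesis
    using * u norm by (intro that[of "(u, y', \<omega>)"]) (auto simp: ocp_admissible_def)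
qed

lemma running_cost_finite:
  assumes th: "0 \<le> th" and y: "\<And>t. t \<in> {th..<th + Th} \<Longrightarrow> norm (y t) \<le> R"
    and u: "\<And>t. t \<in> {th..<th + Th} \<Longrightarrow> norm (u t) \<le> umax"
  shows "running_cost th u y < \<infinity>"
proof -
  let ?K = "{th..th + Th} \<times> cball (0::real^'m) R \<times> cball (0::real^'m) umax"
  have "compact ?K" by (intro compact_Times) auto
  moreover have "?K \<subseteq> {0..} \<times> UNIV \<times> UNIV" using th by auto
  ultimately obtain C where C: "\<And>p. p \<in> ?K \<Longrightarrow> norm ((\<lambda>(t, y, u). l t y u) p) \<le> C"
    using continuous_on_compact_bounded[OF _ continuous_on_subset[OF l_continuous]] by blast
  have "running_cost th u y \<le> (\<integral>\<^sup>+ t. ennreal C \<partial>lebesgue_on {th..th + Th})"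
    unfolding running_cost_def
  proof (rule nn_integral_mono_AE, rule eventually_mono[OF AE_not_endpoint])
    fix t assume t: "t \<in> {th..<th + Th}"
    then show "ennreal (l t (y t) (u t)) \<le> ennreal C"
      using C[of "(t, y t, u t)"] y[OF t] u[OF t] by (intro ennreal_leI) auto
  qed
  also have "\<dots> = ennreal C * emeasure (lebesgue_on {th..th + Th}) {th..th + Th}"
    by simp
  also have "\<dots> < \<infinity>"
    using Th_pos by (simp add: emeasure_restrict_space ennreal_mult_less_top)
  finally show ?thesis .
qed

text \<open>Comparison with an infinite multiple of an indicator function; the integral is monotone also for
  integrands of unknown measurability.\<close>

lemma cost_infinite:
  assumes cd: "th \<le> c" "c < d" "d \<le> th + Th"
    and inf: "\<And>t. t \<in> {c..d} \<Longrightarrow> ereal t < \<omega> \<Longrightarrow> \<not> norm (y t - yref t) \<le> \<psi> t"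
  shows "cost yref \<psi> l Th th (u, y, \<omega>) = \<infinity>"
proof -
  have "\<infinity> * emeasure (lebesgue_on {th..th + Th}) {c..d} = (\<integral>\<^sup>+ t. \<infinity> * indicator {c..d} t \<partial>lebesgue_on {th..th + Th})"
    by (rule nn_integral_cmult_indicator[symmetric]) (use cd in \<open>auto simp: sets_restrict_space_iff\<close>)
  also have "\<dots> \<le> cost yref \<psi> l Th th (u, y, \<omega>)"
    unfolding cost_def prod.case
    by (rule nn_integral_mono) (use inf in \<open>auto simp: indicator_def stage_cost_def\<close>)
  finally have "\<infinity> * emeasure (lebesgue_on {th..th + Th}) {c..d} \<le> cost yref \<psi> l Th th (u, y, \<omega>)" .
  moreover have "emeasure (lebesgue_on {th..th + Th}) {c..d} = ennreal (d - c)"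
    using cd by (subst emeasure_restrict_space) auto
  ultimately show ?thesis
    using cd by (simp add: ennreal_top_mult top_unique)
qed

text \<open>A violation of the funnel at one time persists on an interval, by continuity, and makes the cost
  infinite; so does a response that ends before the horizon. A response that ends exactly at the
  horizon is bounded, because it stays in the funnel, and hence not maximal.\<close>

lemma finite_cost_imp_in_funnel:
  assumes h: "feasible_history th yh" and p: "(u, y, \<omega>) \<in> adm th yh" and fin: "cost yref \<psi> l Th th (u, y, \<omega>) < \<infinity>"
  shows "ereal (th + Th) < \<omega>" "solves th (th + Th) u y"
    "\<And>t. t \<in> {t0 - \<sigma>..th} \<Longrightarrow> y t = yh t"
    "\<And>t. t \<in> {th..th + Th} \<Longrightarrow> norm (y t - yref t) \<le> \<psi> t"
    "\<And>t. t \<in> {th..<th + Th} \<Longrightarrow> norm (u t) \<le> umax"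
proof -
  let ?b = "th + Th"
  have th: "t0 \<le> th" and yh: "continuous_on {t0 - \<sigma>..th} yh" "\<And>t. t \<in> {t0 - \<sigma>..th} \<Longrightarrow> norm (yh t) \<le> R"
    using h by (auto simp: feasible_history_def)
  have th0: "0 \<le> th" using th t0_nonneg by simp
  have u: "u \<in> step_functions P {th..?b}" "norm_Linf {th..?b} u \<le> ereal umax"
    and max: "max_sol th yh u y \<omega>"
    using p by (auto simp: ocp_admissible_def)
  then have sol: "sol th yh u y \<omega>" by (simp add: maximal_solution_def)
  then show hist: "\<And>t. t \<in> {t0 - \<sigma>..th} \<Longrightarrow> y t = yh t" by (simp add: solution_def)
  have bi: "bounded_input th u" by (rule step_bounded_input[OF P u(1) th u(2)])
  show "norm (u t) \<le> umax" if "t \<in> {th..<?b}" for t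
    using step_functions_bound[OF P u(1) th u(2)] that by auto
  have slv: "solves th s u y" if "th \<le> s" "ereal s < \<omega>" for s
    by (rule solution_imp_solves[OF sol yh(1) th that])
  have ex: "ereal t < \<omega>" if t: "t \<in> {th..<?b}" for t
  proof (rule ccontr)
    assume "\<not> ereal t < \<omega>"
    then have "\<omega> \<le> ereal t" by simp
    then have "\<not> ereal s < \<omega>" if "s \<in> {t..?b}" for s
      using that by (meson atLeastAtMost_iff ereal_less_eq(3) leD order_trans)
    then have "cost yref \<psi> l Th th (u, y, \<omega>) = \<infinity>"
      using t by (intro cost_infinite[of th t ?b]) auto
    then show False using fin by simp
  qed
  have in_funnel: "norm (y t - yref t) \<le> \<psi> t" if t: "t \<in> {th..<?b}" for t
  proof (rule ccontr)
    assume "\<not> norm (y t - yref t) \<le> \<psi> t"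
    then have gt: "0 < norm (y t - yref t) - \<psi> t" by simp
    define d where "d = (t + ?b) / 2"
    have d: "t < d" "d < ?b" using t by (auto simp: d_def)
    have "continuous_on {t..d} y"
      by (rule continuous_on_subset[OF solves_continuous[OF slv[of d]]]) (use d t ex[of d] th \<sigma>_nonneg in auto)
    then have "continuous_on {t..d} (\<lambda>s. norm (y s - yref s) - \<psi> s)"
      using t th0 by (intro continuous_intros continuous_on_subset[OF yref_continuous] continuous_on_subset[OF \<psi>_continuous]) auto
    from this[unfolded continuous_on_iff, rule_format, of t, OF _ gt] d(1)
    obtain r where r: "r > 0" "\<And>s. s \<in> {t..d} \<Longrightarrow> dist s t < r \<Longrightarrow>
       dist (norm (y s - yref s) - \<psi> s) (norm (y t - yref t) - \<psi> t) < norm (y t - yref t) - \<psi> t" by auto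
    define c where "c = min d (t + r / 2)"
    have c: "t < c" "c \<le> d" "c - t < r" using d r by (auto simp: c_def)
    have "\<not> norm (y s - yref s) \<le> \<psi> s" if "s \<in> {t..c}" for s
      using r(2)[of s] that c by (auto simp: dist_real_def)
    then have "cost yref \<psi> l Th th (u, y, \<omega>) = \<infinity>"
      using t c d by (intro cost_infinite[of th t c]) auto
    then show False using fin by simp
  qed
  show b\<omega>: "ereal ?b < \<omega>"
  proof (rule ccontr)
    assume "\<not> ereal ?b < \<omega>"
    then have le: "\<omega> \<le> ereal ?b" by simp
    have "norm (y s) \<le> R" if s: "t0 - \<sigma> \<le> s" "ereal s < \<omega>" for s
    proof (cases "s \<le> th")
      case True
      then show ?thesis using hist yh s by auto
    next
      case False
      have "ereal s < ereal ?b" using s le by (rule_tac less_le_trans)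
      then show ?thesis using False in_funnel[of s] th0 by (intro in_funnel_bound[of s]) auto
    qed
    then have "\<omega> = \<infinity>" by (rule maximal_solution_bounded_imp_global[OF max yh(1) th bi])
    then show False using le by simp
  qed
  show sb: "solves th ?b u y" using slv[OF _ b\<omega>] Th_pos by auto
  show "norm (y t - yref t) \<le> \<psi> t" if t: "t \<in> {th..?b}" for t
  proof -
    have "norm (y t - yref t) - \<psi> t \<le> 0"
    proof (rule continuous_le_on_closure[of "{th..<?b}" "\<lambda>s. norm (y s - yref s) - \<psi> s" t 0])
      have "continuous_on {th..?b} y"
        by (rule continuous_on_subset[OF solves_continuous[OF sb]]) (use th \<sigma>_nonneg in auto)
      then show "continuous_on (closure {th..<?b}) (\<lambda>s. norm (y s - yref s) - \<psi> s)"
        using Th_pos th0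
        by (auto intro!: continuous_intros continuous_on_subset[OF yref_continuous] continuous_on_subset[OF \<psi>_continuous])
    qed (use t in_funnel Th_pos in auto)
    then show ?thesis by simp
  qed
qed

lemma feasible_finite_cost:
  assumes h: "feasible_history th yh"
  obtains p where "p \<in> adm th yh" "cost yref \<psi> l Th th p < \<infinity>"
proof -
  have th0: "0 \<le> th" using h t0_nonneg by (auto simp: feasible_history_def)
  obtain u y where u: "u \<in> step_functions P {th..th + Th}" "\<And>t. norm (u t) \<le> umax"
    and y: "\<And>t. t \<in> {t0 - \<sigma>..th} \<Longrightarrow> y t = yh t" "solves th (th + Th) u y"
      "\<And>t. t \<in> {th..th + Th} \<Longrightarrow> norm (y t - yref t) \<le> \<psi> t"
    using feasible_control[OF h] by blast
  obtain p where p: "p \<in> adm th yh" "cost yref \<psi> l Th th p = running_cost th u y"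
    using admissible_of_solves[OF h u y] by blast
  have "running_cost th u y < \<infinity>"
  proof (rule running_cost_finite[OF th0])
    fix t assume "t \<in> {th..<th + Th}"
    then show "norm (y t) \<le> R" using y(3)[of t] th0 by (intro in_funnel_bound[of t]) auto
  qed (rule u(2))
  then show ?thesis using p that by simp
qed

lemma running_cost_measurable:
  assumes th: "0 \<le> th" and y: "continuous_on {th..b} y" and u: "u \<in> borel_measurable (lebesgue_on {th..b})"
  shows "(\<lambda>t. ennreal (l t (y t) (u t))) \<in> borel_measurable (lebesgue_on {th..b})"
proof -
  have c: "continuous_on UNIV (\<lambda>(t, y, u). l (max 0 t) y u)"
  proof -
    have "continuous_on UNIV (\<lambda>p. (\<lambda>(t, y, u). l t y u) (max 0 (fst p), fst (snd p), snd (snd p)))"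
      by (rule continuous_on_compose2[OF l_continuous]) (auto intro!: continuous_intros)
    then show ?thesis by (simp add: case_prod_beta)
  qed
  have "(\<lambda>t. (t, y t, u t)) \<in> borel_measurable (lebesgue_on {th..b})"
  proof (intro borel_measurable_Pair u)
    show "(\<lambda>t. t) \<in> borel_measurable (lebesgue_on {th..b})"
      by (rule continuous_imp_measurable_on_sets_lebesgue) (auto intro: continuous_intros)
    show "y \<in> borel_measurable (lebesgue_on {th..b})"
      by (rule continuous_imp_measurable_on_sets_lebesgue[OF y]) auto
  qed
  from measurable_compose[OF this borel_measurable_continuous_onI[OF c]]
  have "(\<lambda>t. l (max 0 t) (y t) (u t)) \<in> borel_measurable (lebesgue_on {th..b})" by simp
  then have "(\<lambda>t. ennreal (l (max 0 t) (y t) (u t))) \<in> borel_measurable (lebesgue_on {th..b})" by measurable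
  then show ?thesis
    by (rule measurable_cong[THEN iffD1, rotated]) (use th in auto)
qed

text \<open>The starting time is a partition point, so a step function on the horizon is determined by its values at
  partition points, and convergence at these countably many points is convergence everywhere.\<close>

lemma step_functions_limit:
  assumes th: "th = P j" and u: "\<And>n. u n \<in> step_functions P {th..b}" "\<And>n t. norm (u n t) \<le> umax"
  obtains r :: "nat \<Rightarrow> nat" and v where "strict_mono r" "\<And>t. (\<lambda>n. u (r n) t) \<longlonglongrightarrow> v t"
    "v \<in> step_functions P {th..b}" "\<And>t. norm (v t) \<le> umax"
proof -
  have "countable (range P)" by simp
  then obtain r where r: "strict_mono (r::nat \<Rightarrow> nat)" "\<And>s. s \<in> range P \<Longrightarrow> \<exists>x. (\<lambda>n. u (r n) s) \<longlonglongrightarrow> x"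
    using function_convergent_subsequence[of "range P" u umax] u(2) by blast
  have "\<exists>x. (\<lambda>n. u (r n) t) \<longlonglongrightarrow> x" for t
  proof (cases "t \<in> {th..b}")
    case True
    have "t0 \<le> t" using True partition_from_le[OF P, of 0 j] P by (auto simp: th partition_from_def)
    then obtain i where i: "P i \<le> t" "t < P (Suc i)" using partition_from_covers[OF P] by blast
    have "j < Suc i" using True i(2) partition_from_le[OF P, of "Suc i" j] th by (auto simp: not_less[symmetric])
    then have "P j \<le> P i" by (intro partition_from_le[OF P]) auto
    then have m: "P i \<in> {P i..<P (Suc i)} \<inter> {th..b}" "t \<in> {P i..<P (Suc i)} \<inter> {th..b}"
      using True i th by auto
    have "u n t = u n (P i)" for n
      using u(1)[of n] m unfolding step_functions_def by blast
    then show ?thesis using r(2)[of "P i"] by auto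
  next
    case False
    then have "u n t = 0" for n using u(1)[of n] by (simp add: step_functions_def)
    then show ?thesis by auto
  qed
  then obtain v where v: "\<And>t. (\<lambda>n. u (r n) t) \<longlonglongrightarrow> v t" by metis
  show ?thesis
  proof (rule that[OF r(1) v])
    show "norm (v t) \<le> umax" for t
      by (rule LIMSEQ_le_const2[OF tendsto_norm[OF v]]) (use u(2) in auto)
    show "v \<in> step_functions P {th..b}"
      unfolding step_functions_def mem_Collect_eq
    proof (intro conjI allI ballI impI)
      fix i s s' assume s: "s \<in> {P i..<P (Suc i)} \<inter> {th..b}" "s' \<in> {P i..<P (Suc i)} \<inter> {th..b}"
      have "u n s = u n s'" for n using u(1)[of n] s unfolding step_functions_def by blast
      then have "(\<lambda>n. u (r n) s) \<longlonglongrightarrow> v s'" using v[of s'] by simp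
      then show "v s = v s'" using v[of s] by (rule LIMSEQ_unique[rotated])
    next
      fix s assume "s \<notin> {th..b}"
      then have "u n s = 0" for n using u(1)[of n] by (simp add: step_functions_def)
      then show "v s = 0" using v[of s] by (simp add: LIMSEQ_const_iff)
    qed
  qed
qed

lemma solutions_limit:
  assumes h: "feasible_history th yh" and b: "th \<le> b"
    and u: "\<And>n. u n \<in> borel_measurable (lebesgue_on {th..b})" "\<And>n t. norm (u n t) \<le> umax"
      "\<And>t. (\<lambda>n. u n t) \<longlonglongrightarrow> v t"
    and y: "\<And>n t. t \<in> {t0 - \<sigma>..th} \<Longrightarrow> y n t = yh t" "\<And>n. solves th b (u n) (y n)"
      "\<And>n t. t \<in> {th..b} \<Longrightarrow> norm (y n t - yref t) \<le> \<psi> t"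
  obtains r :: "nat \<Rightarrow> nat" and x where "strict_mono r" "\<And>t. t \<in> {t0 - \<sigma>..b} \<Longrightarrow> (\<lambda>n. y (r n) t) \<longlonglongrightarrow> x t"
    "\<And>t. t \<in> {t0 - \<sigma>..th} \<Longrightarrow> x t = yh t" "solves th b v x"
    "\<And>t. t \<in> {th..b} \<Longrightarrow> norm (x t - yref t) \<le> \<psi> t"
proof -
  have th: "t0 \<le> th" and yhc: "continuous_on {t0 - \<sigma>..th} yh" and yhR: "\<And>t. t \<in> {t0 - \<sigma>..th} \<Longrightarrow> norm (yh t) \<le> R"
    using h by (auto simp: feasible_history_def)
  have yR: "norm (y n t) \<le> R" if "t \<in> {t0 - \<sigma>..b}" for n t
  proof (cases "t \<le> th")
    case True
    then show ?thesis using y(1) yhR that by auto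
  next
    case False
    then show ?thesis using y(3)[of t n] that th t0_nonneg by (intro in_funnel_bound[of t]) auto
  qed
  obtain M where M: "rhs_bound R umax M" by (rule rhs_bound_exists)
  have M0: "0 < M" using M by (simp add: rhs_bound_def)
  have lip: "norm (y n t - y n s) \<le> M * \<bar>t - s\<bar>" if "s \<in> {th..b}" "t \<in> {th..b}" for n s t
    by (rule solves_lipschitz[OF y(2) th M yR u(2) that])
  obtain \<zeta> k where k: "strict_mono (k :: nat \<Rightarrow> nat)"
    and unif: "uniform_limit {th..b} (\<lambda>n. y (k n)) \<zeta> sequentially"
    by (rule equi_lipschitz_convergent_subsequence[of M th b y R])
       (use M0 yR lip th \<sigma>_nonneg in auto)
  define x where "x t = (if t \<le> th then yh t else \<zeta> t)" for t
  have \<zeta>lim: "(\<lambda>n. y (k n) t) \<longlonglongrightarrow> \<zeta> t" if "t \<in> {th..b}" for t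
    by (rule tendsto_uniform_limitI[OF unif that])
  have \<zeta>th: "\<zeta> th = yh th"
  proof -
    have "(\<lambda>n. y (k n) th) \<longlonglongrightarrow> \<zeta> th" using \<zeta>lim b by auto
    moreover have "y (k n) th = yh th" for n using y(1) th \<sigma>_nonneg by auto
    ultimately show ?thesis by (simp add: LIMSEQ_const_iff)
  qed
  have ul: "uniform_limit {t0 - \<sigma>..b} (\<lambda>n. y (k n)) x sequentially"
    unfolding uniform_limit_iff
  proof (intro allI impI)
    fix e :: real assume e: "0 < e"
    then have "\<forall>\<^sub>F n in sequentially. \<forall>s\<in>{th..b}. dist (y (k n) s) (\<zeta> s) < e"
      using unif unfolding uniform_limit_iff by blast
    then show "\<forall>\<^sub>F n in sequentially. \<forall>s\<in>{t0 - \<sigma>..b}. dist (y (k n) s) (x s) < e"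
      by (rule eventually_mono) (use y(1) e in \<open>auto simp: x_def\<close>)
  qed
  have lim: "(\<lambda>n. y (k n) t) \<longlonglongrightarrow> x t" if "t \<in> {t0 - \<sigma>..b}" for t
    by (rule tendsto_uniform_limitI[OF ul that])
  have ulim: "(\<lambda>n. u (k n) t) \<longlonglongrightarrow> v t" for t
    using LIMSEQ_subseq_LIMSEQ[OF u(3) k] by (simp add: o_def)
  obtain r :: "nat \<Rightarrow> nat" where r: "strict_mono r" "continuous_on {t0 - \<sigma>..b} x"
    "\<And>t. t \<in> {th..b} \<Longrightarrow> rhs (stopped b x) v integrable_on {th..t}"
    "\<And>t. t \<in> {th..b} \<Longrightarrow> (\<lambda>n. integral {th..t} (rhs (stopped b (y (k (r n)))) (u (k (r n)))))
        \<longlonglongrightarrow> integral {th..t} (rhs (stopped b x) v)"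
    by (rule rhs_integral_converges_stopped[of b "\<lambda>n. y (k n)" R x th "\<lambda>n. u (k n)" umax v])
       (use solves_continuous[OF y(2)] yR ul th b u(1,2) ulim in auto)
  show ?thesis
  proof (rule that[OF k lim])
    show "x t = yh t" if "t \<in> {t0 - \<sigma>..th}" for t using that by (simp add: x_def)
    show "norm (x t - yref t) \<le> \<psi> t" if t: "t \<in> {th..b}" for t
    proof (rule LIMSEQ_le_const2[OF tendsto_norm[OF tendsto_diff[OF lim tendsto_const]]])
      show "t \<in> {t0 - \<sigma>..b}" using t th \<sigma>_nonneg by auto
      show "\<exists>N. \<forall>n\<ge>N. norm (y (k n) t - yref t) \<le> \<psi> t" using y(3)[OF t] by blast
    qed
    show "solves th b v x"
      unfolding solves_def
    proof (intro conjI ballI r(2))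
      fix t assume t: "t \<in> {th..b}"
      have tt: "t \<in> {t0 - \<sigma>..b}" "th \<in> {t0 - \<sigma>..b}" using t th \<sigma>_nonneg by auto
      have "integral {th..t} (rhs (stopped b (y n)) (u n)) = y n t - y n th" for n
        using y(2)[of n] t by (auto simp: solves_def integral_unique)
      then have "(\<lambda>n. y (k (r n)) t - y (k (r n)) th) \<longlonglongrightarrow> integral {th..t} (rhs (stopped b x) v)"
        using r(4)[OF t] by simp
      moreover have "(\<lambda>n. y (k (r n)) t - y (k (r n)) th) \<longlonglongrightarrow> x t - x th"
        using LIMSEQ_subseq_LIMSEQ[OF lim[OF tt(1)] r(1)] LIMSEQ_subseq_LIMSEQ[OF lim[OF tt(2)] r(1)]
        by (intro tendsto_diff) (auto simp: o_def)
      ultimately have "integral {th..t} (rhs (stopped b x) v) = x t - x th"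
        by (rule LIMSEQ_unique)
      then show "(rhs (stopped b x) v has_integral (x t - x th)) {th..t}"
        using integrable_integral[OF r(3)[OF t]] by simp
    qed
  qed
qed

lemma running_cost_lsc:
  assumes th: "0 \<le> th" and y: "\<And>n. continuous_on {th..th + Th} (y n)"
    and u: "\<And>n. u n \<in> borel_measurable (lebesgue_on {th..th + Th})"
    and lim: "\<And>t. t \<in> {th..th + Th} \<Longrightarrow> (\<lambda>n. y n t) \<longlonglongrightarrow> x t" "\<And>t. t \<in> {th..th + Th} \<Longrightarrow> (\<lambda>n. u n t) \<longlonglongrightarrow> v t"
  shows "running_cost th v x \<le> liminf (\<lambda>n. running_cost th (u n) (y n))"
proof -
  have "(\<lambda>n. ennreal (l t (y n t) (u n t))) \<longlonglongrightarrow> ennreal (l t (x t) (v t))" if t: "t \<in> {th..th + Th}" for t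
  proof -
    have "continuous_on UNIV (\<lambda>p. (\<lambda>(t, y, u). l t y u) (t, fst p, snd p))"
      by (rule continuous_on_compose2[OF l_continuous]) (use t th in \<open>auto intro!: continuous_intros\<close>)
    then have "isCont (\<lambda>p. l t (fst p) (snd p)) (x t, v t)"
      by (simp add: continuous_on_eq_continuous_at case_prod_beta')
    from isCont_tendsto_compose[OF this tendsto_Pair[OF lim(1)[OF t] lim(2)[OF t]]]
    show ?thesis by (intro tendsto_ennrealI) simp
  qed
  then have "running_cost th v x = (\<integral>\<^sup>+ t. liminf (\<lambda>n. ennreal (l t (y n t) (u n t))) \<partial>lebesgue_on {th..th + Th})"
    unfolding running_cost_def by (intro nn_integral_cong lim_imp_Liminf[symmetric]) auto
  also have "\<dots> \<le> liminf (\<lambda>n. running_cost th (u n) (y n))"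
    unfolding running_cost_def
    by (rule nn_integral_liminf) (rule running_cost_measurable[OF th y u])
  finally show ?thesis .
qed

text \<open>The direct method. Restricting to pairs of finite cost loses nothing and gives compactness.\<close>

lemma ocp_solution_exists:
  assumes h: "feasible_history th yh"
  obtains p where "ocp_solution t0 \<sigma> (f, g, Op) yref \<psi> l umax P Th th yh p"
    "cost yref \<psi> l Th th p < \<infinity>"
proof -
  let ?b = "th + Th" and ?cost = "cost yref \<psi> l Th th"
  obtain i0 where i0: "th = P i0" and th: "t0 \<le> th" using h by (auto simp: feasible_history_def)
  have th0: "0 \<le> th" using th t0_nonneg by simp
  have b: "th \<le> ?b" using Th_pos by simp
  define fin where "fin = {p \<in> adm th yh. ?cost p < \<infinity>}"
  obtain p0 where p0: "p0 \<in> adm th yh" "?cost p0 < \<infinity>" by (rule feasible_finite_cost[OF h])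
  then have "fin \<noteq> {}" unfolding fin_def by blast
  then have ne: "?cost ` fin \<noteq> {}" by blast
  obtain s where s: "\<And>n. s n \<in> ?cost ` fin" "s \<longlonglongrightarrow> Inf (?cost ` fin)"
    using Inf_as_limit[OF ne] by blast
  have "\<exists>u y \<omega>. (u, y, \<omega>) \<in> fin \<and> s n = ?cost (u, y, \<omega>)" for n
    using s(1)[of n] by (metis (no_types, opaque_lifting) imageE prod_cases3)
  then obtain u y \<omega> where p: "\<And>n. (u n, y n, \<omega> n) \<in> fin" "\<And>n. s n = ?cost (u n, y n, \<omega> n)"
    by metis
  have pa: "(u n, y n, \<omega> n) \<in> adm th yh" "?cost (u n, y n, \<omega> n) < \<infinity>" for n
    using p(1)[of n] by (auto simp: fin_def)
  note F = finite_cost_imp_in_funnel[OF h pa]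
  \<comment> \<open>The essential bound says nothing about the single value at the end of the horizon, which could be
     unbounded along the sequence; large values are cut off.\<close>
  define w where "w n t = (if norm (u n t) \<le> umax then u n t else 0)" for n t
  have wu: "w n t = u n t" if "t \<in> {th..<?b}" for n t
    using F(5)[OF that] by (simp add: w_def)
  have ws: "w n \<in> step_functions P {th..?b}" for n
  proof -
    have us: "u n \<in> step_functions P {th..?b}" using pa(1)[of n] by (simp add: ocp_admissible_def)
    show ?thesis unfolding step_functions_def mem_Collect_eq
    proof (intro conjI allI ballI impI)
      fix i s s' assume "s \<in> {P i..<P (Suc i)} \<inter> {th..?b}" "s' \<in> {P i..<P (Suc i)} \<inter> {th..?b}"
      then have "u n s = u n s'" using us unfolding step_functions_def by blast
      then show "w n s = w n s'" by (simp add: w_def)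
    next
      fix s assume "s \<notin> {th..?b}"
      then have "u n s = 0" using us unfolding step_functions_def by blast
      then show "w n s = 0" by (simp add: w_def)
    qed
  qed
  have wb: "norm (w n t) \<le> umax" for n t using umax by (simp add: w_def)
  have wsol: "solves th ?b (w n) (y n)" for n
  proof (rule solves_cong[OF F(2)[of n] th b])
    show "u n s = w n s" if "s \<in> {th..<?b}" for s using wu[OF that] by simp
  qed simp
  obtain r1 v where r1: "strict_mono (r1 :: nat \<Rightarrow> nat)" "\<And>t. (\<lambda>n. w (r1 n) t) \<longlonglongrightarrow> v t"
    "v \<in> step_functions P {th..?b}" "\<And>t. norm (v t) \<le> umax"
    by (rule step_functions_limit[OF i0 ws wb]) (rule that; assumption)
  have wm: "w n \<in> borel_measurable (lebesgue_on {th..?b})" for n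
    by (rule step_functions_measurable[OF P ws th])
  obtain r2 x where r2: "strict_mono (r2 :: nat \<Rightarrow> nat)" "\<And>t. t \<in> {t0 - \<sigma>..?b} \<Longrightarrow> (\<lambda>n. y (r1 (r2 n)) t) \<longlonglongrightarrow> x t"
    "\<And>t. t \<in> {t0 - \<sigma>..th} \<Longrightarrow> x t = yh t" "solves th ?b v x"
    "\<And>t. t \<in> {th..?b} \<Longrightarrow> norm (x t - yref t) \<le> \<psi> t"
    by (rule solutions_limit[OF h b wm wb r1(2) F(3) wsol F(4)], assumption, assumption) (rule that; assumption)
  obtain p' where p': "p' \<in> adm th yh" "?cost p' = running_cost th v x"
    by (rule admissible_of_solves[OF h r1(3,4) r2(3-5)], assumption+)
  have "?cost p' = running_cost th v x" by (rule p'(2))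
  also have "\<dots> \<le> liminf (\<lambda>n. running_cost th (w (r1 (r2 n))) (y (r1 (r2 n))))"
  proof (rule running_cost_lsc[OF th0 _ wm])
    show "continuous_on {th..?b} (y (r1 (r2 n)))" for n
      by (rule continuous_on_subset[OF solves_continuous[OF wsol]]) (use th \<sigma>_nonneg in auto)
    show "(\<lambda>n. y (r1 (r2 n)) t) \<longlonglongrightarrow> x t" if "t \<in> {th..?b}" for t
      using r2(2)[of t] that th \<sigma>_nonneg by auto
    show "(\<lambda>n. w (r1 (r2 n)) t) \<longlonglongrightarrow> v t" for t
      using LIMSEQ_subseq_LIMSEQ[OF r1(2) r2(1)] by (simp add: o_def)
  qed
  also have "(\<lambda>n. running_cost th (w (r1 (r2 n))) (y (r1 (r2 n)))) = (\<lambda>n. s (r1 (r2 n)))"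
  proof
    fix n
    let ?n = "r1 (r2 n)"
    have "s ?n = running_cost th (u ?n) (y ?n)"
      unfolding p(2) by (rule cost_eq_running_cost[OF less_imp_le[OF F(1)]]) (use F(4) in auto)
    also have "\<dots> = running_cost th (w ?n) (y ?n)"
      by (rule running_cost_cong) (use wu in auto)
    finally show "running_cost th (w ?n) (y ?n) = s ?n" by simp
  qed
  also have "liminf (\<lambda>n. s (r1 (r2 n))) = Inf (?cost ` fin)"
    using LIMSEQ_subseq_LIMSEQ[OF s(2) strict_mono_o[OF r1(1) r2(1)]]
    by (intro lim_imp_Liminf) (auto simp: o_def)
  finally have le: "?cost p' \<le> Inf (?cost ` fin)" .
  have opt: "?cost p' \<le> ?cost p1" if "p1 \<in> adm th yh" for p1
  proof (cases "?cost p1 < \<infinity>")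
    case True
    then have "Inf (?cost ` fin) \<le> ?cost p1" using that by (intro Inf_lower) (auto simp: fin_def)
    then show ?thesis using le by simp
  next
    case False
    then show ?thesis by (simp add: less_top[symmetric])
  qed
  have "?cost p' < \<infinity>" by (rule le_less_trans[OF opt[OF p0(1)] p0(2)])
  then show ?thesis using p'(1) opt by (intro that[of p']) (auto simp: ocp_solution_def)
qed

end

section \<open>The closed loop\<close>

context mpc_problem
begin

abbreviation grid_time :: "nat \<Rightarrow> real" where
  "grid_time k \<equiv> t0 + real k * \<delta>"

abbreviation ocp_sol where
  "ocp_sol \<equiv> ocp_solution t0 \<sigma> (f, g, Op) yref \<psi> l umax P Th"

abbreviation step where
  "step \<equiv> mpc_step t0 \<sigma> (f, g, Op) yref \<psi> l umax P Th \<delta>"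

abbreviation run where
  "run \<equiv> mpc_run t0 \<sigma> (f, g, Op) yref \<psi> l umax P Th \<delta>"

abbreviation global_solution where
  "global_solution \<equiv> mpc_global_solution t0 \<sigma> (f, g, Op) yref \<psi> l umax P Th \<delta>"

lemma grid_time_mono: "k \<le> n \<Longrightarrow> grid_time k \<le> grid_time n"
  using \<delta> by simp

lemma grid_time_ge: "t0 \<le> grid_time k"
  using \<delta> by simp

lemma grid_time_unbounded: "\<exists>k. t < grid_time k"
proof -
  obtain k where "(t - t0) / \<delta> < real k" using reals_Archimedean2 by blast
  then show ?thesis using \<delta> by (intro exI[of _ k]) (simp add: field_simps)
qed

lemma ocp_sol_history_cong:
  assumes "\<And>s. s \<in> {t0 - \<sigma>..th} \<Longrightarrow> y s = y' s"
  shows "ocp_sol th y p \<longleftrightarrow> ocp_sol th y' p"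
proof -
  have "sol th y u x \<omega> \<longleftrightarrow> sol th y' u x \<omega>" for u x \<omega>
    using assms by (auto simp: solution_def)
  then have "adm th y = adm th y'"
    by (simp add: ocp_admissible_def maximal_solution_def)
  then show ?thesis by (simp add: ocp_solution_def)
qed

lemma mpc_step_cong:
  assumes y: "\<And>s. s \<le> grid_time (Suc k) \<Longrightarrow> y s = y' s" and u: "\<And>s. s < grid_time (Suc k) \<Longrightarrow> u s = u' s"
  shows "step y u k \<Longrightarrow> step y' u' k"
proof -
  assume "step y u k"
  then obtain u1 y1 \<omega> where *: "ocp_sol (grid_time k) y (u1, y1, \<omega>)" "ereal (grid_time k + \<delta>) < \<omega>"
    "\<forall>t\<in>{grid_time k..<grid_time k + \<delta>}. u t = u1 t" "\<forall>t\<in>{grid_time k..grid_time k + \<delta>}. y t = y1 t"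
    unfolding mpc_step_def Let_def by blast
  have e: "grid_time (Suc k) = grid_time k + \<delta>" by (simp add: algebra_simps)
  have "ocp_sol (grid_time k) y' (u1, y1, \<omega>)"
    using *(1) by (subst (asm) ocp_sol_history_cong[of _ y y']) (use y \<delta> e in auto)
  moreover have "\<forall>t\<in>{grid_time k..<grid_time k + \<delta>}. u' t = u1 t" "\<forall>t\<in>{grid_time k..grid_time k + \<delta>}. y' t = y1 t"
    using *(3,4) u y unfolding e by auto
  ultimately show "step y' u' k"
    using *(2) unfolding mpc_step_def Let_def by blast
qed

lemma ocp_sol_finite_cost:
  assumes h: "feasible_history th yh" and p: "ocp_sol th yh p"
  shows "cost yref \<psi> l Th th p < \<infinity>"
proof -
  obtain p0 where p0: "p0 \<in> adm th yh" "cost yref \<psi> l Th th p0 < \<infinity>" by (rule feasible_finite_cost[OF h])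
  have "cost yref \<psi> l Th th p \<le> cost yref \<psi> l Th th p0" using p p0(1) by (simp add: ocp_solution_def)
  then show ?thesis using p0(2) by (rule le_less_trans)
qed

lemma mpc_step_solves:
  assumes h: "feasible_history (grid_time k) y" and s: "step y u k"
  shows "solves (grid_time k) (grid_time (Suc k)) u y"
    "\<And>t. t \<in> {grid_time k..grid_time (Suc k)} \<Longrightarrow> norm (y t - yref t) \<le> \<psi> t"
    "\<And>t. t \<in> {grid_time k..<grid_time (Suc k)} \<Longrightarrow> norm (u t) \<le> umax"
proof -
  let ?th = "grid_time k"
  have e: "grid_time (Suc k) = ?th + \<delta>" by (simp add: algebra_simps)
  obtain u1 y1 \<omega> where *: "ocp_sol ?th y (u1, y1, \<omega>)"
    "\<And>t. t \<in> {?th..<?th + \<delta>} \<Longrightarrow> u t = u1 t" "\<And>t. t \<in> {?th..?th + \<delta>} \<Longrightarrow> y t = y1 t"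
    using s unfolding mpc_step_def Let_def by blast
  have "(u1, y1, \<omega>) \<in> adm ?th y" using *(1) by (simp add: ocp_solution_def)
  note F = finite_cost_imp_in_funnel[OF h this ocp_sol_finite_cost[OF h *(1)]]
  have "solves ?th (?th + \<delta>) u1 y1"
    by (rule solves_restrict[OF F(2) grid_time_ge]) (use \<delta> Th in auto)
  then have "solves ?th (?th + \<delta>) u y"
  proof (rule solves_cong)
    fix t assume t: "t \<in> {t0 - \<sigma>..?th + \<delta>}"
    show "y1 t = y t"
      using F(3)[of t] *(3)[of t] t by (cases "t \<le> ?th") auto
  qed (use *(2) \<delta> in auto)
  then show "solves ?th (grid_time (Suc k)) u y" by (simp only: e)
  show "norm (y t - yref t) \<le> \<psi> t" if "t \<in> {?th..grid_time (Suc k)}" for t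
    using F(4)[of t] *(3)[of t] that Th unfolding e by auto
  show "norm (u t) \<le> umax" if "t \<in> {?th..<grid_time (Suc k)}" for t
    using F(5)[of t] *(2)[of t] that Th unfolding e by auto
qed

text \<open>Recursive feasibility: the applied part of an optimal response stays in the funnel and ends at a
  partition point.\<close>

lemma mpc_run_invariant:
  assumes h0: "feasible_history t0 y0" and r: "run y0 y u k"
  shows "feasible_history (grid_time k) y \<and> solves t0 (grid_time k) u y \<and>
    (\<forall>t\<in>{t0..grid_time k}. norm (y t - yref t) \<le> \<psi> t) \<and> (\<forall>t\<in>{t0..<grid_time k}. norm (u t) \<le> umax)"
  using r
proof (induction k)
  case 0
  have y: "y s = y0 s" if "s \<in> {t0 - \<sigma>..t0}" for s using 0 that by (simp add: mpc_run_def)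
  have "continuous_on {t0 - \<sigma>..t0} y"
    by (rule continuous_on_eq[of _ y0]) (use h0 y in \<open>auto simp: feasible_history_def\<close>)
  moreover have "y t0 = y0 t0" using y \<sigma>_nonneg by auto
  ultimately have "feasible_history t0 y" using h0 y by (auto simp: feasible_history_def)
  then show ?case by (auto simp: feasible_history_def solves_def)
next
  case (Suc k)
  have run_k: "run y0 y u k" and s: "step y u k"
    using Suc.prems by (auto simp: mpc_run_def)
  have IH: "feasible_history (grid_time k) y" "solves t0 (grid_time k) u y"
    "\<And>t. t \<in> {t0..grid_time k} \<Longrightarrow> norm (y t - yref t) \<le> \<psi> t"
    "\<And>t. t \<in> {t0..<grid_time k} \<Longrightarrow> norm (u t) \<le> umax"
    using Suc.IH[OF run_k] by auto
  note S = mpc_step_solves[OF IH(1) s]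
  have le: "t0 \<le> grid_time k" "grid_time k \<le> grid_time (Suc k)" "t0 \<le> grid_time (Suc k)"
    by (rule grid_time_ge, rule grid_time_mono, simp, rule grid_time_ge)
  have slv: "solves t0 (grid_time (Suc k)) u y"
    by (rule solves_append[OF IH(2) S(1) order_refl le(1,2)])
  have in_f: "norm (y t - yref t) \<le> \<psi> t" if "t \<in> {t0..grid_time (Suc k)}" for t
    using IH(3)[of t] S(2)[of t] that by (cases "t \<le> grid_time k") auto
  have ub: "norm (u t) \<le> umax" if "t \<in> {t0..<grid_time (Suc k)}" for t
    using IH(4)[of t] S(3)[of t] that by (cases "t < grid_time k") auto
  have "norm (y t) \<le> R" if t: "t \<in> {t0 - \<sigma>..grid_time (Suc k)}" for t
  proof (cases "t \<le> grid_time k")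
    case True
    then show ?thesis using IH(1) t by (auto simp: feasible_history_def)
  next
    case False
    then have "t0 \<le> t" using le by simp
    then show ?thesis using in_f[of t] t t0_nonneg by (intro in_funnel_bound[of t]) auto
  qed
  moreover have "norm (y (grid_time (Suc k)) - yref (grid_time (Suc k))) \<le> \<psi> (grid_time (Suc k))"
    using in_f le by auto
  ultimately have "feasible_history (grid_time (Suc k)) y"
    using solves_continuous[OF slv] grid[of "Suc k"] le(3) unfolding feasible_history_def by blast
  then show ?case using slv in_f ub by blast
qed

lemma mpc_run_extend:
  assumes h0: "feasible_history t0 y0" and r: "run y0 y u k"
  obtains y' u' where "run y0 y' u' (Suc k)"
    "\<And>t. t \<le> grid_time k \<Longrightarrow> y' t = y t" "\<And>t. t < grid_time k \<Longrightarrow> u' t = u t"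
proof -
  let ?th = "grid_time k"
  have h: "feasible_history ?th y" using mpc_run_invariant[OF h0 r] by blast
  obtain p where p: "ocp_sol ?th y p" by (rule ocp_solution_exists[OF h])
  obtain u1 y1 \<omega> where p1: "p = (u1, y1, \<omega>)" by (cases p)
  have a: "(u1, y1, \<omega>) \<in> adm ?th y" using p p1 by (simp add: ocp_solution_def)
  note F = finite_cost_imp_in_funnel[OF h a ocp_sol_finite_cost[OF h p, unfolded p1]]
  define y' where "y' t = (if t \<le> ?th then y t else y1 t)" for t
  define u' where "u' t = (if t < ?th then u t else u1 t)" for t
  have y1th: "y1 ?th = y ?th" using F(3)[of ?th] grid_time_ge[of k] \<sigma>_nonneg by auto
  have old: "step y' u' j" if j: "j < k" for j
  proof (rule mpc_step_cong[of j y y' u u'])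
    have "grid_time (Suc j) \<le> ?th" by (rule grid_time_mono) (use j in simp)
    then show "y s = y' s" if "s \<le> grid_time (Suc j)" for s using that by (simp add: y'_def)
    show "u s = u' s" if "s < grid_time (Suc j)" for s
      using that \<open>grid_time (Suc j) \<le> ?th\<close> by (simp add: u'_def)
    show "step y u j" using r j by (simp add: mpc_run_def)
  qed
  have "ereal (?th + \<delta>) < \<omega>"
    by (rule le_less_trans[OF _ F(1)]) (use Th in simp)
  moreover have "ocp_sol ?th y' (u1, y1, \<omega>)"
    using p p1 by (subst ocp_sol_history_cong[of _ y' y]) (auto simp: y'_def)
  moreover have "\<forall>t\<in>{?th..<?th + \<delta>}. u' t = u1 t" by (simp add: u'_def)
  moreover have "\<forall>t\<in>{?th..?th + \<delta>}. y' t = y1 t" using y1th by (auto simp: y'_def)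
  ultimately have new: "step y' u' k" unfolding mpc_step_def Let_def by blast
  have "y' s = y0 s" if "s \<in> {t0 - \<sigma>..t0}" for s
    using r that grid_time_ge[of k] by (auto simp: mpc_run_def y'_def)
  then have "run y0 y' u' (Suc k)"
    using old new by (auto simp: mpc_run_def less_Suc_eq)
  then show ?thesis by (rule that) (auto simp: y'_def u'_def)
qed

lemma mpc_global_run:
  assumes "global_solution y0 y u"
  shows "run y0 y u k"
  using assms by (auto simp: mpc_global_solution_def mpc_run_def solution_def)

lemma mpc_global_bounds:
  assumes h0: "feasible_history t0 y0" and glob: "global_solution y0 y u"
    and t: "t0 \<le> t"
  shows "norm (u t) \<le> umax" "norm (y t - yref t) \<le> \<psi> t"
proof -
  obtain k where "t < grid_time k" using grid_time_unbounded by blast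
  then show "norm (u t) \<le> umax" "norm (y t - yref t) \<le> \<psi> t"
    using mpc_run_invariant[OF h0 mpc_global_run[OF glob, of k]] t by auto
qed

lemma mpc_global_solution_exists:
  assumes h0: "feasible_history t0 y0"
  shows "\<exists>y u. global_solution y0 y u"
proof -
  have "\<exists>X. \<forall>n. run y0 (fst (X n)) (snd (X n)) n \<and>
      ((\<forall>t\<le>grid_time n. fst (X (Suc n)) t = fst (X n) t) \<and> (\<forall>t<grid_time n. snd (X (Suc n)) t = snd (X n) t))"
  proof (rule dependent_nat_choice)
    show "\<exists>x. run y0 (fst x) (snd x) 0"
      by (rule exI[of _ "(y0, \<lambda>_. 0)"]) (simp add: mpc_run_def)
  next
    fix x n assume r: "run y0 (fst x) (snd x) n"
    obtain y' u' where "run y0 y' u' (Suc n)" "\<And>t. t \<le> grid_time n \<Longrightarrow> y' t = fst x t"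
       "\<And>t. t < grid_time n \<Longrightarrow> u' t = snd x t"
      using mpc_run_extend[OF h0 r] by blast
    then show "\<exists>x'. run y0 (fst x') (snd x') (Suc n) \<and>
       ((\<forall>t\<le>grid_time n. fst x' t = fst x t) \<and> (\<forall>t<grid_time n. snd x' t = snd x t))"
      by (intro exI[of _ "(y', u')"]) auto
  qed
  then obtain X where X: "\<And>n. run y0 (fst (X n)) (snd (X n)) n"
    "\<And>n t. t \<le> grid_time n \<Longrightarrow> fst (X (Suc n)) t = fst (X n) t"
    "\<And>n t. t < grid_time n \<Longrightarrow> snd (X (Suc n)) t = snd (X n) t" by blast
  have stable: "(t \<le> grid_time n \<longrightarrow> fst (X m) t = fst (X n) t) \<and> (t < grid_time n \<longrightarrow> snd (X m) t = snd (X n) t)"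
    if "n \<le> m" for n m t
    using that
  proof (induction m rule: dec_induct)
    case (step m)
    have "grid_time n \<le> grid_time m" by (rule grid_time_mono) (use step in simp)
    then show ?case using step.IH X(2)[of t m] X(3)[of t m] by auto
  qed simp
  \<comment> \<open>Later runs do not change the past, so their values at a fixed time are eventually constant.\<close>
  define N where "N t = (SOME k. t < grid_time k)" for t
  have N: "t < grid_time (N t)" for t unfolding N_def by (rule someI_ex[OF grid_time_unbounded])
  define y where "y t = fst (X (N t)) t" for t
  define u where "u t = snd (X (N t)) t" for t
  have y: "y t = fst (X n) t" if "t \<le> grid_time n" for t n
    using stable[of n "max n (N t)" t] stable[of "N t" "max n (N t)" t] that N[of t] by (auto simp: y_def)
  have u: "u t = snd (X n) t" if "t < grid_time n" for t n
    using stable[of n "max n (N t)" t] stable[of "N t" "max n (N t)" t] that N[of t] by (auto simp: u_def)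
  have steps: "step y u k" for k
  proof (rule mpc_step_cong[of k "fst (X (Suc k))" y "snd (X (Suc k))" u])
    show "step (fst (X (Suc k))) (snd (X (Suc k))) k"
      using X(1)[of "Suc k"] by (simp add: mpc_run_def)
    show "fst (X (Suc k)) s = y s" if "s \<le> grid_time (Suc k)" for s by (rule y[OF that, symmetric])
    show "snd (X (Suc k)) s = u s" if "s < grid_time (Suc k)" for s by (rule u[OF that, symmetric])
  qed
  have init: "y s = y0 s" if s: "s \<in> {t0 - \<sigma>..t0}" for s
    using X(1)[of 0] y[of s 0] s by (simp add: mpc_run_def)
  have r: "run y0 y u k" for k
    using steps init by (simp add: mpc_run_def)
  note inv = mpc_run_invariant[OF h0 r]
  have "sol t0 y0 u y \<infinity>"
  proof (rule solves_imp_solution[OF order_refl _ init])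
    fix s assume s: "t0 \<le> s"
    obtain k where k: "s < grid_time k" using grid_time_unbounded by blast
    show "solves t0 s u y"
      by (rule solves_restrict[of t0 "grid_time k"]) (use inv[of k] k s in auto)
    show "\<exists>U. \<forall>t\<in>{t0..<s}. norm (u t) \<le> U"
      using inv[of k] k by (intro exI[of _ umax]) auto
  qed auto
  then show ?thesis using steps by (auto simp: mpc_global_solution_def)
qed

end

theorem mainTheorem1:
  fixes t0 \<sigma> :: real
    and f :: "real^'q::finite \<Rightarrow> real^'m::finite"
    and g :: "real^'q \<Rightarrow> real^'m^'m"
    and Op :: "('m, 'q) operator"
    and y0 yref :: "real \<Rightarrow> real^'m"
    and \<psi> :: "real \<Rightarrow> real"
    and l :: "real \<Rightarrow> real^'m \<Rightarrow> real^'m \<Rightarrow> real"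
  assumes "0 \<le> t0" and "0 \<le> \<sigma>"
    and "(f, g, Op) \<in> system_class t0 \<sigma>"
    and "continuous_on {t0 - \<sigma>..t0} y0"
    and "\<psi> \<in> funnel_functions"
    and "yref \<in> W1inf {0..}"
    and "continuous_on ({0..} \<times> UNIV \<times> UNIV) (\<lambda>(t, y, u). l t y u)"
    and "\<And>t y u. 0 \<le> t \<Longrightarrow> 0 \<le> l t y u"
    and initial_error: "norm (y0 t0 - yref t0) \<le> \<psi> t0"
    and operator_continuity: "continuous_op t0 \<sigma> Op"
  shows "\<exists>umax>0. \<exists>\<tau>>0. \<forall>\<delta>>0. \<forall>Th\<ge>\<delta>. \<forall>P.
    partition_from t0 P \<and> mesh P \<le> ereal \<tau> \<and>
    (\<exists>r. strict_mono r \<and> (\<forall>k::nat. P (r k) = t0 + real k * \<delta>)) \<longrightarrow>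
      (\<forall>k y u. mpc_run t0 \<sigma> (f, g, Op) yref \<psi> l umax P Th \<delta> y0 y u k \<longrightarrow>
         (\<exists>p. ocp_solution t0 \<sigma> (f, g, Op) yref \<psi> l umax P Th (t0 + real k * \<delta>) y p \<and>
              cost yref \<psi> l Th (t0 + real k * \<delta>) p < \<infinity>)) \<and>
      (\<exists>y u. mpc_global_solution t0 \<sigma> (f, g, Op) yref \<psi> l umax P Th \<delta> y0 y u) \<and>
      (\<forall>y u. mpc_global_solution t0 \<sigma> (f, g, Op) yref \<psi> l umax P Th \<delta> y0 y u \<longrightarrow>
         (\<forall>t\<ge>t0. norm (u t) \<le> umax) \<and>
         (\<forall>t\<ge>t0. norm (y t - yref t) \<le> \<psi> t))"
proof -
  interpret control_system t0 \<sigma> f g Op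
    by unfold_locales (use assms in auto)
  have \<psi>W: "\<psi> \<in> W1inf {0..}" and \<psi>pos: "0 < (INF s\<in>{0..}. \<psi> s)"
    using assms(5) by (auto simp: funnel_functions_def)
  obtain B\<psi> where B\<psi>: "\<And>t. 0 \<le> t \<Longrightarrow> norm (\<psi> t) \<le> B\<psi>" by (rule W1inf_bounded[OF \<psi>W]) blast
  obtain L\<psi> where L\<psi>: "0 < L\<psi>" "\<And>s t. \<lbrakk>0 \<le> s; 0 \<le> t\<rbrakk> \<Longrightarrow> norm (\<psi> t - \<psi> s) \<le> L\<psi> * \<bar>t - s\<bar>"
    by (rule W1inf_lipschitz[OF \<psi>W]) blast
  obtain Br where Br: "\<And>t. 0 \<le> t \<Longrightarrow> norm (yref t) \<le> Br" by (rule W1inf_bounded[OF assms(6)]) blast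
  obtain Lr where Lr: "0 < Lr" "\<And>s t. \<lbrakk>0 \<le> s; 0 \<le> t\<rbrakk> \<Longrightarrow> norm (yref t - yref s) \<le> Lr * \<bar>t - s\<bar>"
    by (rule W1inf_lipschitz[OF assms(6)]) blast
  obtain R0 where R0: "\<And>t. t \<in> {t0 - \<sigma>..t0} \<Longrightarrow> norm (y0 t) \<le> R0"
    using continuous_on_Icc_bounded[OF assms(4)] by blast
  define R where "R = max R0 (B\<psi> + Br)"
  have R: "\<psi> t + norm (yref t) \<le> R" if "0 \<le> t" for t
    using B\<psi>[OF that] Br[OF that] by (auto simp: R_def)
  have R0R: "norm (y0 t) \<le> R" if "t \<in> {t0 - \<sigma>..t0}" for t
    using R0[OF that] by (simp add: R_def)
  have "bdd_below (\<psi> ` {0..})"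
    using B\<psi> by (intro bdd_belowI2[of _ "- B\<psi>"]) (force simp: abs_le_iff)
  then have \<psi>m: "(INF s\<in>{0..}. \<psi> s) \<le> \<psi> t" if "0 \<le> t" for t
    using that by (intro cINF_lower) auto
  have L\<psi>': "\<bar>\<psi> t - \<psi> s\<bar> \<le> L\<psi> * \<bar>t - s\<bar>" if "0 \<le> s" "0 \<le> t" for s t
    using L\<psi>(2)[OF that] by simp
  obtain umax \<tau> where umax: "0 < umax" and \<tau>: "0 < \<tau>"
    and one_step: "keeps_in_funnel yref \<psi> R umax \<tau>"
    by (rule funnel_step[OF \<psi>pos \<psi>m L\<psi>(1) L\<psi>' Lr, where R=R], assumption+)
  show ?thesis
  proof (rule exI[of _ umax], rule conjI[OF umax], rule exI[of _ \<tau>], rule conjI[OF \<tau>],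
      intro allI impI, elim conjE exE)
    fix \<delta> Th :: real and P :: "nat \<Rightarrow> real" and r :: "nat \<Rightarrow> nat"
    assume \<delta>: "0 < \<delta>" "\<delta> \<le> Th" and P: "partition_from t0 P" "mesh P \<le> ereal \<tau>"
      and r: "\<forall>k::nat. P (r k) = t0 + real k * \<delta>"
    have "ereal (P (Suc i) - P i) \<le> ereal \<tau>" for i
      using P(2) unfolding mesh_def by (rule SUP_le_iff[THEN iffD1, rule_format]) simp
    then have P_step: "P (Suc i) \<le> P i + \<tau>" for i by (simp add: algebra_simps)
    interpret mpc_problem t0 \<sigma> f g Op yref \<psi> l umax \<tau> R \<delta> Th P
    proof unfold_locales
      show "continuous_on ({0..} \<times> UNIV \<times> UNIV) (\<lambda>(t, y, u). l t y u)" by (rule assms(7))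
      show "continuous_on {0..} \<psi>" "continuous_on {0..} yref"
        using \<psi>W assms(6) by (auto simp: W1inf_def)
      show "\<exists>i. P i = t0 + real k * \<delta>" for k :: nat using r by blast
    qed (fact R umax one_step \<delta> P(1) P_step)+
    have "\<exists>i. P i = t0" using P(1) by (auto simp: partition_from_def)
    then have h0: "feasible_history t0 y0"
      using assms(4) R0R initial_error unfolding feasible_history_def by blast
    show "(\<forall>k y u. run y0 y u k \<longrightarrow>
         (\<exists>p. ocp_sol (grid_time k) y p \<and> cost yref \<psi> l Th (grid_time k) p < \<infinity>)) \<and>
      (\<exists>y u. global_solution y0 y u) \<and>
      (\<forall>y u. global_solution y0 y u \<longrightarrow>
         (\<forall>t\<ge>t0. norm (u t) \<le> umax) \<and> (\<forall>t\<ge>t0. norm (y t - yref t) \<le> \<psi> t))"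
    proof (intro conjI allI impI)
      fix k y u assume "run y0 y u k"
      then have "feasible_history (grid_time k) y" using mpc_run_invariant[OF h0] by blast
      then show "\<exists>p. ocp_sol (grid_time k) y p \<and> cost yref \<psi> l Th (grid_time k) p < \<infinity>"
        by (rule ocp_solution_exists) blast
    qed (use mpc_global_solution_exists[OF h0] mpc_global_bounds[OF h0] in blast)+
  qed
qed

end
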